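(* Let $g\ge 1$, $k\ge 2$, $r\ge 0$, $d\ge 0$ be integers with $g-d+r>0$, and let $\ell$ be an integer with $1\le \ell\le k-1$. If $k$ and $\ell$ are relatively prime, then $$\dim W^r_d(\Gamma_{g,k,\ell})=\overline{\rho}_{g,k}(d,r),$$ where, by convention, if $\overline{\rho}_{g,k}(d,r)<0$ this means that $W^r_d(\Gamma_{g,k,\ell})=\emptyset$.
   Context: $\Gamma_{g,k,\ell}$ is the metric graph with vertices $w_0,w_1,\dots,w_g$ in which, for each $i=0,\dots,g-1$, the vertices $w_i$ and $w_{i+1}$ are joined by exactly two edges, one of length $\ell$ (the top edge) and one of length $k-\ell$ (the bottom edge), and there are no other edges. Thus it is a chain of $g$ cycles, consecutive cycles sharing a single vertex. For a metric graph $\Gamma$, divisors are finite formal $\mathbf{Z}$-linear combinations of points of $\Gamma$; two divisors are linearly equivalent if they differ by the divisor of a continuous piecewise-linear function with integer slopes; $\operatorname{Pic}^d(\Gamma)$ is the set of linear equivalence classes of divisors of degree $d$ (a torsor for a real torus of dimension equal to the first Betti number of $\Gamma$). The Baker-Norine rank of a divisor $D$ is the largest integer $s\ge -1$ such that $D-E$ is linearly equivalent to an effective divisor for every effective divisor $E$ of degree $s$ (rank $-1$ if $D$ is not equivalent to an effective divisor). $W^r_d(\Gamma)\subseteq\operatorname{Pic}^d(\Gamma)$ is the set of classes of degree $d$ divisors of rank at least $r$; its dimension is its dimension as a polyhedral subset of the torus $\operatorname{Pic}^d(\Gamma)$ (the maximum of the dimensions of its polyhedral pieces). Put $\rho_g(d,s)=g-(s+1)(g-d+s)$,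 let $r'=\min(r,\,g-d+r-1)$, and define $$\overline{\rho}_{g,k}(d,r)=\max_{j\in\{0,1,\dots,r'\}}\bigl(\rho_g(d,r-j)-jk\bigr).$$ *)

theory Defs
  imports "HOL-Analysis.Analysis" "HOL-Analysis.Finite_Function_Topology"
begin

section \<open>Metric graphs\<close>

text \<open>
  A metric graph is given by a finite multigraph with positive edge lengths. Every edge carries an
  auxiliary orientation: arc \<open>e\<close> is a copy of the real interval from \<open>0\<close> (glued to \<open>tail e\<close>) to
  \<open>len e\<close> (glued to \<open>head e\<close>). No notion below depends on the chosen orientation.
\<close>

record ('v, 'e) metric_graph =
  verts :: "'v set"
  arcs :: "'e set"
  tail :: "'e \<Rightarrow> 'v"
  head :: "'e \<Rightarrow> 'v"
  len :: "'e \<Rightarrow> real"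

datatype ('v, 'e) point = Vertex 'v | Interior 'e real

definition points :: "('v, 'e) metric_graph \<Rightarrow> ('v, 'e) point set" where
  "points G = Vertex ` verts G \<union> {Interior e t | e t. e \<in> arcs G \<and> 0 < t \<and> t < len G e}"

text \<open>The parametrization of an edge; it is constant outside of \<open>{0..len G e}\<close>.\<close>

definition edge_point :: "('v, 'e) metric_graph \<Rightarrow> 'e \<Rightarrow> real \<Rightarrow> ('v, 'e) point" where
  "edge_point G e t =
     (if t \<le> 0 then Vertex (tail G e)
      else if t \<ge> len G e then Vertex (head G e)
      else Interior e t)"


section \<open>Divisors and linear equivalence\<close>

type_synonym ('v, 'e) divisor = "('v, 'e) point \<Rightarrow>\<^sub>0 int"

definition divisor_degree :: "('v, 'e) divisor \<Rightarrow> int" where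
  "divisor_degree D = (\<Sum>p\<in>Poly_Mapping.keys D. Poly_Mapping.lookup D p)"

definition divisors :: "('v, 'e) metric_graph \<Rightarrow> int \<Rightarrow> ('v, 'e) divisor set" where
  "divisors G d = {D. Poly_Mapping.keys D \<subseteq> points G \<and> divisor_degree D = d}"

definition effective :: "('v, 'e) divisor \<Rightarrow> bool" where
  "effective D \<longleftrightarrow> (\<forall>p. 0 \<le> Poly_Mapping.lookup D p)"

definition integral_piecewise_linear_on :: "real \<Rightarrow> real \<Rightarrow> (real \<Rightarrow> real) \<Rightarrow> bool" where
  "integral_piecewise_linear_on a b h \<longleftrightarrow>
     continuous_on {a..b} h \<and>
     (\<exists>S. finite S \<and>
        (\<forall>s t. a \<le> s \<and> s < t \<and> t \<le> b \<and> {s<..<t} \<inter> S = {} \<longrightarrow>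
           (\<exists>(m::int) c. \<forall>x\<in>{s<..<t}. h x = of_int m * x + c)))"

text \<open>
  As the graph is a finite union of its closed edges, continuity of a function on it
  is continuity along every edge.
\<close>

definition rational_function :: "('v, 'e) metric_graph \<Rightarrow> (('v, 'e) point \<Rightarrow> real) \<Rightarrow> bool" where
  "rational_function G f \<longleftrightarrow>
     (\<forall>e\<in>arcs G. integral_piecewise_linear_on 0 (len G e) (\<lambda>t. f (edge_point G e t)))"

text \<open>
  The sum of the slopes of \<open>f\<close> along all directions leaving a point. The opposite sign convention
  gives the same principal divisors.
\<close>

fun order_at :: "('v, 'e) metric_graph \<Rightarrow> (('v, 'e) point \<Rightarrow> real) \<Rightarrow> ('v, 'e) point \<Rightarrow> real" where
  "order_at G f (Vertex v) =
     (\<Sum>e | e \<in> arcs G \<and> tail G e = v.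
        vector_derivative (\<lambda>t. f (edge_point G e t)) (at_right 0)) -
     (\<Sum>e | e \<in> arcs G \<and> head G e = v.
        vector_derivative (\<lambda>t. f (edge_point G e t)) (at_left (len G e)))"
| "order_at G f (Interior e s) =
     vector_derivative (\<lambda>t. f (edge_point G e t)) (at_right s) -
     vector_derivative (\<lambda>t. f (edge_point G e t)) (at_left s)"

definition principal :: "('v, 'e) metric_graph \<Rightarrow> ('v, 'e) divisor \<Rightarrow> bool" where
  "principal G D \<longleftrightarrow>
     Poly_Mapping.keys D \<subseteq> points G \<and>
     (\<exists>f. rational_function G f \<and>
          (\<forall>p\<in>points G. of_int (Poly_Mapping.lookup D p) = order_at G f p))"

definition linearly_equivalent ::
    "('v, 'e) metric_graph \<Rightarrow> ('v, 'e) divisor \<Rightarrow> ('v, 'e) divisor \<Rightarrow> bool" where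
  "linearly_equivalent G D D' \<longleftrightarrow> principal G (D - D')"

definition divisor_class ::
    "('v, 'e) metric_graph \<Rightarrow> ('v, 'e) divisor \<Rightarrow> ('v, 'e) divisor set" where
  "divisor_class G D = {D' \<in> divisors G (divisor_degree D). linearly_equivalent G D D'}"

definition Pic :: "('v, 'e) metric_graph \<Rightarrow> int \<Rightarrow> ('v, 'e) divisor set set" where
  "Pic G d = divisor_class G ` divisors G d"


section \<open>Baker-Norine rank and Brill-Noether loci\<close>

definition rank :: "('v, 'e) metric_graph \<Rightarrow> ('v, 'e) divisor \<Rightarrow> int" where
  "rank G D = (GREATEST s. -1 \<le> s \<and>
     (\<forall>E\<in>divisors G s. effective E \<longrightarrow>
        (\<exists>F\<in>divisors G (divisor_degree D - s). effective F \<and> linearly_equivalent G (D - E) F)))"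

definition brill_noether_locus ::
    "('v, 'e) metric_graph \<Rightarrow> int \<Rightarrow> int \<Rightarrow> ('v, 'e) divisor set set" where
  "brill_noether_locus G r d = {C \<in> Pic G d. \<exists>D\<in>C. rank G D \<ge> r}"


section \<open>The torus structure on the Picard group and polyhedral dimension\<close>

text \<open>
  Real 1-cycles (flows), that is \<open>H\<^sub>1(\<Gamma>, \<real>)\<close>; they are also the coefficient vectors of the harmonic
  1-forms on the metric graph.
\<close>

definition real_cycles :: "('v, 'e) metric_graph \<Rightarrow> ('e \<Rightarrow>\<^sub>0 real) set" where
  "real_cycles G = {\<omega>. Poly_Mapping.keys \<omega> \<subseteq> arcs G \<and>
     (\<forall>v\<in>verts G.
        (\<Sum>e | e \<in> arcs G \<and> tail G e = v. Poly_Mapping.lookup \<omega> e) =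
        (\<Sum>e | e \<in> arcs G \<and> head G e = v. Poly_Mapping.lookup \<omega> e))}"

text \<open>The length pairing; it identifies \<open>H\<^sub>1(\<Gamma>, \<real>)\<close> with the dual of the space of harmonic 1-forms.\<close>

definition cycle_pairing ::
    "('v, 'e) metric_graph \<Rightarrow> ('e \<Rightarrow>\<^sub>0 real) \<Rightarrow> ('e \<Rightarrow>\<^sub>0 real) \<Rightarrow> real" where
  "cycle_pairing G \<eta> \<omega> =
     (\<Sum>e\<in>arcs G. len G e * Poly_Mapping.lookup \<eta> e * Poly_Mapping.lookup \<omega> e)"

text \<open>
  Integral 1-chains are formal \<open>\<int>\<close>-linear combinations of oriented segments; \<open>(e, s, t)\<close> is the
  segment of the edge \<open>e\<close> that runs from position \<open>s\<close> to position \<open>t\<close>.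
\<close>

type_synonym 'e chain = "('e \<times> real \<times> real) \<Rightarrow>\<^sub>0 int"

definition chains :: "('v, 'e) metric_graph \<Rightarrow> 'e chain set" where
  "chains G = {c. Poly_Mapping.keys c \<subseteq>
     {(e, s, t). e \<in> arcs G \<and> s \<in> {0..len G e} \<and> t \<in> {0..len G e}}}"

definition chain_boundary :: "('v, 'e) metric_graph \<Rightarrow> 'e chain \<Rightarrow> ('v, 'e) divisor" where
  "chain_boundary G =
     frag_extend (\<lambda>(e, s, t). frag_of (edge_point G e t) - frag_of (edge_point G e s))"

definition chain_integral :: "'e chain \<Rightarrow> ('e \<Rightarrow>\<^sub>0 real) \<Rightarrow> real" where
  "chain_integral c \<omega> =
     (\<Sum>(e, s, t)\<in>Poly_Mapping.keys c.
        of_int (Poly_Mapping.lookup c (e, s, t)) * (t - s) * Poly_Mapping.lookup \<omega> e)"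

text \<open>
  The universal covering \<open>H\<^sub>1(\<Gamma>, \<real>) \<rightarrow> H\<^sub>1(\<Gamma>, \<real>) / H\<^sub>1(\<Gamma>, \<int>) \<cong> Pic\<^sup>d(\<Gamma>)\<close>, where the isomorphism is the
  inverse of the Abel-Jacobi map \<open>D \<mapsto> (\<omega> \<mapsto> \<integral>\<^bsub>D\<^sub>0\<^esub>\<^bsup>D\<^esup> \<omega>)\<close> with base divisor \<open>D\<^sub>0\<close> of degree \<open>d\<close>:
  the point \<open>\<eta>\<close> is sent to the set of all \<open>D\<close> that are joined to \<open>D\<^sub>0\<close> by some integral chain along which
  harmonic forms integrate to their pairing with \<open>\<eta>\<close>. By the tropical Abel-Jacobi theorem
  this set is a linear equivalence class.
\<close>

definition Pic_covering ::
    "('v, 'e) metric_graph \<Rightarrow> ('v, 'e) divisor \<Rightarrow> ('e \<Rightarrow>\<^sub>0 real) \<Rightarrow> ('v, 'e) divisor set" where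
  "Pic_covering G D\<^sub>0 \<eta> =
     {D \<in> divisors G (divisor_degree D\<^sub>0). \<exists>c\<in>chains G. chain_boundary G c = D - D\<^sub>0 \<and>
        (\<forall>\<omega>\<in>real_cycles G. chain_integral c \<omega> = cycle_pairing G \<eta> \<omega>)}"

text \<open>
  The dimension of the affine span, for nonempty sets (the library constant \<open>aff_dim\<close> requires a
  Euclidean space type).
\<close>

definition affine_dimension :: "'a::real_vector set \<Rightarrow> nat" where
  "affine_dimension P = dim {x - y | x y. x \<in> P \<and> y \<in> P}"

text \<open>
  \<open>W\<close> is a nonempty polyhedral subset of dimension \<open>n\<close> of the torus \<open>Pic\<^sup>d\<close>. By compactness of the
  torus, such a subset is a finite union of images of polytopes in the universal cover, and \<open>n\<close> is the
  maximal dimension of these; the covering being a local isomorphism, \<open>n\<close> does not depend on the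
  decomposition. A change of \<open>D\<^sub>0\<close> amounts to a translation.
\<close>

definition has_polyhedral_dimension ::
    "('v, 'e) metric_graph \<Rightarrow> int \<Rightarrow> ('v, 'e) divisor set set \<Rightarrow> int \<Rightarrow> bool" where
  "has_polyhedral_dimension G d W n \<longleftrightarrow>
     (\<exists>D\<^sub>0\<in>divisors G d. \<exists>\<P>. finite \<P> \<and> \<P> \<noteq> {} \<and>
        (\<forall>P\<in>\<P>. polytope P \<and> P \<noteq> {} \<and> P \<subseteq> real_cycles G) \<and>
        W = (\<Union>P\<in>\<P>. Pic_covering G D\<^sub>0 ` P) \<and>
        n = int (Max (affine_dimension ` \<P>)))"


section \<open>Chains of cycles\<close>

datatype side = Top | Bottom

text \<open>Arc \<open>(i, s)\<close> runs from vertex \<open>i\<close> to vertex \<open>i + 1\<close>.\<close>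

definition chain_of_cycles :: "nat \<Rightarrow> nat \<Rightarrow> nat \<Rightarrow> (nat, nat \<times> side) metric_graph" where
  "chain_of_cycles g k l =
     \<lparr> verts = {0..g}, arcs = {0..<g} \<times> {Top, Bottom},
       tail = (\<lambda>(i, s). i), head = (\<lambda>(i, s). Suc i),
       len = (\<lambda>(i, s). case s of Top \<Rightarrow> real l | Bottom \<Rightarrow> real k - real l) \<rparr>"

definition rho :: "int \<Rightarrow> int \<Rightarrow> int \<Rightarrow> int" where
  "rho g d s = g - (s + 1) * (g - d + s)"

definition rho_bar :: "int \<Rightarrow> int \<Rightarrow> int \<Rightarrow> int \<Rightarrow> int" where
  "rho_bar g k d r = Max ((\<lambda>j. rho g d (r - j) - j * k) ` {0..min r (g - d + r - 1)})"

end

theory Submission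
  imports Defs
begin

text \<open>
  A divisor class on the chain is a degree together with one coordinate in \<open>\<real>/k\<int>\<close> for each cycle.
  Detaching the last cycle turns "rank at least \<open>r\<close>" into a recursion: the minimal number of chips
  that must be added at the right end in order to reach rank \<open>r\<close> grows by one with each cycle, except
  that it may stay the same when it solves a congruence modulo \<open>k\<close> given by the coordinate of that
  cycle. Read off for all \<open>r\<close> at once, these numbers form a partition; a cycle with coordinate in
  \<open>l\<int> + k\<int>\<close> adds to it all addable boxes of one content residue modulo \<open>k\<close>, any other cycle adds
  nothing, and the rank is at least \<open>r\<close> if and only if the final partition contains the
  \<open>(r + 1) \<times> (g - d + r)\<close> rectangle. Hence \<open>W\<^sup>r\<^sub>d\<close> is a finite union of subtori, one for each
  sequence of residues that builds such a partition, of dimension \<open>g\<close> minus the number of residues.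
  The reachable partitions are \<open>k\<close>-cores; counting affine inversions on their abacus bounds the number
  of residues from below, and a tableau on the rectangle with a \<open>(p, p - k)\<close>-periodicity
  attains the bound.
\<close>

section \<open>Bead configurations\<close>

text \<open>One letter may add many boxes at once, so counting boxes says nothing about how few
  letters produce an \<open>a\<close> by \<open>b\<close> rectangle, where \<open>a = r + 1\<close>
  and \<open>b = g - d + r\<close>. What grows by at most one per letter is the number of affine
  inversions. The expression \<open>(a - j) * (b - j) + j * k\<close> then arises twice. In the
  lower bound, \<open>p\<close> runners have a bead before the corner and \<open>h\<close> runners
  have a gap behind it; the \<open>A\<close> beads and \<open>B\<close> gaps spread over them force
  this many inversions, with \<open>A\<close>, \<open>B\<close> for \<open>a\<close>,
  \<open>b\<close> and \<open>j = min (A - p) (B - h)\<close>. In the construction, a splitting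
  \<open>k = p + h\<close> costs \<open>p * b + (a - p) * h\<close> letters, and
  \<open>p = a - j\<close> turns this into the same expression. On the geometric side,
  \<open>k\<close> and \<open>l\<close> being coprime makes the multiples of \<open>l\<close> meet
  the circle of length \<open>k\<close> in exactly \<open>k\<close> points, so special positions
  correspond to residues. The dimension becomes a count of cycles without a letter; a free
  coordinate may run through special positions as well, which is harmless because an additional
  letter can only enlarge the partition.\<close>

text \<open>
  A strictly increasing \<open>f\<close> encodes the partition with rows \<open>r - f r\<close>. The step with residue \<open>z\<close> adds
  all addable boxes whose row index minus column index is congruent to \<open>z\<close> modulo \<open>k\<close>.
\<close>

definition bead_step :: "nat \<Rightarrow> int option \<Rightarrow> (nat \<Rightarrow> int) \<Rightarrow> nat \<Rightarrow> int" where
  "bead_step k w f r =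
     (case w of None \<Rightarrow> f r
      | Some z \<Rightarrow> if int k dvd f r - z \<and> (r = 0 \<or> f (r - 1) < f r - 1) then f r - 1 else f r)"

primrec beads :: "nat \<Rightarrow> (nat \<Rightarrow> int option) \<Rightarrow> nat \<Rightarrow> nat \<Rightarrow> int" where
  "beads k w 0 = int"
| "beads k w (Suc n) = bead_step k (w n) (beads k w n)"

lemma bead_step_None [simp]: "bead_step k None f = f"
  by (simp add: bead_step_def fun_eq_iff)

lemma bead_step_le: "bead_step k w f r \<le> f r"
  by (auto simp: bead_step_def split: option.split)

lemma strict_mono_bead_step:
  assumes "strict_mono f"
  shows "strict_mono (bead_step k w f)"
proof (rule strict_monoI_Suc)
  fix r
  have "f r < f (Suc r)"
    using assms by (simp add: strict_mono_less)
  then show "bead_step k w f r < bead_step k w f (Suc r)"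
    by (auto simp: bead_step_def split: option.split)
qed

lemma strict_mono_beads: "strict_mono (beads k w n)"
proof (induction n)
  case 0
  then show ?case by (simp add: strict_mono_def)
qed (simp add: strict_mono_bead_step)

text \<open>If the larger sequence drops at an index where the two agree, the preceding entry leaves
  room in the smaller one too, so it drops as well; where they differ, a drop by one cannot reverse
  the order. Deleting letters is allowed because a cell of the Brill-Noether locus fixes only some
  coordinates.\<close>

lemma bead_step_mono:
  assumes "\<And>r. f r \<le> g r" "v = None \<or> v = w"
  shows "bead_step k w f r \<le> bead_step k v g r"
proof (cases "v = None")
  case True
  then show ?thesis
    using bead_step_le[of k w f r] assms(1)[of r] by simp
next
  case False
  then show ?thesis
    using assms(1)[of r] assms(1)[of "r - 1"] assms(2)
    by (cases "f r = g r") (auto simp: bead_step_def split: option.split)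
qed

lemma beads_mono:
  assumes "\<And>i. i < n \<Longrightarrow> v i = None \<or> v i = w i"
  shows "beads k w n r \<le> beads k v n r"
  using assms
proof (induction n arbitrary: r)
  case (Suc n)
  then show ?case
    by (simp add: bead_step_mono)
qed simp

lemma beads_cong:
  assumes "\<And>i. i < n \<Longrightarrow> v i = w i"
  shows "beads k v n = beads k w n"
  using assms by (induction n) auto

section \<open>The abacus of a core and its affine inversions\<close>

text \<open>
  On the abacus of a \<open>k\<close>-core, \<open>t i\<close> is the first bead of its residue class. The core length counts the
  inversions of the affine permutation with window \<open>t\<close>.
\<close>

definition gap :: "nat \<Rightarrow> int \<Rightarrow> int \<Rightarrow> int" where
  "gap k a b = (if a < b then (b - a) div int k else 0)"

definition core_length :: "nat \<Rightarrow> (nat \<Rightarrow> int) \<Rightarrow> int" where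
  "core_length k t = (\<Sum>i<k. \<Sum>j<k. gap k (t i) (t j))"

text \<open>The conditions on the window of an affine permutation; the prescribed sum keeps the
  charge of the abacus at that of the empty partition.\<close>

definition balanced :: "nat \<Rightarrow> (nat \<Rightarrow> int) \<Rightarrow> bool" where
  "balanced k t \<longleftrightarrow> inj_on (\<lambda>i. t i mod int k) {..<k} \<and> (\<Sum>i<k. t i) = (\<Sum>i<k. int i)"

text \<open>Inclusion of the bead set in the abacus of \<open>t\<close>. It guarantees that the
  abacus has at least as many beads before any corner as \<open>f\<close>.\<close>

definition covers :: "nat \<Rightarrow> (nat \<Rightarrow> int) \<Rightarrow> (nat \<Rightarrow> int) \<Rightarrow> bool" where
  "covers k t f \<longleftrightarrow> (\<forall>r. \<exists>i<k. t i \<le> f r \<and> int k dvd f r - t i)"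

lemma div_pred:
  fixes x k :: int
  assumes "0 < k" "\<not> k dvd x"
  shows "(x - 1) div k = x div k"
proof -
  have "0 < x mod k"
    using assms pos_mod_sign[of k x] by (simp add: dvd_eq_mod_eq_0 order_less_le)
  moreover have "x mod k < k"
    using assms by simp
  moreover have "x - 1 = k * (x div k) + (x mod k - 1)"
    by (simp add: algebra_simps)
  ultimately show ?thesis
    by (intro int_div_pos_eq[where r = "x mod k - 1"]) auto
qed

text \<open>The quotient can change only when a multiple of \<open>k\<close> is crossed. Hence a
  move on two runners affects no inversion with a third one.\<close>

lemma gap_pred_right:
  assumes "0 < k" "\<not> int k dvd b - a" "\<not> int k dvd b - 1 - a"
  shows "gap k a (b - 1) = gap k a b"
proof -
  have "b - 1 \<noteq> a" "b \<noteq> a"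
    using assms by auto
  then show ?thesis
    using div_pred[of "int k" "b - a"] assms by (auto simp: gap_def algebra_simps)
qed

lemma gap_pred_left:
  assumes "0 < k" "\<not> int k dvd b - a" "\<not> int k dvd b - (a - 1)"
  shows "gap k (a - 1) b = gap k a b"
proof -
  have "b \<noteq> a - 1" "b \<noteq> a"
    using assms by auto
  then show ?thesis
    using div_pred[of "int k" "b - (a - 1)"] assms by (auto simp: gap_def algebra_simps)
qed

lemma image_residues:
  assumes "inj_on (\<lambda>i. t i mod int k) {..<k}"
  shows "(\<lambda>i. t i mod int k) ` {..<k} = {0..<int k}"
proof (cases "k = 0")
  case False
  show ?thesis
    by (rule card_subset_eq) (use False in \<open>auto simp: card_image[OF assms]\<close>)
qed auto

lemma sum_split2:
  fixes F :: "nat \<Rightarrow> int"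
  assumes "i < k" "j < k" "i \<noteq> j"
  shows "(\<Sum>c<k. F c) = F i + F j + (\<Sum>c\<in>{..<k} - {i, j}. F c)"
proof -
  have "(\<Sum>c<k. F c) = sum F {i, j} + sum F ({..<k} - {i, j})"
    using assms by (subst sum.subset_diff[of "{i, j}" "{..<k}"]) auto
  then show ?thesis
    using assms by simp
qed

lemma core_length_split:
  assumes "i < k" "j < k" "i \<noteq> j"
  shows "core_length k t =
    gap k (t i) (t i) + gap k (t i) (t j) + gap k (t j) (t i) + gap k (t j) (t j)
    + (\<Sum>c\<in>{..<k} - {i, j}. gap k (t i) (t c) + gap k (t j) (t c) + gap k (t c) (t i) + gap k (t c) (t j))
    + (\<Sum>c\<in>{..<k} - {i, j}. \<Sum>d\<in>{..<k} - {i, j}. gap k (t c) (t d))"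
  unfolding core_length_def sum_split2[OF assms] sum.distrib by simp

text \<open>The letter \<open>z\<close> moves beads from the runner of class \<open>z\<close> to
  that of class \<open>z - 1\<close>, so only the first beads \<open>t i\<close> and
  \<open>t j\<close> of these two runners are concerned. Either the second runner already starts
  early enough to receive every moved bead, or the two starts are exchanged by a simple reflection
  of the window, which creates exactly one inversion.\<close>

lemma core_step:
  assumes k: "k \<ge> 2" and bal: "balanced k t" and cov: "covers k t f" and f: "strict_mono f"
  obtains t' where "balanced k t'" "covers k t' (bead_step k (Some z) f)"
    "core_length k t' \<le> core_length k t + 1"
proof -
  let ?K = "int k"
  have inj: "inj_on (\<lambda>i. t i mod ?K) {..<k}"
    using bal by (simp add: balanced_def)
  have res: "\<exists>i<k. t i mod ?K = u mod ?K" for u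
  proof -
    have "u mod ?K \<in> (\<lambda>i. t i mod ?K) ` {..<k}"
      unfolding image_residues[OF inj] using k by simp
    then show ?thesis by auto
  qed
  obtain i where i: "i < k" "t i mod ?K = z mod ?K"
    using res by blast
  obtain j where j: "j < k" "t j mod ?K = (z - 1) mod ?K"
    using res by blast
  have iz: "?K dvd t i - z" and jz: "?K dvd t j - (z - 1)"
    using i(2) j(2) by (simp_all add: mod_eq_dvd_iff)
  have distinct: "\<not> ?K dvd t c - t d" if "c < k" "d < k" "c \<noteq> d" for c d
    using inj that by (auto simp: inj_on_def mod_eq_dvd_iff)
  have ij: "i \<noteq> j"
  proof
    assume "i = j"
    then have "?K dvd (t i - (z - 1)) - (t i - z)"
      using iz jz by (metis dvd_diff)
    then show False
      using k by simp
  qed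
  have uniq_i: "c = i" if "c < k" "?K dvd t c - z" for c
  proof -
    have "?K dvd t c - t i"
      using dvd_diff[OF that(2) iz] by simp
    then show ?thesis
      using distinct that i by blast
  qed
  have uniq_j: "c = j" if "c < k" "?K dvd t c - (z - 1)" for c
  proof -
    have "?K dvd t c - t j"
      using dvd_diff[OF that(2) jz] by simp
    then show ?thesis
      using distinct that j by blast
  qed
  have fst: "f (r - 1) < f r" if "r \<noteq> 0" for r
    using f that by (simp add: strict_mono_less)
  have cov': "\<exists>c<k. t c \<le> f r \<and> ?K dvd f r - t c" for r
    using cov by (simp add: covers_def)
  have ci: "t i \<le> f r" if "?K dvd f r - z" for r
  proof -
    obtain c where c: "c < k" "t c \<le> f r" "?K dvd f r - t c"
      using cov' by blast
    have "?K dvd t c - z"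
      using dvd_diff[OF that c(3)] by simp
    then show ?thesis
      using uniq_i c by blast
  qed
  have cj: "t j \<le> f r" if "?K dvd f r - (z - 1)" for r
  proof -
    obtain c where c: "c < k" "t c \<le> f r" "?K dvd f r - t c"
      using cov' by blast
    have "?K dvd t c - (z - 1)"
      using dvd_diff[OF that c(3)] by (simp add: algebra_simps)
    then show ?thesis
      using uniq_j c by blast
  qed
  show thesis
  proof (cases "t i - 1 < t j")
    \<comment> \<open>Runner \<open>j\<close> starts at or before \<open>t i - 1\<close>, so each
      moved bead lands on it and \<open>t\<close> is kept. The core length does not grow, which is
      why the conclusion is an inequality.\<close>
    case False
    have "covers k t (bead_step k (Some z) f)"
      unfolding covers_def
    proof
      fix r
      show "\<exists>c<k. t c \<le> bead_step k (Some z) f r \<and> ?K dvd bead_step k (Some z) f r - t c"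
      proof (cases "?K dvd f r - z \<and> (r = 0 \<or> f (r - 1) < f r - 1)")
        case True
        then have "t j \<le> f r - 1"
          using ci[of r] False by simp
        moreover have "?K dvd f r - 1 - t j"
          using dvd_diff[of ?K "f r - z" "t j - (z - 1)"] True jz by (simp add: algebra_simps)
        ultimately show ?thesis
          using True j(1) by (auto simp: bead_step_def)
      next
        case False
        then have "bead_step k (Some z) f r = f r"
          by (simp only: bead_step_def option.case if_False)
        then show ?thesis
          using cov' by simp
      qed
    qed
    then show thesis
      using that bal by fastforce
  next
    case True
    \<comment> \<open>From here on index \<open>i\<close> represents the class \<open>z - 1\<close>
      and index \<open>j\<close> the class \<open>z\<close>: the two have exchanged roles.\<close>
    define t' where "t' = t(i := t i - 1, j := t j + 1)"
    have t'i: "t' i = t i - 1" and t'j: "t' j = t j + 1" and t'c: "\<And>c. c \<noteq> i \<Longrightarrow> c \<noteq> j \<Longrightarrow> t' c = t c"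
      using ij by (auto simp: t'_def)
    have iz': "?K dvd t' i - (z - 1)" and jz': "?K dvd t' j - z"
      using iz jz t'i t'j by (simp_all add: algebra_simps)
    have "covers k t' (bead_step k (Some z) f)"
      unfolding covers_def
    proof
      fix r
      consider (a) "?K dvd f r - z" "r = 0 \<or> f (r - 1) < f r - 1"
        | (b) "?K dvd f r - z" "r \<noteq> 0" "f (r - 1) \<ge> f r - 1"
        | (c) "\<not> ?K dvd f r - z"
        by linarith
      then show "\<exists>c<k. t' c \<le> bead_step k (Some z) f r \<and> ?K dvd bead_step k (Some z) f r - t' c"
      proof cases
        case a
        have "?K dvd f r - 1 - t' i"
          using dvd_diff[OF a(1) iz'] by (simp add: algebra_simps)
        then show ?thesis
          using a ci[of r] i(1) t'i by (auto simp: bead_step_def)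
      next
        case b
        \<comment> \<open>A bead that cannot move is blocked by one directly before it, which lies
          on runner \<open>j\<close>; hence the blocked bead is at \<open>t j + 1\<close> or
          later.\<close>
        then have "f (r - 1) = f r - 1"
          using fst[of r] by simp
        then have "t j \<le> f r - 1"
          using cj[of "r - 1"] b by (simp add: algebra_simps)
        moreover have "?K dvd f r - t' j"
          using dvd_diff[OF b(1) jz'] by (simp add: algebra_simps)
        ultimately show ?thesis
          using b j(1) t'j by (auto simp: bead_step_def)
      next
        case c
        obtain d where d: "d < k" "t d \<le> f r" "?K dvd f r - t d"
          using cov' by blast
        have "d \<noteq> i"
          using c d(3) iz dvd_add[of ?K "f r - t i" "t i - z"] by fastforce
        show ?thesis
        proof (cases "d = j")
          case dj: True
          have "?K dvd f r - t' i"
            using dvd_diff[of ?K "(f r - t j) + (t j - (z - 1))" "t' i - (z - 1)"] d dj iz' jz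
            by (metis (no_types, lifting) add_diff_cancel_right' diff_add_cancel diff_diff_eq2 dvd_add dvd_diff)
          then show ?thesis
            using c d dj True i(1) t'i by (auto simp: bead_step_def intro!: exI[of _ i])
        next
          case False
          then show ?thesis
            using c d \<open>d \<noteq> i\<close> t'c by (auto simp: bead_step_def)
        qed
      qed
    qed
    moreover have "balanced k t'"
      unfolding balanced_def
    proof
      show "inj_on (\<lambda>i. t' i mod ?K) {..<k}"
      proof (rule inj_onI)
        have *: "?K dvd t' c - z \<longleftrightarrow> c = j" "?K dvd t' c - (z - 1) \<longleftrightarrow> c = i" if "c < k" for c
        proof -
          have "\<not> ?K dvd t' i - z"
          proof
            assume "?K dvd t' i - z"
            then have "?K dvd (t' i - (z - 1)) - (t' i - z)"
              using iz' dvd_diff by blast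
            then show False using k by simp
          qed
          moreover have "\<not> ?K dvd t' j - (z - 1)"
          proof
            assume "?K dvd t' j - (z - 1)"
            then have "?K dvd (t' j - (z - 1)) - (t' j - z)"
              using jz' dvd_diff by blast
            then show False using k by simp
          qed
          ultimately show "?K dvd t' c - z \<longleftrightarrow> c = j" "?K dvd t' c - (z - 1) \<longleftrightarrow> c = i"
            using iz' jz' uniq_i[OF that] uniq_j[OF that] t'c[of c] by metis+
        qed
        fix c d assume cd: "c \<in> {..<k}" "d \<in> {..<k}" and eq: "t' c mod ?K = t' d mod ?K"
        have dv: "?K dvd t' c - u \<longleftrightarrow> ?K dvd t' d - u" for u
          using eq by (metis mod_eq_dvd_iff)
        show "c = d"
        proof (cases "c = i \<or> c = j")
          case True
          then show ?thesis using * dv cd by (metis lessThan_iff)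
        next
          case False
          then have "d \<noteq> i" "d \<noteq> j"
            using * dv cd by (metis lessThan_iff)+
          then show ?thesis
            using False eq t'c inj cd by (auto simp: inj_on_def)
        qed
      qed
      have "(\<Sum>c<k. t' c) = (\<Sum>c<k. t c)"
        using sum_split2[OF i(1) j(1) ij, of t] sum_split2[OF i(1) j(1) ij, of t'] t'i t'j t'c by simp
      then show "(\<Sum>c<k. t' c) = (\<Sum>c<k. int c)"
        using bal by (simp add: balanced_def)
    qed
    moreover have "core_length k t' = core_length k t + 1"
    proof -
      have nd: "\<not> ?K dvd t c - z" "\<not> ?K dvd t c - (z - 1)" if "c \<in> {..<k} - {i, j}" for c
        using uniq_i uniq_j that by auto
      have cg: "gap k (t' i) (t' c) = gap k (t i) (t c)" "gap k (t' c) (t' i) = gap k (t c) (t i)"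
        "gap k (t' j) (t' c) = gap k (t j) (t c)" "gap k (t' c) (t' j) = gap k (t c) (t j)"
        if c: "c \<in> {..<k} - {i, j}" for c
      proof -
        have di: "\<not> ?K dvd t c - t i" "\<not> ?K dvd t i - t c" "\<not> ?K dvd t c - t j" "\<not> ?K dvd t j - t c"
          using distinct c i j by auto
        have "\<not> ?K dvd t c - (t i - 1)" "\<not> ?K dvd t c - (t j + 1)"
          using nd[OF c] dvd_add[of ?K "t c - (t i - 1)" "t i - z"] dvd_add[of ?K "t c - (t j + 1)" "t j - (z - 1)"] iz jz
          by (auto simp: algebra_simps)
        moreover from this have "\<not> ?K dvd (t i - 1) - t c" "\<not> ?K dvd (t j + 1) - t c"
          by (metis dvd_minus_iff minus_diff_eq)+
        ultimately show "gap k (t' i) (t' c) = gap k (t i) (t c)" "gap k (t' c) (t' i) = gap k (t c) (t i)"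
          "gap k (t' j) (t' c) = gap k (t j) (t c)" "gap k (t' c) (t' j) = gap k (t c) (t j)"
          using gap_pred_left[of k "t c" "t i"] gap_pred_right[of k "t i" "t c"]
            gap_pred_left[of k "t c" "t j + 1"] gap_pred_right[of k "t j + 1" "t c"] di k c
          by (auto simp: t'i t'j t'c)
      qed
      have "?K dvd t j + 1 - t i"
        using dvd_diff[OF jz iz] by (simp add: algebra_simps)
      \<comment> \<open>The ordered pair \<open>(i, j)\<close> contributes \<open>q - 1\<close>
        before the exchange and \<open>q\<close> after it; the reverse pair contributes nothing
        either time.\<close>
      then obtain q where q: "t j + 1 - t i = ?K * q"
        by (rule dvdE)
      have q0: "0 < ?K * q"
        using True q by simp
      then have q1: "q \<ge> 1"
        using k by (simp add: zero_less_mult_iff)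
      have "gap k (t i) (t j) = q - 1"
      proof (cases "t i < t j")
        case True
        have "(t j - t i) div ?K = q - 1"
          by (rule int_div_pos_eq[where r = "?K - 1"]) (use q k in \<open>auto simp: algebra_simps\<close>)
        then show ?thesis using True by (simp add: gap_def)
      next
        case False
        have "?K * q \<ge> ?K * 1"
          using q1 by (intro mult_left_mono) auto
        then have "?K * q \<ge> 2"
          using k by linarith
        then show ?thesis
          using q False \<open>t i - 1 < t j\<close> by linarith
      qed
      moreover have "gap k (t' i) (t' j) = q"
      proof -
        have "(t' j - t' i) div ?K = q"
          by (rule int_div_pos_eq[where r = 1]) (use q k t'i t'j in \<open>auto simp: algebra_simps\<close>)
        then show ?thesis
          using q q0 t'i t'j by (auto simp: gap_def)
      qed
      moreover have "gap k (t j) (t i) = 0" "gap k (t' j) (t' i) = 0"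
        using True t'i t'j by (auto simp: gap_def)
      moreover have "gap k a a = 0" for a
        by (simp add: gap_def)
      moreover have "(\<Sum>c\<in>{..<k} - {i, j}. \<Sum>d\<in>{..<k} - {i, j}. gap k (t' c) (t' d)) =
          (\<Sum>c\<in>{..<k} - {i, j}. \<Sum>d\<in>{..<k} - {i, j}. gap k (t c) (t d))"
        by (intro sum.cong) (auto simp: t'c)
      moreover have "(\<Sum>c\<in>{..<k} - {i, j}. gap k (t' i) (t' c) + gap k (t' j) (t' c) + gap k (t' c) (t' i) + gap k (t' c) (t' j)) =
          (\<Sum>c\<in>{..<k} - {i, j}. gap k (t i) (t c) + gap k (t j) (t c) + gap k (t c) (t i) + gap k (t c) (t j))"
        by (intro sum.cong refl) (simp only: cg)
      ultimately show ?thesis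
        unfolding core_length_split[OF i(1) j(1) ij] by simp
    qed
    ultimately show thesis
      using that by simp
  qed
qed

text \<open>Starts from the abacus of the empty partition, whose runners begin at \<open>0\<close>
  to \<open>k - 1\<close> without inversions, and spends at most one inversion per letter.\<close>

lemma beads_core:
  assumes "k \<ge> 2"
  shows "\<exists>t. balanced k t \<and> covers k t (beads k w n) \<and>
    core_length k t \<le> int (card {i. i < n \<and> w i \<noteq> None})"
proof (induction n)
  case 0
  have "balanced k int"
    by (auto simp: balanced_def inj_on_def)
  moreover have "covers k int (beads k w 0)"
    unfolding covers_def
  proof
    fix r :: nat
    have "r mod k \<le> r"
      by simp
    then have "int (r mod k) \<le> int r" "int k dvd int r - int (r mod k)"
      by (simp_all only: of_nat_le_iff) (simp add: zmod_int)
    then show "\<exists>i<k. int i \<le> beads k w 0 r \<and> int k dvd beads k w 0 r - int i"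
      using assms by (intro exI[of _ "r mod k"]) auto
  qed
  moreover have "core_length k int = 0"
    unfolding core_length_def gap_def by (intro sum.neutral ballI) auto
  ultimately show ?case
    by (metis of_nat_0_le_iff)
next
  case (Suc n)
  then obtain t where t: "balanced k t" "covers k t (beads k w n)"
    "core_length k t \<le> int (card {i. i < n \<and> w i \<noteq> None})"
    by blast
  show ?case
  proof (cases "w n")
    case None
    then have "{i. i < Suc n \<and> w i \<noteq> None} = {i. i < n \<and> w i \<noteq> None}"
      by (auto simp: less_Suc_eq)
    then show ?thesis using t None by auto
  next
    case (Some z)
    then have "{i. i < Suc n \<and> w i \<noteq> None} = insert n {i. i < n \<and> w i \<noteq> None}"
      by (auto simp: less_Suc_eq)
    then have "card {i. i < Suc n \<and> w i \<noteq> None} = Suc (card {i. i < n \<and> w i \<noteq> None})"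
      by simp
    moreover obtain t' where "balanced k t'" "covers k t' (bead_step k (Some z) (beads k w n))"
      "core_length k t' \<le> core_length k t + 1"
      using core_step[OF assms t(1,2) strict_mono_beads] by blast
    ultimately show ?thesis
      using t Some by (intro exI[of _ t']) auto
  qed
qed

section \<open>Lower bound for the number of letters\<close>

text \<open>The bound is the ceiling of \<open>(m + 1 - a) / k\<close>, written as a negated floor
  to agree with the numbers \<open>e i\<close> of the corner count.\<close>

lemma card_residue_interval:
  fixes a m :: int
  assumes "0 < k"
  shows "finite {s. a \<le> s \<and> s \<le> m \<and> int k dvd s - a}"
    and "int (card {s. a \<le> s \<and> s \<le> m \<and> int k dvd s - a}) \<le> max 0 (- ((a - m - 1) div int k))"
proof -
  let ?q = "nat (- ((a - m - 1) div int k))"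
  have sub: "{s. a \<le> s \<and> s \<le> m \<and> int k dvd s - a} \<subseteq> (\<lambda>n. a + int n * int k) ` {..<?q}"
  proof safe
    fix s assume s: "a \<le> s" "s \<le> m" "int k dvd s - a"
    then obtain c where c: "s - a = int k * c"
      by (auto elim: dvdE)
    then have "0 \<le> int k * c"
      using s by simp
    then have "0 \<le> c"
      using assms by (simp add: zero_le_mult_iff)
    have "a - m - 1 < (- c) * int k"
      using c s by (simp add: algebra_simps)
    moreover have "(a - m - 1) div int k * int k \<le> a - m - 1"
      using assms pos_mod_sign[of "int k" "a - m - 1"] div_mult_mod_eq[of "a - m - 1" "int k"] by linarith
    ultimately have "(a - m - 1) div int k * int k < (- c) * int k"
      by linarith
    then have "(a - m - 1) div int k < - c"
      using assms by (simp only: mult_less_cancel_right)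
    then show "s \<in> (\<lambda>n. a + int n * int k) ` {..<?q}"
      using c \<open>0 \<le> c\<close> by (intro image_eqI[of _ _ "nat c"]) (auto simp: algebra_simps)
  qed
  then show "finite {s. a \<le> s \<and> s \<le> m \<and> int k dvd s - a}"
    using finite_surj by blast
  have "card {s. a \<le> s \<and> s \<le> m \<and> int k dvd s - a} \<le> card {..<?q}"
    using sub surj_card_le by blast
  then show "int (card {s. a \<le> s \<and> s \<le> m \<and> int k dvd s - a}) \<le> max 0 (- ((a - m - 1) div int k))"
    by simp
qed

text \<open>The quotients are the rows of \<open>a\<close> and \<open>b\<close> relative to
  \<open>m\<close>; the two remainders differ by less than one full turn, which costs the
  \<open>- 1\<close>.\<close>

lemma gap_ge:
  assumes "0 < k"
  shows "gap k a b \<ge> (b - m) div int k - (a - m) div int k - 1" "gap k a b \<ge> 0"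
proof -
  show nonneg: "gap k a b \<ge> 0"
    using assms by (simp add: gap_def pos_imp_zdiv_nonneg_iff)
  let ?x = "(b - m) div int k" and ?y = "(a - m) div int k"
  have "b - m = int k * ?x + (b - m) mod int k" "a - m = int k * ?y + (a - m) mod int k"
    by simp_all
  moreover have "(b - m) mod int k \<ge> 0" "(a - m) mod int k < int k"
    using assms by simp_all
  moreover have "(?x - ?y - 1) * int k = int k * ?x - int k * ?y - int k"
    by (simp add: algebra_simps)
  ultimately have *: "(?x - ?y - 1) * int k < b - a"
    by linarith
  show "gap k a b \<ge> ?x - ?y - 1"
  proof (cases "a < b")
    case True
    have "?x - ?y - 1 = (?x - ?y - 1) * int k div int k"
      using assms by simp
    also have "\<dots> \<le> (b - a) div int k"
      by (rule zdiv_mono1) (use * assms in auto)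
    finally show ?thesis
      using True by (simp add: gap_def)
  next
    case False
    then have "(?x - ?y - 1) * int k < 0"
      using * by simp
    then show ?thesis
      using nonneg by (simp add: mult_less_0_iff)
  qed
qed

text \<open>The remainders run through \<open>0\<close> to \<open>k - 1\<close> once, so their sum
  is that of the window, and the quotients have to compensate the shift by \<open>m\<close>.\<close>

lemma sum_div_balanced:
  assumes "0 < k" "balanced k t"
  shows "(\<Sum>i<k. (t i - m) div int k) = - m"
proof -
  let ?\<rho> = "\<lambda>i. (t i - m) mod int k"
  have "inj_on ?\<rho> {..<k}"
    using assms by (auto simp: balanced_def inj_on_def mod_eq_dvd_iff)
  from image_residues[OF this] sum.reindex[OF this, of "\<lambda>x. x"]
  have "(\<Sum>i<k. ?\<rho> i) = \<Sum>{0..<int k}"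
    by (simp add: o_def)
  also have "{0..<int k} = int ` {..<k}"
    by (simp add: image_int_atLeastLessThan flip: atLeast0LessThan)
  also have "\<Sum>(int ` {..<k}) = (\<Sum>i<k. int i)"
    by (simp add: sum.reindex)
  also have "\<dots> = (\<Sum>i<k. t i)"
    using assms by (simp add: balanced_def)
  also have "\<dots> = (\<Sum>i<k. int k * ((t i - m) div int k) + ?\<rho> i + m)"
    by simp
  also have "\<dots> = int k * (\<Sum>i<k. (t i - m) div int k) + (\<Sum>i<k. ?\<rho> i) + int k * m"
    by (simp only: sum.distrib sum_distrib_left) simp
  finally have "int k * ((\<Sum>i<k. (t i - m) div int k) + m) = 0"
    by (simp add: algebra_simps)
  then show ?thesis
    using assms by simp
qed

text \<open>
  In the application, \<open>- e i\<close> is the number of beads of the class \<open>i\<close> before the corner of a rectangle,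
  or, if this is negative, \<open>e i\<close> is the number of its gaps behind the corner.
\<close>

lemma core_length_ge:
  fixes A B :: int
  assumes k: "0 < k" and A: "A = (\<Sum>i<k. max 0 (- e i))" and B: "B = (\<Sum>i<k. max 0 (e i))"
    and pos: "A \<ge> 1" "B \<ge> 1"
    and ge: "\<And>i j. i < k \<Longrightarrow> j < k \<Longrightarrow> G i j \<ge> e j - e i - 1" "\<And>i j. i < k \<Longrightarrow> j < k \<Longrightarrow> G i j \<ge> 0"
  shows "\<exists>j\<in>{0..min A B - 1}. (A - j) * (B - j) + j * int k \<le> (\<Sum>i<k. \<Sum>j<k. G i j)"
proof -
  define P where "P = {i. i < k \<and> e i < 0}"
  define H where "H = {i. i < k \<and> e i > 0}"
  define Z where "Z = {i. i < k \<and> e i = 0}"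
  have fin: "finite P" "finite H" "finite Z"
    by (simp_all add: P_def H_def Z_def)
  have disj: "P \<inter> H = {}" "P \<inter> Z = {}" "H \<inter> Z = {}"
    by (auto simp: P_def H_def Z_def)
  have un: "{..<k} = P \<union> H \<union> Z"
    by (auto simp: P_def H_def Z_def)
  define p h z where "p = int (card P)" and "h = int (card H)" and "z = int (card Z)"
  have kk: "int k = p + h + z"
  proof -
    have "k = card (P \<union> H \<union> Z)"
      using un by (metis card_lessThan)
    also have "\<dots> = card P + card H + card Z"
      using fin disj by (simp add: card_Un_disjoint Int_Un_distrib2)
    finally show ?thesis
      by (simp add: p_def h_def z_def)
  qed
  have AP: "A = (\<Sum>i\<in>P. - e i)"
    unfolding A by (rule sum.mono_neutral_cong_right) (auto simp: P_def)
  have BH: "B = (\<Sum>i\<in>H. e i)"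
    unfolding B by (rule sum.mono_neutral_cong_right) (auto simp: H_def)
  have "(\<Sum>i\<in>P. 1) \<le> A"
    unfolding AP by (rule sum_mono) (auto simp: P_def)
  then have Ap: "p \<le> A"
    by (simp add: p_def)
  have "(\<Sum>i\<in>H. 1) \<le> B"
    unfolding BH by (rule sum_mono) (auto simp: H_def)
  then have Bh: "h \<le> B"
    by (simp add: h_def)
  have "P \<noteq> {}"
    using AP pos by auto
  then have p1: "p \<ge> 1"
    using fin by (simp add: p_def Suc_le_eq card_gt_0_iff)
  have "H \<noteq> {}"
    using BH pos by auto
  then have h1: "h \<ge> 1"
    using fin by (simp add: h_def Suc_le_eq card_gt_0_iff)
  define s where "s X Y = (\<Sum>i\<in>X. \<Sum>j\<in>Y. G i j)" for X Y
  have lt: "i < k" if "i \<in> P \<union> H \<union> Z" for i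
    using that un by blast
  have split: "sum F {..<k} = sum F P + sum F H + sum F Z" for F :: "nat \<Rightarrow> int"
  proof -
    have "sum F {..<k} = sum F (P \<union> H) + sum F Z"
      unfolding un using fin disj by (intro sum.union_disjoint) auto
    then show ?thesis
      using fin disj by (simp add: sum.union_disjoint)
  qed
  have nn: "0 \<le> s X Y" if "X \<subseteq> {..<k}" "Y \<subseteq> {..<k}" for X Y
    unfolding s_def using that by (intro sum_nonneg ge) auto
  have "(\<Sum>i<k. \<Sum>j<k. G i j) = s P P + s P H + s P Z + s H P + s H H + s H Z + s Z P + s Z H + s Z Z"
    unfolding split s_def sum.distrib by simp
  moreover have "0 \<le> s P P" "0 \<le> s H P" "0 \<le> s H H" "0 \<le> s H Z" "0 \<le> s Z P" "0 \<le> s Z Z"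
    using un by (auto intro!: nn)
  \<comment> \<open>The other six blocks enter only as nonnegative. The kept ones are those in which
    \<open>e\<close> increases from the first index to the second.\<close>
  ultimately have "s P H + s P Z + s Z H \<le> (\<Sum>i<k. \<Sum>j<k. G i j)"
    by linarith
  moreover have "s P H \<ge> p * B + h * A - p * h"
  proof -
    have "s P H \<ge> (\<Sum>i\<in>P. \<Sum>j\<in>H. e j - e i - 1)"
      unfolding s_def by (intro sum_mono ge lt) auto
    moreover have "(\<Sum>i\<in>P. \<Sum>j\<in>H. e j - e i - 1) = p * B + h * A - p * h"
      unfolding AP BH p_def h_def
      by (simp add: sum_subtractf sum.distrib sum_negf algebra_simps flip: sum_distrib_left sum_distrib_right)
    ultimately show ?thesis by simp
  qed
  moreover have "s P Z \<ge> z * (A - p)"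
  proof -
    have "s P Z \<ge> (\<Sum>i\<in>P. \<Sum>j\<in>Z. e j - e i - 1)"
      unfolding s_def by (intro sum_mono ge lt) auto
    moreover have "(\<Sum>i\<in>P. \<Sum>j\<in>Z. e j - e i - 1) = (\<Sum>i\<in>P. \<Sum>j\<in>Z. - e i - 1)"
      by (intro sum.cong) (auto simp: Z_def)
    moreover have "(\<Sum>i\<in>P. \<Sum>j\<in>Z. - e i - 1) = z * (A - p)"
      unfolding AP p_def z_def
      by (simp add: sum_subtractf sum.distrib sum_negf algebra_simps flip: sum_distrib_left sum_distrib_right)
    ultimately show ?thesis by simp
  qed
  moreover have "s Z H \<ge> z * (B - h)"
  proof -
    have "s Z H \<ge> (\<Sum>i\<in>Z. \<Sum>j\<in>H. e j - e i - 1)"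
      unfolding s_def by (intro sum_mono ge lt) auto
    moreover have "(\<Sum>i\<in>Z. \<Sum>j\<in>H. e j - e i - 1) = (\<Sum>i\<in>Z. \<Sum>j\<in>H. e j - 1)"
      by (intro sum.cong) (auto simp: Z_def)
    moreover have "(\<Sum>i\<in>Z. \<Sum>j\<in>H. e j - 1) = z * (B - h)"
      unfolding BH h_def z_def
      by (simp add: sum_subtractf sum.distrib algebra_simps flip: sum_distrib_left sum_distrib_right)
    ultimately show ?thesis by simp
  qed
  ultimately have main: "p * B + h * A - p * h + z * (A - p) + z * (B - h) \<le> (\<Sum>i<k. \<Sum>j<k. G i j)"
    by linarith
  \<comment> \<open>With this \<open>j\<close>, at least one of \<open>A - j = p\<close> and
    \<open>B - j = h\<close> holds, and the surplus over the claimed value is a nonnegative multiple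
    of \<open>z\<close>.\<close>
  let ?j = "min (A - p) (B - h)"
  have "p * B + h * A - p * h + z * (A - p) + z * (B - h) - ((A - ?j) * (B - ?j) + ?j * int k)
      = z * max (A - p) (B - h)"
    unfolding kk by (auto simp: min_def max_def algebra_simps)
  moreover have "z * max (A - p) (B - h) \<ge> 0"
    using Ap by (simp add: z_def)
  moreover have "?j \<in> {0..min A B - 1}"
    using Ap Bh p1 h1 by auto
  ultimately show ?thesis
    using main by (intro bexI[of _ ?j]) linarith+
qed

text \<open>The abacus may have \<open>c\<close> more beads before the corner, and then also
  \<open>c\<close> more gaps behind it, than the rectangle demands. Either the excess is absorbed
  into \<open>j\<close>, or the product alone is already large enough.\<close>

lemma rectangle_monotone:
  fixes a b c k :: int
  assumes ab: "a \<ge> 1" "b \<ge> 1" and c: "c \<ge> 0" and k: "k \<ge> 0" and j: "j \<in> {0..min (a + c) (b + c) - 1}"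
    and le: "(a + c - j) * (b + c - j) + j * k \<le> n"
  shows "\<exists>j\<in>{0..min a b - 1}. (a - j) * (b - j) + j * k \<le> n"
proof (cases "c \<le> j")
  case True
  have "(j - c) * k \<le> j * k"
    using c k by (intro mult_right_mono) auto
  then show ?thesis
    using True j le by (intro bexI[of _ "j - c"]) (auto simp: algebra_simps)
next
  case False
  have "a * b \<le> (a + c - j) * (b + c - j)"
    using False ab by (intro mult_mono) auto
  moreover have "0 \<le> j * k"
    using j k by simp
  ultimately show ?thesis
    using ab le by (intro bexI[of _ 0]) auto
qed

text \<open>The hypothesis places the first \<open>r + 1\<close> beads at or before
  \<open>m = r - b\<close>, so at least as many positions of the abacus lie there. The charge fixes
  the difference between their number and the number of gaps behind \<open>m\<close>; both therefore
  exceed the sides of the rectangle by the same \<open>c\<close>.\<close>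

lemma beads_lower_bound:
  fixes b :: int
  assumes k: "k \<ge> 2" and b: "b \<ge> 1" and le: "beads k w n r \<le> int r - b"
  shows "\<exists>j\<in>{0..min (int r) (b - 1)}.
    (int r + 1 - j) * (b - j) + j * int k \<le> int (card {i. i < n \<and> w i \<noteq> None})"
proof -
  obtain t where t: "balanced k t" "covers k t (beads k w n)"
    and len: "core_length k t \<le> int (card {i. i < n \<and> w i \<noteq> None})"
    using beads_core[OF k] by blast
  define m where "m = int r - b"
  define e where "e i = (t i - (m + 1)) div int k" for i
  define A where "A = (\<Sum>i<k. max 0 (- e i))"
  define B where "B = (\<Sum>i<k. max 0 (e i))"
  have k0: "0 < k"
    using k by simp
  have "B - A = (\<Sum>i<k. e i)"
    unfolding A_def B_def by (simp add: max_def flip: sum_subtractf) (rule sum.cong, auto)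
  also have "\<dots> = - (m + 1)"
    unfolding e_def by (rule sum_div_balanced[OF k0 t(1)])
  finally have BA: "B - A = b - (int r + 1)"
    by (simp add: m_def)
  have "int (r + 1) \<le> A"
  proof -
    let ?U = "\<lambda>i. {s. t i \<le> s \<and> s \<le> m \<and> int k dvd s - t i}"
    have "beads k w n ` {..r} \<subseteq> (\<Union>i<k. ?U i)"
    proof safe
      fix x assume "x \<le> r"
      then have "beads k w n x \<le> beads k w n r"
        using strict_mono_beads[of k w n] by (simp add: strict_mono_less_eq)
      then have "beads k w n x \<le> m"
        using le by (simp add: m_def)
      then show "beads k w n x \<in> (\<Union>i<k. ?U i)"
        using t(2) by (auto simp: covers_def)
    qed
    then have "card (beads k w n ` {..r}) \<le> card (\<Union>i<k. ?U i)"
      using card_residue_interval(1)[OF k0] by (intro card_mono) auto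
    also have "\<dots> \<le> (\<Sum>i<k. card (?U i))"
      by (rule card_UN_le) simp
    finally have "r + 1 \<le> (\<Sum>i<k. card (?U i))"
      using strict_mono_beads[of k w n] by (simp add: card_image strict_mono_on_imp_inj_on strict_mono_imp_inj_on inj_on_subset)
    then have "int (r + 1) \<le> (\<Sum>i<k. int (card (?U i)))"
      by (simp flip: of_nat_sum)
    also have "\<dots> \<le> A"
      unfolding A_def e_def using card_residue_interval(2)[OF k0, of "t _" m]
      by (intro sum_mono) (simp add: algebra_simps)
    finally show ?thesis .
  qed
  moreover define c where "c = A - (int r + 1)"
  ultimately have c: "c \<ge> 0" and A: "A = int r + 1 + c"
    by simp_all
  have B: "B = b + c"
    using BA A by simp
  have "\<exists>j\<in>{0..min A B - 1}. (A - j) * (B - j) + j * int k \<le> core_length k t"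
    unfolding core_length_def
  proof (rule core_length_ge[OF k0 A_def B_def])
    show "1 \<le> A" "1 \<le> B"
      using A B b c by simp_all
  qed (use gap_ge[OF k0] in \<open>auto simp: e_def\<close>)
  then have "\<exists>j\<in>{0..min (int r + 1) b - 1}. (int r + 1 - j) * (b - j) + j * int k \<le> core_length k t"
    unfolding A B using b c by (auto intro: rectangle_monotone[of _ _ c])
  then obtain j where "j \<in> {0..min (int r + 1) b - 1}"
    "(int r + 1 - j) * (b - j) + j * int k \<le> core_length k t"
    by blast
  then show ?thesis
    using len by (intro bexI[of _ j]) auto
qed

section \<open>Words that build a rectangle\<close>

definition letters :: "'a list \<Rightarrow> nat \<Rightarrow> 'a option" where
  "letters zs i = (if i < length zs then Some (zs ! i) else None)"

text \<open>
  The translation by \<open>(p, - h)\<close> preserves \<open>h * x + p * y\<close> and changes \<open>x - y\<close> by \<open>k\<close>. So the boxes of an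
  orbit can all be added in one step if the orbits are processed in the order of this functional, and
  the set \<open>Q\<close> below meets each orbit that meets the rectangle.
\<close>

lemma beads_rectangle:
  fixes a b p h k :: nat
  assumes pa: "1 \<le> p" "p \<le> a" and b: "1 \<le> b" and h: "1 \<le> h" and k: "k = p + h"
  shows "\<exists>zs. length zs \<le> p * b + (a - p) * h \<and>
    beads k (letters zs) (length zs) (a - 1) \<le> int a - 1 - int b"
proof -
  \<comment> \<open>The first \<open>p\<close> rows and the last \<open>h\<close> columns of the
    rectangle: a box outside \<open>Q\<close> can be translated by \<open>(- p, h)\<close> without
    leaving the rectangle.\<close>
  define Q where "Q = {(x, y). x < a \<and> y < b \<and> (x < p \<or> b \<le> y + h)}"
  define \<phi> where "\<phi> = (\<lambda>(x, y). h * x + p * y)"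
  define c where "c = (\<lambda>(x, y). int x - int y)"
  have Q: "Q \<subseteq> {..<p} \<times> {..<b} \<union> {p..<a} \<times> {b - h..<b}"
    by (auto simp: Q_def)
  have "card Q \<le> card ({..<p} \<times> {..<b} \<union> {p..<a} \<times> {b - h..<b})"
    by (rule card_mono[OF _ Q]) simp
  also have "\<dots> \<le> card ({..<p} \<times> {..<b}) + card ({p..<a} \<times> {b - h..<b})"
    by (rule card_Un_le)
  also have "\<dots> \<le> p * b + (a - p) * h"
    by (simp add: card_cartesian_product) linarith
  finally have cardQ: "card Q \<le> p * b + (a - p) * h" .
  have "finite Q"
    using Q by (rule finite_subset) simp
  then obtain ls where ls: "set ls = Q" "distinct ls"
    using finite_distinct_list by blast
  define qs where "qs = sort_key \<phi> ls"
  have qs: "set qs = Q" "sorted (map \<phi> qs)" "length qs = card Q"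
    using ls distinct_card[of ls] by (simp_all add: qs_def)
  define rep where "rep q s \<longleftrightarrow> \<phi> q = \<phi> s \<and> int k dvd c s - c q" for q s
  have rep_ex: "\<exists>q\<in>Q. rep q (x, y)" if "x < a" "y < b" for x y
    using that
  proof (induction x arbitrary: y rule: less_induct)
    case (less x)
    show ?case
    proof (cases "(x, y) \<in> Q")
      case True
      then show ?thesis
        by (auto simp: rep_def)
    next
      case False
      then have xy: "p \<le> x" "y + h < b"
        using less.prems by (auto simp: Q_def)
      then have "x - p < x" "x - p < a"
        using less.prems pa by simp_all
      then obtain q where q: "q \<in> Q" "rep q (x - p, y + h)"
        using less.IH[of "x - p" "y + h"] xy by blast
      have "\<phi> (x - p, y + h) = \<phi> (x, y)"
        using xy by (auto simp: \<phi>_def algebra_simps diff_mult_distrib2 le_add_diff_inverse2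
            intro!: le_add_diff_inverse2 trans_le_add1 mult_le_mono1)
      moreover have "c (x, y) - c q = (c (x - p, y + h) - c q) + int k"
        using xy by (simp add: c_def k of_nat_diff)
      then have "int k dvd c (x, y) - c q"
        using q(2) by (simp only: rep_def) simp
      ultimately show ?thesis
        using q by (auto simp: rep_def)
    qed
  qed
  define zs where "zs = map c qs"
  \<comment> \<open>In terms of boxes, \<open>(x, y)\<close> is present as soon as the letter of its
    orbit has been read.\<close>
  have inv: "beads k (letters zs) n x \<le> int x - int y - 1"
    if "n \<le> length qs" "x < a" "y < b" "i < n" "rep (qs ! i) (x, y)" for n x y i
    using that
  proof (induction n arbitrary: x y i)
    case (Suc n)
    let ?f = "beads k (letters zs) n"
    \<comment> \<open>As \<open>h\<close> and \<open>p\<close> are positive, the neighbours of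
      \<open>(x, y)\<close> in the preceding row and column have smaller \<open>\<phi>\<close>, so
      the letters of their orbits have already been read.\<close>
    have earlier: "?f x' \<le> int x' - int y' - 1" if lt: "x' < a" "y' < b" "\<phi> (x', y') < \<phi> (qs ! n)" for x' y'
    proof -
      obtain q where q: "q \<in> Q" "rep q (x', y')"
        using rep_ex[OF lt(1,2)] by blast
      then obtain m where m: "m < length qs" "q = qs ! m"
        using qs(1) by (metis in_set_conv_nth)
      have "m < n"
      proof (rule ccontr)
        assume "\<not> m < n"
        then have "\<phi> (qs ! n) \<le> \<phi> (qs ! m)"
          using sorted_nth_mono[OF qs(2), of n m] m Suc.prems by simp
        then show False
          using lt q m by (simp add: rep_def)
      qed
      then show ?thesis
        using Suc.IH[of x' y' m] Suc.prems lt q m by simp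
    qed
    have le: "beads k (letters zs) (Suc n) x \<le> ?f x"
      by (simp add: bead_step_le)
    show ?case
    proof (cases "i < n \<or> ?f x \<le> int x - int y - 1")
      case True
      then show ?thesis
        using le Suc.IH[of x y i] Suc.prems by force
    next
      case False
      then have i: "i = n" and f: "?f x > int x - int y - 1"
        using Suc.prems by simp_all
      have \<phi>: "\<phi> (x, y) = \<phi> (qs ! n)"
        using Suc.prems i by (simp add: rep_def)
      have "?f x \<le> int x - int y"
      proof (cases y)
        case 0
        have "?f x \<le> int x"
          by (induction n) (auto intro: order.trans[OF bead_step_le])
        then show ?thesis using 0 by simp
      next
        case (Suc y')
        then show ?thesis
          using earlier[of x y'] \<open>x < a\<close> \<open>y < b\<close> \<phi> pa by (simp add: \<phi>_def)
      qed
      \<comment> \<open>Row \<open>x\<close> has exactly \<open>y\<close> boxes and the row before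
        it has more, so \<open>(x, y)\<close> is addable and the current letter is its
        residue.\<close>
      then have fx: "?f x = int x - int y"
        using f by simp
      have "x = 0 \<or> ?f (x - 1) < ?f x - 1"
      proof (cases x)
        case (Suc x')
        then show ?thesis
          using earlier[of x' y] \<open>x < a\<close> \<open>y < b\<close> \<phi> fx h by (simp add: \<phi>_def)
      qed simp
      moreover have "letters zs n = Some (c (qs ! n))"
        using Suc.prems by (simp add: letters_def zs_def)
      moreover have "int k dvd ?f x - c (qs ! n)"
        using Suc.prems i fx by (simp add: rep_def c_def)
      ultimately have "beads k (letters zs) (Suc n) x = ?f x - 1"
        by (simp add: bead_step_def)
      then show ?thesis
        using fx by simp
    qed
  qed simp
  have "a - 1 < a" "b - 1 < b"
    using pa b by simp_all
  then obtain q where q: "q \<in> Q" "rep q (a - 1, b - 1)"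
    using rep_ex by blast
  then obtain m where "m < length qs" "q = qs ! m"
    using qs(1) by (metis in_set_conv_nth)
  then have "beads k (letters zs) (length qs) (a - 1) \<le> int (a - 1) - int (b - 1) - 1"
    using inv[of "length qs" "a - 1" "b - 1" m] q \<open>a - 1 < a\<close> \<open>b - 1 < b\<close> by simp
  then show ?thesis
    using qs(3) cardQ pa b by (intro exI[of _ zs]) (simp add: zs_def of_nat_diff)
qed

text \<open>The concave parabola has its vertex at \<open>X / 2\<close>, cut off at
  \<open>m\<close>; the difference of the two values factors as
  \<open>(?i - j) * (X - ?i - j)\<close>.\<close>

lemma quadratic_max:
  fixes j X m :: int
  assumes "0 \<le> j" "j \<le> m"
  shows "j * (X - j) \<le> min (X div 2) m * (X - min (X div 2) m)"
proof -
  let ?i = "min (X div 2) m"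
  have "0 \<le> (?i - j) * (X - ?i - j)"
  proof (cases "j < ?i")
    case True
    then show ?thesis by (intro mult_nonneg_nonneg) auto
  next
    case False
    then show ?thesis
      using assms by (cases "j = ?i") (auto intro!: mult_nonpos_nonpos)
  qed
  then show ?thesis
    by (simp add: algebra_simps)
qed

text \<open>One word serves all \<open>j\<close> at once: the expression equals
  \<open>a * b - j * (X - j)\<close>, and the splitting of \<open>k\<close> is chosen so that the
  length is at most its minimum over \<open>j\<close>.\<close>

lemma beads_upper_bound:
  fixes a b k :: nat
  assumes k: "2 \<le> k" and a: "1 \<le> a" and b: "1 \<le> b"
  shows "\<exists>zs. (\<forall>j\<in>{0..min (int a) (int b) - 1}.
      int (length zs) \<le> (int a - j) * (int b - j) + j * int k) \<and>
    beads k (letters zs) (length zs) (a - 1) \<le> int a - 1 - int b"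
proof -
  define X where "X = int a + int b - int k"
  have target: "(int a - j) * (int b - j) + j * int k = int a * int b - j * (X - j)" for j
    by (simp add: X_def algebra_simps)
  define i where "i = min (X div 2) (min (int a) (int b) - 1)"
  have "\<exists>p h. 1 \<le> p \<and> p \<le> a \<and> 1 \<le> h \<and> k = p + h \<and>
    (\<forall>j\<in>{0..min (int a) (int b) - 1}. int p * int b + (int a - int p) * int h \<le> int a * int b - j * (X - j))"
  proof (cases "X \<le> 0")
    \<comment> \<open>Here \<open>a + b \<le> k\<close>, and the best choice is
      \<open>j = 0\<close>: with \<open>p = a\<close> the set \<open>Q\<close> is the whole
      rectangle and each box gets its own letter.\<close>
    case True
    have "j * (X - j) \<le> 0" if "j \<ge> 0" for j
      using True that by (simp add: mult_le_0_iff)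
    then show ?thesis
      using True a b by (intro exI[of _ a] exI[of _ "k - a"]) (auto simp: X_def)
  next
    case False
    have i: "0 \<le> i" "i \<le> X" "i < a" "i < b"
      using False a b by (auto simp: i_def)
    have max: "j * (X - j) \<le> i * (X - i)" if "j \<in> {0..min (int a) (int b) - 1}" for j
      unfolding i_def using that by (intro quadratic_max) auto
    \<comment> \<open>\<open>m\<close> becomes \<open>p\<close> if \<open>a\<close> is the smaller
      side and \<open>h\<close> otherwise; in both cases \<open>p * b + (a - p) * h\<close> is
      exactly the value of the expression at \<open>i\<close>.\<close>
    define m where "m = min (int a) (int b) - i"
    have m: "1 \<le> m"
      using i by (simp add: m_def)
    \<comment> \<open>Controls the loss by rounding down, so that the other part
      \<open>k - m\<close> of the splitting is positive; this uses \<open>k \<ge> 2\<close>.\<close>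
    have "2 * (X div 2) \<ge> X - 1"
      by linarith
    then have "m < k"
      using k X_def by (cases "X div 2 \<le> min (int a) (int b) - 1") (auto simp: m_def i_def)
    note m = m this
    obtain n where n: "m = int n"
      using m by (metis nonneg_int_cases order.trans zero_le_one)
    then have kn: "int (k - n) = int k - int n"
      using m by (simp add: of_nat_diff)
    show ?thesis
    proof (cases "a \<le> b")
      case True
      then have "int n = int a - i" "int (k - n) = int k - int a + i"
        using n kn by (simp_all add: m_def)
      moreover have "(int a - i) * int b + (int a - (int a - i)) * (int k - int a + i) = int a * int b - i * (X - i)"
        by (simp add: X_def algebra_simps)
      ultimately have "int n * int b + (int a - int n) * int (k - n) \<le> int a * int b - j * (X - j)"
        if "j \<in> {0..min (int a) (int b) - 1}" for j
        using max[OF that] by simp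
      moreover have "1 \<le> n" "n \<le> a" "1 \<le> k - n" "k = n + (k - n)"
        using \<open>int n = int a - i\<close> i(1) m n by simp_all
      ultimately show ?thesis
        by blast
    next
      case False
      then have "int n = int b - i" "int (k - n) = int k - int b + i"
        using n kn by (simp_all add: m_def)
      moreover have "(int k - int b + i) * int b + (int a - (int k - int b + i)) * (int b - i) = int a * int b - i * (X - i)"
        by (simp add: X_def algebra_simps)
      ultimately have "int (k - n) * int b + (int a - int (k - n)) * int n \<le> int a * int b - j * (X - j)"
        if "j \<in> {0..min (int a) (int b) - 1}" for j
        using max[OF that] by simp
      moreover have "1 \<le> k - n" "k - n \<le> a" "1 \<le> n" "k = (k - n) + n"
        using \<open>int (k - n) = int k - int b + i\<close> i(2) m n X_def by simp_all
      ultimately show ?thesis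
        by blast
    qed
  qed
  then obtain p h where ph: "1 \<le> p" "p \<le> a" "1 \<le> h" "k = p + h" and
    le: "\<And>j. j \<in> {0..min (int a) (int b) - 1} \<Longrightarrow> int p * int b + (int a - int p) * int h \<le> int a * int b - j * (X - j)"
    by blast
  obtain zs where zs: "length zs \<le> p * b + (a - p) * h"
    "beads k (letters zs) (length zs) (a - 1) \<le> int a - 1 - int b"
    using beads_rectangle[OF ph(1,2) b ph(3,4)] by blast
  have "int (length zs) \<le> int (p * b + (a - p) * h)"
    using zs(1) by linarith
  also have "\<dots> = int p * int b + (int a - int p) * int h"
    using ph by (simp add: of_nat_diff)
  finally show ?thesis
    using zs(2) le by (intro exI[of _ zs]) (fastforce simp: target)
qed

section \<open>Comparison with \<open>rho_bar\<close>\<close>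

lemma rho_bar_attained:
  assumes "int g - int d + int r > 0"
  obtains j where "j \<in> {0..min (int r) (int g - int d + int r - 1)}"
    "rho_bar (int g) (int k) (int d) (int r) = int g - ((int r + 1 - j) * (int g - int d + int r - j) + j * int k)"
proof -
  have "rho_bar (int g) (int k) (int d) (int r) \<in>
      (\<lambda>j. rho (int g) (int d) (int r - j) - j * int k) ` {0..min (int r) (int g - int d + int r - 1)}"
    unfolding rho_bar_def using assms by (intro Max_in) auto
  then obtain j where "j \<in> {0..min (int r) (int g - int d + int r - 1)}"
    "rho_bar (int g) (int k) (int d) (int r) = rho (int g) (int d) (int r - j) - j * int k"
    by blast
  then show thesis
    by (intro that[of j]) (simp_all add: rho_def algebra_simps)
qed

lemma rho_bar_ge:
  assumes "j \<in> {0..min (int r) (int g - int d + int r - 1)}"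
  shows "int g - ((int r + 1 - j) * (int g - int d + int r - j) + j * int k) \<le> rho_bar (int g) (int k) (int d) (int r)"
proof -
  have "rho (int g) (int d) (int r - j) - j * int k \<le> rho_bar (int g) (int k) (int d) (int r)"
    unfolding rho_bar_def by (rule Max_ge) (use assms in auto)
  then show ?thesis
    by (simp add: rho_def algebra_simps)
qed

lemma card_None: "card {i. i < g \<and> w i = None} = g - card {i. i < g \<and> w i \<noteq> None}"
proof -
  have "{i. i < g \<and> w i = None} = {..<g} - {i. i < g \<and> w i \<noteq> None}"
    by auto
  then show ?thesis
    by (simp add: card_Diff_subset subset_iff)
qed

section \<open>Piecewise linear functions on an interval\<close>

definition kink :: "(real \<Rightarrow> real) \<Rightarrow> real \<Rightarrow> real" where
  "kink h s = vector_derivative h (at_right s) - vector_derivative h (at_left s)"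

text \<open>Cells are closed, with the value at the left end as constant term, so that one-sided
  derivatives can be read off at their ends.\<close>

definition affine_cells :: "real set \<Rightarrow> real \<Rightarrow> real \<Rightarrow> (real \<Rightarrow> real) \<Rightarrow> bool" where
  "affine_cells S a b h \<longleftrightarrow> finite S \<and> (\<forall>s t. a \<le> s \<and> s < t \<and> t \<le> b \<and> {s<..<t} \<inter> S = {} \<longrightarrow>
     (\<exists>m::int. \<forall>x\<in>{s..t}. h x = h s + of_int m * (x - s)))"

text \<open>Continuity carries the affine formula from the open cell over to its end points.\<close>

lemma integral_piecewise_linear_cells:
  assumes "integral_piecewise_linear_on a b h"
  obtains S where "affine_cells S a b h"
proof -
  obtain S where cont: "continuous_on {a..b} h" and "finite S" and S: "\<And>s t. a \<le> s \<Longrightarrow> s < t \<Longrightarrow> t \<le> b \<Longrightarrow> {s<..<t} \<inter> S = {} \<Longrightarrow>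
      \<exists>(m::int) c. \<forall>x\<in>{s<..<t}. h x = of_int m * x + c"
    using assms unfolding integral_piecewise_linear_on_def by blast
  have "\<exists>m::int. \<forall>x\<in>{s..t}. h x = h s + of_int m * (x - s)"
    if st: "a \<le> s" "s < t" "t \<le> b" "{s<..<t} \<inter> S = {}" for s t
  proof -
    obtain m :: int and c where mc: "\<And>x. x \<in> {s<..<t} \<Longrightarrow> h x = of_int m * x + c"
      using S[OF st] by blast
    have cl: "closure {s<..<t} = {s..t}"
      using st by simp
    have "continuous_on (closure {s<..<t}) (\<lambda>x. h x - of_int m * x)"
      unfolding cl by (intro continuous_intros continuous_on_subset[OF cont]) (use st in auto)
    then have "h x - of_int m * x = c" if "x \<in> {s..t}" for x
      using continuous_constant_on_closure[of "{s<..<t}" "\<lambda>x. h x - of_int m * x" c x] mc that cl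
      by fastforce
    from this[of s] this have "h x = h s + of_int m * (x - s)" if "x \<in> {s..t}" for x
      using that st by (fastforce simp: algebra_simps)
    then show ?thesis by blast
  qed
  then have "affine_cells S a b h"
    unfolding affine_cells_def using \<open>finite S\<close> by blast
  then show thesis
    by (rule that)
qed

lemma vector_derivative_at_right_affine:
  fixes h :: "real \<Rightarrow> real"
  assumes "s < t" "\<And>x. x \<in> {s..t} \<Longrightarrow> h x = h s + m * (x - s)"
  shows "vector_derivative h (at_right s) = m"
proof -
  have "((\<lambda>x. h s + m * (x - s)) has_real_derivative m) (at s within {s..})"
    by (auto intro!: derivative_eq_intros)
  then have "((\<lambda>x. h s + m * (x - s)) has_vector_derivative m) (at s within {s..})"
    by (simp only: has_real_derivative_iff_has_vector_derivative)
  then have "(h has_vector_derivative m) (at s within {s..})"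
    by (rule has_vector_derivative_transform_within[where d = "t - s"])
      (use assms(1) in \<open>auto simp: dist_real_def intro!: assms(2)[symmetric]\<close>)
  then show ?thesis
    by (intro vector_derivative_within) (auto simp: at_within_Ici_at_right trivial_limit_at_right_real)
qed

lemma vector_derivative_at_left_affine:
  fixes h :: "real \<Rightarrow> real"
  assumes "s < t" "\<And>x. x \<in> {s..t} \<Longrightarrow> h x = h s + m * (x - s)"
  shows "vector_derivative h (at_left t) = m"
proof -
  have "((\<lambda>x. h s + m * (x - s)) has_real_derivative m) (at t within {..t})"
    by (auto intro!: derivative_eq_intros)
  then have "((\<lambda>x. h s + m * (x - s)) has_vector_derivative m) (at t within {..t})"
    by (simp only: has_real_derivative_iff_has_vector_derivative)
  then have "(h has_vector_derivative m) (at t within {..t})"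
    by (rule has_vector_derivative_transform_within[where d = "t - s"])
      (use assms(1) in \<open>auto simp: dist_real_def intro!: assms(2)[symmetric]\<close>)
  then show ?thesis
    by (intro vector_derivative_within) (auto simp: at_within_Iic_at_left trivial_limit_at_left_real)
qed

text \<open>Integrates the second derivative of \<open>h\<close> twice. \<open>S\<close> holds the
  possible breakpoints and \<open>K\<close> the places where a kink may be nonzero; neither has to
  contain the other, so the interval is cut at points of \<open>S\<close> while kinks are summed
  over \<open>K\<close>.\<close>

lemma affine_cells_kinks:
  assumes "affine_cells S a b h" "a < b" "finite K" "\<And>s. a < s \<Longrightarrow> s < b \<Longrightarrow> s \<notin> K \<Longrightarrow> kink h s = 0"
  shows "\<exists>m n :: int. vector_derivative h (at_right a) = m \<and> vector_derivative h (at_left b) = n \<and>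
    of_int n = of_int m + (\<Sum>s\<in>K \<inter> {a<..<b}. kink h s) \<and>
    h b = h a + of_int m * (b - a) + (\<Sum>s\<in>K \<inter> {a<..<b}. kink h s * (b - s))"
  using assms
proof (induction "card (S \<inter> {a<..<b})" arbitrary: a b rule: less_induct)
  case less
  have "finite S"
    using less.prems(1) by (simp add: affine_cells_def)
  show ?case
  proof (cases "S \<inter> {a<..<b} = {}")
    case True
    then have "{a<..<b} \<inter> S = {}"
      by auto
    then have "\<exists>m::int. \<forall>x\<in>{a..b}. h x = h a + of_int m * (x - a)"
      using less.prems(1,2) unfolding affine_cells_def by (elim conjE allE[of _ a] allE[of _ b]) simp
    then obtain m :: int where m: "\<And>x. x \<in> {a..b} \<Longrightarrow> h x = h a + of_int m * (x - a)"
      by blast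
    have "kink h s = 0" if "s \<in> {a<..<b}" for s
    proof -
      have *: "h x = h s + of_int m * (x - s)" if "x \<in> {a..b}" for x
        using m[OF that] m[of s] \<open>s \<in> {a<..<b}\<close> by (simp add: algebra_simps)
      have "vector_derivative h (at_right s) = of_int m"
        using that by (intro vector_derivative_at_right_affine[of s b] *) auto
      moreover have "vector_derivative h (at_left s) = of_int m"
        using that by (intro vector_derivative_at_left_affine[of a s] m) auto
      ultimately show ?thesis
        by (simp add: kink_def)
    qed
    then have "(\<Sum>s\<in>K \<inter> {a<..<b}. kink h s) = 0" "(\<Sum>s\<in>K \<inter> {a<..<b}. kink h s * (b - s)) = 0"
      by (auto intro: sum.neutral)
    moreover have "vector_derivative h (at_right a) = of_int m"
      using less.prems(2) by (intro vector_derivative_at_right_affine[of a b] m) auto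
    moreover have "vector_derivative h (at_left b) = of_int m"
      using less.prems(2) by (intro vector_derivative_at_left_affine[of a b] m) auto
    moreover have "h b = h a + of_int m * (b - a)"
      using less.prems(2) by (intro m) auto
    ultimately show ?thesis
      by (intro exI[of _ m]) simp
  next
    case False
    then obtain c where c: "c \<in> S" "a < c" "c < b"
      by auto
    have cells: "affine_cells S a c h" "affine_cells S c b h"
      using less.prems(1) c by (auto simp: affine_cells_def)
    have "S \<inter> {a<..<c} \<subset> S \<inter> {a<..<b}" "S \<inter> {c<..<b} \<subset> S \<inter> {a<..<b}"
      using c by auto
    then have card: "card (S \<inter> {a<..<c}) < card (S \<inter> {a<..<b})" "card (S \<inter> {c<..<b}) < card (S \<inter> {a<..<b})"
      using \<open>finite S\<close> by (auto intro: psubset_card_mono)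
    obtain m n :: int where 1: "vector_derivative h (at_right a) = m" "vector_derivative h (at_left c) = n"
      "of_int n = of_int m + (\<Sum>s\<in>K \<inter> {a<..<c}. kink h s)"
      "h c = h a + of_int m * (c - a) + (\<Sum>s\<in>K \<inter> {a<..<c}. kink h s * (c - s))"
      using less.hyps[OF card(1) cells(1)] less.prems c by force
    obtain m' n' :: int where 2: "vector_derivative h (at_right c) = m'" "vector_derivative h (at_left b) = n'"
      "of_int n' = of_int m' + (\<Sum>s\<in>K \<inter> {c<..<b}. kink h s)"
      "h b = h c + of_int m' * (b - c) + (\<Sum>s\<in>K \<inter> {c<..<b}. kink h s * (b - s))"
      using less.hyps[OF card(2) cells(2)] less.prems c by force
    have kc: "kink h c = of_int m' - of_int n"
      by (simp add: kink_def 1 2)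
    have split: "(\<Sum>s\<in>K \<inter> {a<..<b}. kink h s * F s) =
        (\<Sum>s\<in>K \<inter> {a<..<c}. kink h s * F s) + kink h c * F c + (\<Sum>s\<in>K \<inter> {c<..<b}. kink h s * F s)"
      for F
    proof -
      \<comment> \<open>\<open>c\<close> need not belong to \<open>K\<close>, but in that case its
        kink vanishes.\<close>
      have "(\<Sum>s\<in>K \<inter> {a<..<b}. kink h s * F s) = (\<Sum>s\<in>insert c (K \<inter> {a<..<b}). kink h s * F s)"
        by (rule sum.mono_neutral_left) (use less.prems c in auto)
      also have "insert c (K \<inter> {a<..<b}) = insert c (K \<inter> {a<..<c} \<union> K \<inter> {c<..<b})"
        using c by auto
      also have "(\<Sum>s\<in>\<dots>. kink h s * F s) = kink h c * F c + (\<Sum>s\<in>K \<inter> {a<..<c} \<union> K \<inter> {c<..<b}. kink h s * F s)"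
        using less.prems by (subst sum.insert) auto
      also have "(\<Sum>s\<in>K \<inter> {a<..<c} \<union> K \<inter> {c<..<b}. kink h s * F s) =
          (\<Sum>s\<in>K \<inter> {a<..<c}. kink h s * F s) + (\<Sum>s\<in>K \<inter> {c<..<b}. kink h s * F s)"
        using less.prems by (intro sum.union_disjoint) auto
      finally show ?thesis by simp
    qed
    have "(\<Sum>s\<in>K \<inter> {a<..<c}. kink h s * (b - s)) =
        (\<Sum>s\<in>K \<inter> {a<..<c}. kink h s * (c - s) + kink h s * (b - c))"
      by (rule sum.cong) (simp_all add: algebra_simps)
    also have "\<dots> = (\<Sum>s\<in>K \<inter> {a<..<c}. kink h s * (c - s)) + (\<Sum>s\<in>K \<inter> {a<..<c}. kink h s) * (b - c)"
      by (simp only: sum.distrib sum_distrib_right)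
    finally have "(\<Sum>s\<in>K \<inter> {a<..<c}. kink h s * (b - s)) =
        (\<Sum>s\<in>K \<inter> {a<..<c}. kink h s * (c - s)) + (\<Sum>s\<in>K \<inter> {a<..<c}. kink h s) * (b - c)" .
    note left = this
    have m': "of_int m' = of_int m + (\<Sum>s\<in>K \<inter> {a<..<c}. kink h s) + kink h c"
      using kc 1(3) by simp
    have "h b = h a + of_int m * (b - a) + ((\<Sum>s\<in>K \<inter> {a<..<c}. kink h s * (c - s)) +
        (\<Sum>s\<in>K \<inter> {a<..<c}. kink h s) * (b - c) + kink h c * (b - c) + (\<Sum>s\<in>K \<inter> {c<..<b}. kink h s * (b - s)))"
      unfolding 2(4) 1(4) m' by algebra
    then have "h b = h a + of_int m * (b - a) + (\<Sum>s\<in>K \<inter> {a<..<b}. kink h s * (b - s))"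
      unfolding split[of "\<lambda>s. b - s"] left .
    moreover have "of_int n' = of_int m + (\<Sum>s\<in>K \<inter> {a<..<b}. kink h s)"
      using 1 2 kc split[of "\<lambda>s. 1"] by simp
    ultimately show ?thesis
      using 1 2 by blast
  qed
qed

section \<open>Functions with prescribed kinks\<close>

definition ramp :: "real \<Rightarrow> int \<Rightarrow> real set \<Rightarrow> (real \<Rightarrow> int) \<Rightarrow> real \<Rightarrow> real" where
  "ramp c m K E t = c + of_int m * t + (\<Sum>u\<in>K. of_int (E u) * max 0 (t - u))"

lemma ramp_affine:
  assumes "finite K" "\<And>u. u \<in> K \<Longrightarrow> u \<le> s \<or> t \<le> u" "x \<in> {s..t}"
  shows "ramp c m K E x = ramp c m K E s + of_int (m + (\<Sum>u\<in>{u\<in>K. u \<le> s}. E u)) * (x - s)"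
proof -
  have "(\<Sum>u\<in>K. of_int (E u) * max 0 (x - u)) =
      (\<Sum>u\<in>K. of_int (E u) * max 0 (s - u) + (if u \<le> s then of_int (E u) * (x - s) else 0))"
  proof (rule sum.cong[OF refl])
    fix u assume "u \<in> K"
    then show "of_int (E u) * max 0 (x - u) = of_int (E u) * max 0 (s - u) + (if u \<le> s then of_int (E u) * (x - s) else 0)"
      using assms(2)[of u] assms(3) by (auto simp: max_def algebra_simps)
  qed
  also have "\<dots> = (\<Sum>u\<in>K. of_int (E u) * max 0 (s - u)) + (\<Sum>u\<in>{u\<in>K. u \<le> s}. of_int (E u)) * (x - s)"
    using assms(1) by (simp add: sum.distrib sum.inter_filter sum_distrib_right if_distrib[of "\<lambda>v. v * (x - s)"] cong: if_cong)
  finally show ?thesis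
    by (simp add: ramp_def algebra_simps)
qed

lemma avoid_finite:
  fixes s :: real
  assumes "finite K" "0 < e"
  shows "\<exists>d>0. d \<le> e \<and> (\<forall>u\<in>K. u = s \<or> u \<le> s - d \<or> s + d \<le> u)"
proof -
  obtain d where d: "d > 0" "\<And>u. u \<in> K \<Longrightarrow> u \<noteq> s \<Longrightarrow> d \<le> dist s u"
    using finite_set_avoid[OF assms(1), of s] by blast
  have "u = s \<or> u \<le> s - min d e \<or> s + min d e \<le> u" if "u \<in> K" for u
    using d(2)[OF that] unfolding dist_real_def by linarith
  then show ?thesis
    using d(1) assms(2) by (intro exI[of _ "min d e"]) simp
qed

lemma integral_piecewise_linear_ramp:
  assumes "finite K" "\<And>t. t \<in> {a..b} \<Longrightarrow> h t = ramp c m K E t"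
  shows "integral_piecewise_linear_on a b h"
  unfolding integral_piecewise_linear_on_def
proof
  have "continuous_on {a..b} (ramp c m K E)"
    unfolding ramp_def by (intro continuous_intros)
  then show "continuous_on {a..b} h"
    by (rule continuous_on_eq) (use assms in simp)
  have "\<exists>(n::int) d. \<forall>x\<in>{s<..<t}. h x = of_int n * x + d"
    if st: "a \<le> s" "s < t" "t \<le> b" "{s<..<t} \<inter> K = {}" for s t
  proof -
    have "u \<le> s \<or> t \<le> u" if "u \<in> K" for u
      using that st(4) by force
    then have "h x = ramp c m K E s + of_int (m + (\<Sum>u\<in>{u\<in>K. u \<le> s}. E u)) * (x - s)" if "x \<in> {s<..<t}" for x
      using assms(2)[of x] ramp_affine[OF assms(1), of s t x] st that by auto
    then have "\<forall>x\<in>{s<..<t}. h x = of_int (m + (\<Sum>u\<in>{u\<in>K. u \<le> s}. E u)) * x +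
        (ramp c m K E s - of_int (m + (\<Sum>u\<in>{u\<in>K. u \<le> s}. E u)) * s)"
      by (simp only: right_diff_distrib) simp
    then show ?thesis by (intro exI)
  qed
  then show "\<exists>S. finite S \<and> (\<forall>s t. a \<le> s \<and> s < t \<and> t \<le> b \<and> {s<..<t} \<inter> S = {} \<longrightarrow>
           (\<exists>(m::int) c. \<forall>x\<in>{s<..<t}. h x = of_int m * x + c))"
    using assms(1) by (intro exI[of _ K]) simp
qed

lemma ramp_right_derivative:
  assumes K: "finite K" and h: "\<And>t. t \<in> {a..b} \<Longrightarrow> h t = ramp c m K E t" and s: "a \<le> s" "s < b"
  shows "vector_derivative h (at_right s) = of_int (m + (\<Sum>u\<in>{u\<in>K. u \<le> s}. E u))"
proof -
  have "0 < b - s"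
    using s by simp
  then obtain d where d: "0 < d" "d \<le> b - s" "\<forall>u\<in>K. u = s \<or> u \<le> s - d \<or> s + d \<le> u"
    using avoid_finite[OF K, of "b - s" s] by blast
  have u: "u \<le> s \<or> s + d \<le> u" if "u \<in> K" for u
    using bspec[OF d(3) that] d(1) by linarith
  have "h x = h s + of_int (m + (\<Sum>u\<in>{u\<in>K. u \<le> s}. E u)) * (x - s)" if x: "x \<in> {s..s + d}" for x
  proof -
    have "h x = ramp c m K E x" "h s = ramp c m K E s"
      using x d s by (intro h; simp)+
    then show ?thesis
      using ramp_affine[OF K u x] by (simp only:)
  qed
  note eq = this
  show ?thesis
    by (rule vector_derivative_at_right_affine[of s "s + d"]) (use d(1) in simp, rule eq)
qed

lemma ramp_left_derivative:
  assumes K: "finite K" and h: "\<And>t. t \<in> {a..b} \<Longrightarrow> h t = ramp c m K E t" and s: "a < s" "s \<le> b"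
  shows "vector_derivative h (at_left s) = of_int (m + (\<Sum>u\<in>{u\<in>K. u < s}. E u))"
proof -
  have "0 < s - a"
    using s by simp
  then obtain d where d: "0 < d" "d \<le> s - a" "\<forall>u\<in>K. u = s \<or> u \<le> s - d \<or> s + d \<le> u"
    using avoid_finite[OF K, of "s - a" s] by blast
  have u: "u \<le> s - d \<or> s \<le> u" if "u \<in> K" for u
    using bspec[OF d(3) that] d(1) by linarith
  have less: "{u\<in>K. u \<le> s - d} = {u\<in>K. u < s}"
    using u d(1) by fastforce
  have "h x = h (s - d) + of_int (m + (\<Sum>u\<in>{u\<in>K. u < s}. E u)) * (x - (s - d))"
    if x: "x \<in> {s - d..s}" for x
  proof -
    have "h x = ramp c m K E x" "h (s - d) = ramp c m K E (s - d)"
      using x d s by (intro h; simp)+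
    then show ?thesis
      using ramp_affine[OF K u x] by (simp only: less)
  qed
  note eq = this
  show ?thesis
    by (rule vector_derivative_at_left_affine[of "s - d" s]) (use d(1) in simp, rule eq)
qed

lemma ramp_kink:
  assumes K: "finite K" and h: "\<And>t. t \<in> {a..b} \<Longrightarrow> h t = ramp c m K E t" and s: "a < s" "s < b"
  shows "kink h s = (if s \<in> K then of_int (E s) else 0)"
proof -
  have "{u\<in>K. u \<le> s} = (if s \<in> K then insert s {u\<in>K. u < s} else {u\<in>K. u < s})"
    by (auto simp: order.order_iff_strict)
  moreover have "vector_derivative h (at_right s) = of_int (m + (\<Sum>u\<in>{u\<in>K. u \<le> s}. E u))"
    by (rule ramp_right_derivative[OF K h]) (use s in auto)
  moreover have "vector_derivative h (at_left s) = of_int (m + (\<Sum>u\<in>{u\<in>K. u < s}. E u))"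
    by (rule ramp_left_derivative[OF K h]) (use s in auto)
  ultimately show ?thesis
    using K by (simp add: kink_def)
qed

section \<open>Divisors and polytopes\<close>

text \<open>The linear extension of \<open>\<phi>\<close>. Degrees, Abel-Jacobi coordinates and
  windings of chains are all instances, hence the arbitrary type of points.\<close>

definition evaluate :: "('p \<Rightarrow> real) \<Rightarrow> ('p \<Rightarrow>\<^sub>0 int) \<Rightarrow> real" where
  "evaluate \<phi> D = (\<Sum>p\<in>Poly_Mapping.keys D. of_int (Poly_Mapping.lookup D p) * \<phi> p)"

lemma evaluate_superset:
  assumes "finite A" "Poly_Mapping.keys D \<subseteq> A"
  shows "evaluate \<phi> D = (\<Sum>p\<in>A. of_int (Poly_Mapping.lookup D p) * \<phi> p)"
  unfolding evaluate_def using assms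
  by (intro sum.mono_neutral_left) (auto simp: in_keys_iff)

lemma evaluate_add: "evaluate \<phi> (D + E) = evaluate \<phi> D + evaluate \<phi> E"
proof -
  let ?A = "Poly_Mapping.keys D \<union> Poly_Mapping.keys E"
  have "Poly_Mapping.keys (D + E) \<subseteq> ?A"
    by (rule Poly_Mapping.keys_add)
  then show ?thesis
    by (simp add: evaluate_superset[of ?A] lookup_add algebra_simps sum.distrib)
qed

lemma evaluate_uminus: "evaluate \<phi> (- D) = - evaluate \<phi> D"
  by (simp add: evaluate_def sum_negf)

lemma evaluate_diff: "evaluate \<phi> (D - E) = evaluate \<phi> D - evaluate \<phi> E"
  using evaluate_add[of \<phi> D "- E"] by (simp add: evaluate_uminus)

lemma evaluate_zero [simp]: "evaluate \<phi> 0 = 0"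
  by (simp add: evaluate_def)

lemma evaluate_of [simp]: "evaluate \<phi> (frag_of p) = \<phi> p"
  by (simp add: evaluate_def)

lemma divisor_degree_evaluate: "real_of_int (divisor_degree D) = evaluate (\<lambda>_. 1) D"
  by (simp add: divisor_degree_def evaluate_def)

lemma divisor_degree_diff: "divisor_degree (D - E) = divisor_degree D - divisor_degree E"
  using evaluate_diff[of "\<lambda>_. 1" D E]
  by (simp flip: divisor_degree_evaluate of_int_diff)

definition divisor_of :: "'p list \<Rightarrow> ('p \<Rightarrow>\<^sub>0 int)" where
  "divisor_of ps = (\<Sum>p\<leftarrow>ps. frag_of p)"

lemma divisor_of_simps [simp]:
  "divisor_of [] = 0"
  "divisor_of (p # ps) = frag_of p + divisor_of ps"
  by (simp_all add: divisor_of_def)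

lemma evaluate_divisor_of: "evaluate \<phi> (divisor_of ps) = (\<Sum>p\<leftarrow>ps. \<phi> p)"
  by (induction ps) (simp_all add: evaluate_add)

lemma keys_divisor_of: "Poly_Mapping.keys (divisor_of ps) \<subseteq> set ps"
proof (induction ps)
  case (Cons p ps)
  then show ?case
    using Poly_Mapping.keys_add[of "frag_of p" "divisor_of ps"] by auto
qed simp

lemma lookup_divisor_of: "Poly_Mapping.lookup (divisor_of ps) p = int (count_list ps p)"
  by (induction ps) (auto simp: lookup_add)

lemma effective_divisor_of: "effective (divisor_of ps)"
  by (simp add: effective_def lookup_divisor_of)

lemma divisor_degree_divisor_of: "divisor_degree (divisor_of ps) = int (length ps)"
proof -
  have "real_of_int (divisor_degree (divisor_of ps)) = real (length ps)"
    unfolding divisor_degree_evaluate evaluate_divisor_of by (induction ps) auto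
  then show ?thesis
    by linarith
qed

lemma effective_degree_nonneg: "effective E \<Longrightarrow> 0 \<le> divisor_degree E"
  unfolding effective_def divisor_degree_def by (intro sum_nonneg) blast

text \<open>Removes one chip at a time. Lists are the form in which the rank recursion handles
  single chips.\<close>

lemma effective_obtain_list:
  assumes "effective E" "divisor_degree E = int n"
  obtains ps where "length ps = n" "set ps \<subseteq> Poly_Mapping.keys E" "E = divisor_of ps"
proof -
  have "\<exists>ps. length ps = n \<and> set ps \<subseteq> Poly_Mapping.keys E \<and> E = divisor_of ps"
    using assms
  proof (induction n arbitrary: E)
    case 0
    then have "Poly_Mapping.lookup E p = 0" if "p \<in> Poly_Mapping.keys E" for p
      using that sum_nonneg_0[of "Poly_Mapping.keys E" "Poly_Mapping.lookup E" p]
      by (auto simp: effective_def divisor_degree_def)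
    then have "E = 0"
      by (metis in_keys_iff keys_eq_empty ex_in_conv)
    then show ?case by simp
  next
    case (Suc n)
    then have "E \<noteq> 0"
      by (auto simp: divisor_degree_def)
    then obtain p where p: "p \<in> Poly_Mapping.keys E"
      by (metis keys_eq_empty ex_in_conv)
    then have "Poly_Mapping.lookup E p \<noteq> 0"
      by (simp add: in_keys_iff)
    then have E1: "1 \<le> Poly_Mapping.lookup E p"
      using Suc.prems by (metis effective_def int_one_le_iff_zero_less order_less_le)
    define E' where "E' = E - frag_of p"
    have "effective E'"
      using Suc.prems(1) E1 by (auto simp: effective_def E'_def lookup_minus)
    moreover have "divisor_degree E' = int n"
      using Suc.prems by (simp add: E'_def divisor_degree_diff divisor_degree_def[of "frag_of p"])
    ultimately obtain ps where ps: "length ps = n" "set ps \<subseteq> Poly_Mapping.keys E'" "E' = divisor_of ps"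
      using Suc.IH by blast
    have "Poly_Mapping.keys E' \<subseteq> Poly_Mapping.keys E"
      unfolding E'_def using keys_diff[of E "frag_of p"] p by auto
    moreover have "E = divisor_of (p # ps)"
      using ps(3) by (simp add: E'_def algebra_simps)
    ultimately show ?case
      using p ps by (intro exI[of _ "p # ps"]) auto
  qed
  then show thesis
    using that by blast
qed

lemma evaluate_cmul: "evaluate \<phi> (frag_cmul c D) = of_int c * evaluate \<phi> D"
proof -
  have "evaluate \<phi> (frag_cmul c D) =
      (\<Sum>p\<in>Poly_Mapping.keys D. of_int (Poly_Mapping.lookup (frag_cmul c D) p) * \<phi> p)"
    by (rule evaluate_superset) (auto dest: subsetD[OF keys_cmul])
  then show ?thesis
    by (simp add: evaluate_def sum_distrib_left mult.assoc)
qed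

lemma evaluate_frag_extend: "evaluate \<phi> (frag_extend b c) = evaluate (\<lambda>x. evaluate \<phi> (b x)) c"
  using subset_UNIV
proof (induction c rule: frag_induction)
  case (diff a b)
  then show ?case
    by (simp add: frag_extend_diff evaluate_diff)
qed auto

lemma evaluate_diff_fun: "evaluate (\<lambda>x. \<phi> x - \<psi> x) D = evaluate \<phi> D - evaluate \<psi> D"
  by (simp add: evaluate_def sum_subtractf right_diff_distrib)

lemma lookup_scaleR:
  fixes x :: "'a \<Rightarrow>\<^sub>0 'b::real_vector"
  shows "Poly_Mapping.lookup (r *\<^sub>R x) i = r *\<^sub>R Poly_Mapping.lookup x i"
proof -
  have "{i. r *\<^sub>R Poly_Mapping.lookup x i \<noteq> 0} \<subseteq> {i. Poly_Mapping.lookup x i \<noteq> 0}"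
    by auto
  then have "finite {i. r *\<^sub>R Poly_Mapping.lookup x i \<noteq> 0}"
    using finite_subset finite_lookup by blast
  then show ?thesis
    by (simp add: scaleR_poly_mapping_def Abs_poly_mapping_inverse)
qed

text \<open>Minkowski sums commute with convex hulls, and a finite sum of finite vertex sets is
  finite.\<close>

lemma polytope_set_sum:
  fixes S :: "'i \<Rightarrow> 'a::real_vector set"
  assumes "finite I" "\<And>i. i \<in> I \<Longrightarrow> polytope (S i)"
  shows "polytope {\<Sum>i\<in>I. s i | s. \<forall>i\<in>I. s i \<in> S i}"
proof -
  have "\<forall>i\<in>I. \<exists>V. finite V \<and> S i = convex hull V"
    using assms(2) by (simp add: polytope_def)
  then obtain V where V: "\<And>i. i \<in> I \<Longrightarrow> finite (V i)" "\<And>i. i \<in> I \<Longrightarrow> S i = convex hull (V i)"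
    by metis
  have "{\<Sum>i\<in>I. s i | s. \<forall>i\<in>I. s i \<in> S i} = (\<Sum>i\<in>I. S i)"
    by (rule set_sum_alt[OF assms(1), symmetric])
  also have "\<dots> = convex hull (\<Sum>i\<in>I. V i)"
    using V(2) by (simp add: convex_hull_set_sum)
  finally have "{\<Sum>i\<in>I. s i | s. \<forall>i\<in>I. s i \<in> S i} = convex hull (\<Sum>i\<in>I. V i)" .
  moreover have "finite (\<Sum>i\<in>I. V i)"
    using assms(1) V(1) by (induction I rule: finite_induct) (auto simp: finite_set_plus)
  ultimately show ?thesis
    unfolding polytope_def by blast
qed

section \<open>The rank on a chain of cycles\<close>

text \<open>
  Retracts the chain onto the cycle \<open>i\<close> and measures the position from the left vertex along the top
  edge, modulo \<open>k\<close>; both edges lead to the value \<open>L = l\<close> at the right vertex because \<open>- (k - l) = l\<close>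
  modulo \<open>k\<close>.
\<close>

fun coord :: "real \<Rightarrow> nat \<Rightarrow> (nat, nat \<times> side) point \<Rightarrow> real" where
  "coord L i (Vertex v) = (if v \<le> i then 0 else L)"
| "coord L i (Interior (j, s) t) =
     (if j < i then 0 else if i < j then L else case s of Top \<Rightarrow> t | Bottom \<Rightarrow> - t)"

locale cycle_chain =
  fixes k l :: nat
  assumes l1: "1 \<le> l" and lk: "l < k" and kl: "coprime k l"
begin

abbreviation \<Gamma> :: "nat \<Rightarrow> (nat, nat \<times> side) metric_graph" where
  "\<Gamma> n \<equiv> chain_of_cycles n k l"

abbreviation crd :: "nat \<Rightarrow> (nat, nat \<times> side) point \<Rightarrow> real" where
  "crd \<equiv> coord (real l)"

definition period :: "real \<Rightarrow> bool" where
  "period y \<longleftrightarrow> (\<exists>n::int. y = of_int n * real k)"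

lemma k0: "0 < real k"
  using lk by simp

lemma period_0 [simp]: "period 0"
  by (auto simp: period_def intro: exI[of _ 0])

lemma period_k [simp]: "period (of_int n * real k)"
  by (auto simp: period_def)

lemma period_add: "period x \<Longrightarrow> period y \<Longrightarrow> period (x + y)"
  unfolding period_def by (metis distrib_right of_int_add)

lemma period_minus: "period x \<Longrightarrow> period (- x)"
  unfolding period_def by (metis mult_minus_left of_int_minus)

lemma period_diff: "period x \<Longrightarrow> period y \<Longrightarrow> period (x - y)"
  using period_add[of x "- y"] period_minus[of y] by simp

lemma period_add_cancel: "period x \<Longrightarrow> period (x + y) \<longleftrightarrow> period y"
  using period_add period_diff[of "x + y" x] by auto

lemma period_bounded: "period x \<Longrightarrow> \<bar>x\<bar> < real k \<Longrightarrow> x = 0"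
proof -
  assume "period x" "\<bar>x\<bar> < real k"
  then obtain n :: int where n: "x = of_int n * real k"
    unfolding period_def by blast
  then have "\<bar>real_of_int n\<bar> * real k < 1 * real k"
    using \<open>\<bar>x\<bar> < real k\<close> by (simp add: abs_mult)
  then have "\<bar>real_of_int n\<bar> < 1"
    using k0 by (simp only: mult_less_cancel_right)
  then have "n = 0"
    by linarith
  then show "x = 0"
    using n by simp
qed

text \<open>Coprimality enters here: the class of \<open>l\<close> has order \<open>k\<close> in the
  group of integers modulo \<open>k\<close>, so conditions on chip counts become congruences modulo
  \<open>k\<close>.\<close>

lemma period_int_mult_l: "period (of_int m * real l) \<longleftrightarrow> int k dvd m"
proof
  assume "period (of_int m * real l)"
  then obtain n where "real_of_int m * real l = of_int n * real k"
    by (auto simp: period_def)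
  then have "m * int l = n * int k"
    by (metis of_int_eq_iff of_int_mult of_int_of_nat_eq)
  then have "int k dvd m * int l"
    by simp
  then show "int k dvd m"
    using kl by (simp add: coprime_dvd_mult_left_iff)
next
  assume "int k dvd m"
  then obtain c where "m = int k * c"
    by (rule dvdE)
  then have "of_int m * real l = of_int (c * int l) * real k"
    by simp
  then show "period (of_int m * real l)"
    by (metis period_k)
qed

lemma points_iff:
  "Vertex v \<in> points (\<Gamma> n) \<longleftrightarrow> v \<le> n"
  "Interior (j, s) t \<in> points (\<Gamma> n) \<longleftrightarrow>
    j < n \<and> 0 < t \<and> t < (case s of Top \<Rightarrow> real l | Bottom \<Rightarrow> real k - real l)"
  by (cases s; auto simp: points_def chain_of_cycles_def)+

lemma side_UNIV: "x \<in> {Top, Bottom}"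
  by (cases x) auto

lemma points_Suc: "points (\<Gamma> n) \<subseteq> points (\<Gamma> (Suc n))"
proof
  fix p assume "p \<in> points (\<Gamma> n)"
  then show "p \<in> points (\<Gamma> (Suc n))"
    by (cases p) (auto simp: points_iff)
qed

lemma crd_right: "p \<in> points (\<Gamma> n) \<Longrightarrow> n \<le> i \<Longrightarrow> crd i p = 0"
  by (cases "(real l, i, p)" rule: coord.cases) (auto simp: points_iff)

lemma crd_left: "p \<in> points (\<Gamma> (Suc n)) \<Longrightarrow> p \<notin> points (\<Gamma> n) \<Longrightarrow> i < n \<Longrightarrow> crd i p = real l"
  by (cases "(real l, i, p)" rule: coord.cases) (auto simp: points_iff)

text \<open>Contracts the last cycle to the vertex at which it is attached. The earlier coordinates
  do not notice this, because they are constant on the last cycle.\<close>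

definition push :: "nat \<Rightarrow> (nat, nat \<times> side) point \<Rightarrow> (nat, nat \<times> side) point" where
  "push n p = (if p \<in> points (\<Gamma> n) then p else Vertex n)"

lemma push_points [simp]: "push n p \<in> points (\<Gamma> n)"
  by (simp add: push_def points_iff)

lemma crd_push: "p \<in> points (\<Gamma> (Suc n)) \<Longrightarrow> i < n \<Longrightarrow> crd i (push n p) = crd i p"
  by (simp add: push_def crd_left)

lemma period_reduce:
  obtains u where "0 \<le> u" "u < real k" "period (y - u)"
proof
  let ?u = "frac (y / real k) * real k"
  have "y - ?u = of_int \<lfloor>y / real k\<rfloor> * real k"
    using k0 by (simp add: frac_def algebra_simps)
  then show "period (y - ?u)"
    by simp
  show "0 \<le> ?u" "?u < real k"
    using k0 by (simp_all add: frac_lt_1)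
qed

lemma ex_point_on_cycle:
  obtains p where "p \<in> points (\<Gamma> (Suc n))" "\<And>i. i < n \<Longrightarrow> crd i p = real l" "period (y - crd n p)"
    "\<And>i. n < i \<Longrightarrow> crd i p = 0"
proof -
  obtain u where u: "0 \<le> u" "u < real k" "period (y - u)"
    by (rule period_reduce)
  consider "u = 0" | "0 < u" "u < real l" | "u = real l" | "real l < u"
    using u by linarith
  then show thesis
  proof cases
    case 1
    then show thesis
      using u by (intro that[of "Vertex n"]) (auto simp: points_iff)
  next
    case 2
    then show thesis
      using u by (intro that[of "Interior (n, Top) u"]) (auto simp: points_iff)
  next
    case 3
    then show thesis
      using u by (intro that[of "Vertex (Suc n)"]) (auto simp: points_iff)
  next
    \<comment> \<open>The bottom edge is traversed with negative coordinates, from \<open>0\<close>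
      down to \<open>l - k\<close>.\<close>
    case 4
    have "period (y - (u - real k))"
      using period_add[OF u(3) period_k[of 1]] by (simp add: algebra_simps)
    then show thesis
      using u 4 by (intro that[of "Interior (n, Bottom) (real k - u)"]) (auto simp: points_iff algebra_simps)
  qed
qed

section \<open>Effective classes and rank on subchains\<close>

definition aj :: "(nat, nat \<times> side) point list \<Rightarrow> nat \<Rightarrow> real" where
  "aj ps i = (\<Sum>p\<leftarrow>ps. crd i p)"

lemma aj_simps [simp]:
  "aj [] i = 0"
  "aj (p # ps) i = crd i p + aj ps i"
  "aj (ps @ qs) i = aj ps i + aj qs i"
  by (simp_all add: aj_def)

lemma aj_right: "set ps \<subseteq> points (\<Gamma> n) \<Longrightarrow> n \<le> i \<Longrightarrow> aj ps i = 0"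
  by (induction ps) (auto simp: crd_right)

lemma aj_push: "set ps \<subseteq> points (\<Gamma> (Suc n)) \<Longrightarrow> i < n \<Longrightarrow> aj (map (push n) ps) i = aj ps i"
  by (induction ps) (auto simp: crd_push)

lemma aj_split: "p \<in> set ps \<Longrightarrow> aj ps i = crd i p + aj (remove1 p ps) i"
  unfolding aj_def by (rule sum_list_map_remove1)

text \<open>
  The class of degree \<open>d\<close> with coordinates \<open>x\<close> on the chain of the first \<open>n\<close> cycles is effective
  (\<open>effl\<close>), respectively has rank at least \<open>r\<close> (\<open>rkl\<close>).
\<close>

definition effl :: "nat \<Rightarrow> int \<Rightarrow> (nat \<Rightarrow> real) \<Rightarrow> bool" where
  "effl n d x \<longleftrightarrow> (\<exists>qs. int (length qs) = d \<and> set qs \<subseteq> points (\<Gamma> n) \<and>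
     (\<forall>i<n. period (x i - aj qs i)))"

lemma effl_cong: "(\<And>i. i < n \<Longrightarrow> period (x i - y i)) \<Longrightarrow> effl n d x \<longleftrightarrow> effl n d y"
proof -
  have *: "effl n d y" if e: "effl n d x" and xy: "\<And>i. i < n \<Longrightarrow> period (x i - y i)" for x y
  proof -
    obtain qs where qs: "int (length qs) = d" "set qs \<subseteq> points (\<Gamma> n)" "\<And>i. i < n \<Longrightarrow> period (x i - aj qs i)"
      using e by (auto simp: effl_def)
    have "period (y i - aj qs i)" if "i < n" for i
      using period_diff[OF qs(3)[OF that] xy[OF that]] by simp
    then show ?thesis
      using qs by (auto simp: effl_def)
  qed
  assume "\<And>i. i < n \<Longrightarrow> period (x i - y i)"
  moreover from this have "\<And>i. i < n \<Longrightarrow> period (y i - x i)"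
    using period_minus by force
  ultimately show ?thesis
    using * by blast
qed

lemma effl_add_vertex:
  assumes "effl n d (\<lambda>i. x i - real l)"
  shows "effl n (d + 1) x"
proof -
  obtain qs where qs: "int (length qs) = d" "set qs \<subseteq> points (\<Gamma> n)"
    "\<And>i. i < n \<Longrightarrow> period (x i - real l - aj qs i)"
    using assms by (auto simp: effl_def)
  then show ?thesis
    unfolding effl_def
    by (intro exI[of _ "Vertex n # qs"]) (auto simp: points_iff algebra_simps)
qed

text \<open>A chip beyond the attaching vertex can be moved along the last cycle to realise any
  value of \<open>x n\<close>. As soon as there is one, the last coordinate imposes no condition;
  seen from the left this chip counts \<open>l\<close> in each coordinate, and the others may be
  pushed to the vertex. Without such a chip \<open>x n\<close> has to vanish modulo
  \<open>k\<close>.\<close>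

lemma effl_Suc:
  "effl (Suc n) d x \<longleftrightarrow> effl n (d - 1) (\<lambda>i. x i - real l) \<or> period (x n) \<and> effl n d x"
proof
  assume "effl (Suc n) d x"
  then obtain qs where qs: "int (length qs) = d" "set qs \<subseteq> points (\<Gamma> (Suc n))"
    "\<And>i. i < Suc n \<Longrightarrow> period (x i - aj qs i)"
    by (auto simp: effl_def)
  show "effl n (d - 1) (\<lambda>i. x i - real l) \<or> period (x n) \<and> effl n d x"
  proof (cases "set qs \<subseteq> points (\<Gamma> n)")
    case True
    then have "period (x n)"
      using qs(3)[of n] aj_right[of qs n n] by simp
    then show ?thesis
      using qs True by (auto simp: effl_def)
  next
    case False
    then obtain p where p: "p \<in> set qs" "p \<notin> points (\<Gamma> n)"
      by blast
    define rs where "rs = map (push n) (remove1 p qs)"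
    have sub: "set (remove1 p qs) \<subseteq> points (\<Gamma> (Suc n))"
      using qs(2) set_remove1_subset by fastforce
    have "aj qs i = real l + aj rs i" if "i < n" for i
      using aj_split[OF p(1), of i] aj_push[OF sub that] crd_left[of p n i] p qs(2) that
      by (auto simp: rs_def)
    then have "period (x i - real l - aj rs i)" if "i < n" for i
      using qs(3)[of i] that by (simp add: algebra_simps)
    moreover have "set rs \<subseteq> points (\<Gamma> n)"
      by (auto simp: rs_def)
    moreover have "length qs \<ge> 1"
      using p by (cases qs) auto
    then have "int (length rs) = d - 1"
      using qs(1) p by (simp add: rs_def length_remove1 of_nat_diff)
    ultimately show ?thesis
      by (auto simp: effl_def)
  qed
next
  assume "effl n (d - 1) (\<lambda>i. x i - real l) \<or> period (x n) \<and> effl n d x"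
  then show "effl (Suc n) d x"
  proof
    assume "effl n (d - 1) (\<lambda>i. x i - real l)"
    then obtain qs where qs: "int (length qs) = d - 1" "set qs \<subseteq> points (\<Gamma> n)"
      "\<And>i. i < n \<Longrightarrow> period (x i - real l - aj qs i)"
      by (auto simp: effl_def)
    obtain p where p: "p \<in> points (\<Gamma> (Suc n))" "\<And>i. i < n \<Longrightarrow> crd i p = real l" "period (x n - crd n p)"
      using ex_point_on_cycle[of n "x n"] by metis
    have "period (x i - aj (p # qs) i)" if "i < Suc n" for i
    proof (cases "i = n")
      case True
      then show ?thesis
        using p aj_right[of qs n n] qs by simp
    next
      case False
      then show ?thesis
        using p(2)[of i] qs(3)[of i] that by (simp add: algebra_simps)
    qed
    then show ?thesis
      unfolding effl_def using qs p points_Suc[of n]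
      by (intro exI[of _ "p # qs"]) auto
  next
    assume *: "period (x n) \<and> effl n d x"
    then obtain qs where qs: "int (length qs) = d" "set qs \<subseteq> points (\<Gamma> n)"
      "\<And>i. i < n \<Longrightarrow> period (x i - aj qs i)"
      by (auto simp: effl_def)
    have "period (x i - aj qs i)" if "i < Suc n" for i
      using that * qs aj_right[of qs n n] by (cases "i = n") auto
    then show ?thesis
      unfolding effl_def using qs points_Suc by blast
  qed
qed

definition rkl :: "nat \<Rightarrow> int \<Rightarrow> (nat \<Rightarrow> real) \<Rightarrow> nat \<Rightarrow> bool" where
  "rkl n d x r \<longleftrightarrow> (\<forall>ps. length ps = r \<longrightarrow> set ps \<subseteq> points (\<Gamma> n) \<longrightarrow>
     effl n (d - int r) (\<lambda>i. x i - aj ps i))"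

text \<open>
  Moving a point of the last cycle to its left vertex affects the last coordinate only, and this
  coordinate is irrelevant as soon as one chip may be placed freely on the last cycle.
\<close>

lemma rkl_Suc:
  "rkl (Suc n) d x r \<longleftrightarrow> rkl n (d - 1) (\<lambda>i. x i - real l) r \<or>
     period (x n) \<and> rkl n d x r \<and> (r = 0 \<or> rkl n (d - 2) (\<lambda>i. x i - 2 * real l) (r - 1))"
    (is "_ \<longleftrightarrow> ?A \<or> ?B")
proof
  assume L: "rkl (Suc n) d x r"
  have eff: "effl n (d - int r - 1) (\<lambda>i. x i - aj ps i - real l) \<or>
      period (x n - aj ps n) \<and> effl n (d - int r) (\<lambda>i. x i - aj ps i)"
    if "length ps = r" "set ps \<subseteq> points (\<Gamma> (Suc n))" for ps
    using L that effl_Suc[of n "d - int r" "\<lambda>i. x i - aj ps i"] by (simp add: rkl_def)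
  show "?A \<or> ?B"
  proof (cases ?A)
    case False
    then obtain ps where ps: "length ps = r" "set ps \<subseteq> points (\<Gamma> n)"
      "\<not> effl n (d - 1 - int r) (\<lambda>i. x i - real l - aj ps i)"
      by (auto simp: rkl_def)
    \<comment> \<open>A test divisor on the subchain that refutes \<open>?A\<close> leaves only the
      second alternative, and it does not affect the last coordinate.\<close>
    then have "period (x n - aj ps n)"
      using eff[of ps] points_Suc[of n] by (auto simp: algebra_simps)
    then have xn: "period (x n)"
      using aj_right[of ps n n] ps by simp
    have "rkl n d x r"
      unfolding rkl_def
    proof (intro allI impI)
      fix ps assume ps: "length ps = r" "set ps \<subseteq> points (\<Gamma> n)"
      show "effl n (d - int r) (\<lambda>i. x i - aj ps i)"
        using eff[of ps] ps points_Suc[of n] effl_add_vertex[of n "d - int r - 1" "\<lambda>i. x i - aj ps i"]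
        by auto
    qed
    moreover have "rkl n (d - 2) (\<lambda>i. x i - 2 * real l) (r - 1)" if "r \<noteq> 0"
      unfolding rkl_def
    proof (intro allI impI)
      fix ps assume ps: "length ps = r - 1" "set ps \<subseteq> points (\<Gamma> n)"
      \<comment> \<open>The midpoint of the top edge shifts the last coordinate by
        \<open>l / 2\<close>, which is not a multiple of \<open>k\<close>, and so rules out the
        second alternative. One \<open>l\<close> comes from this point as seen from the left, the
        other from the first alternative.\<close>
      let ?p = "Interior (n, Top) (real l / 2)"
      have p: "?p \<in> points (\<Gamma> (Suc n))"
        using l1 by (simp add: points_iff)
      have "aj (?p # ps) n = real l / 2"
        using aj_right[of ps n n] ps by simp
      moreover have "\<not> period (x n - real l / 2)"
      proof
        assume "period (x n - real l / 2)"
        then have "period (real l / 2)"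
          using period_diff[OF xn] by fastforce
        then show False
          using period_bounded l1 lk by fastforce
      qed
      ultimately have "effl n (d - int r - 1) (\<lambda>i. x i - aj (?p # ps) i - real l)"
        using eff[of "?p # ps"] p ps points_Suc[of n] that by auto
      also have "?this \<longleftrightarrow> effl n (d - int r - 1) (\<lambda>i. x i - 2 * real l - aj ps i)"
        by (rule effl_cong) (simp add: algebra_simps)
      also have "d - int r - 1 = d - 2 - int (r - 1)"
        using that by simp
      finally show "effl n (d - 2 - int (r - 1)) (\<lambda>i. x i - 2 * real l - aj ps i)" .
    qed
    ultimately show ?thesis
      using xn by blast
  qed simp
next
  assume R: "?A \<or> ?B"
  show "rkl (Suc n) d x r"
    unfolding rkl_def effl_Suc
  proof (intro allI impI)
    fix ps assume ps: "length ps = r" "set ps \<subseteq> points (\<Gamma> (Suc n))"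
    show "effl n (d - int r - 1) (\<lambda>i. x i - aj ps i - real l) \<or>
      period (x n - aj ps n) \<and> effl n (d - int r) (\<lambda>i. x i - aj ps i)"
      using R
    proof
      assume A: ?A
      have "effl n (d - 1 - int r) (\<lambda>i. x i - real l - aj (map (push n) ps) i)"
        using A ps by (simp add: rkl_def image_subset_iff)
      also have "?this \<longleftrightarrow> effl n (d - 1 - int r) (\<lambda>i. x i - aj ps i - real l)"
        by (rule effl_cong) (simp add: aj_push[OF ps(2)])
      also have "d - 1 - int r = d - int r - 1"
        by simp
      finally show ?thesis ..
    next
      assume B: ?B
      show ?thesis
      proof (cases "set ps \<subseteq> points (\<Gamma> n)")
        case True
        then show ?thesis
          using B ps aj_right[of ps n n] by (auto simp: rkl_def)
      next
        case False
        then obtain p where p: "p \<in> set ps" "p \<notin> points (\<Gamma> n)"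
          by blast
        \<comment> \<open>The test point \<open>p\<close> and the chip reserved for the last cycle
          together account for \<open>2 * real l\<close>; the remaining \<open>r - 1\<close> test
          points are pushed to the subchain.\<close>
        define rs where "rs = map (push n) (remove1 p ps)"
        have sub: "set (remove1 p ps) \<subseteq> points (\<Gamma> (Suc n))"
          using ps(2) set_remove1_subset by fastforce
        have r: "r \<noteq> 0"
          using p ps by auto
        have "aj ps i = real l + aj rs i" if "i < n" for i
          using aj_split[OF p(1), of i] aj_push[OF sub that] crd_left[of p n i] p ps(2) that
          by (auto simp: rs_def)
        then have eq: "period (x i - 2 * real l - aj rs i - (x i - aj ps i - real l))" if "i < n" for i
          using that by simp
        have "length rs = r - 1" "set rs \<subseteq> points (\<Gamma> n)"
          using ps p by (auto simp: rs_def length_remove1)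
        then have "effl n (d - 2 - int (r - 1)) (\<lambda>i. x i - 2 * real l - aj rs i)"
          using B r by (auto simp: rkl_def)
        also have "?this \<longleftrightarrow> effl n (d - 2 - int (r - 1)) (\<lambda>i. x i - aj ps i - real l)"
          by (rule effl_cong) (rule eq)
        also have "d - 2 - int (r - 1) = d - int r - 1"
          using r by simp
        finally show ?thesis ..
      qed
    qed
  qed
qed

lemma rkl_0: "rkl 0 d x r \<longleftrightarrow> int r \<le> d"
proof
  assume "rkl 0 d x r"
  moreover have "length (replicate r (Vertex 0)) = r" "set (replicate r (Vertex 0)) \<subseteq> points (\<Gamma> 0)"
    by (auto simp: points_iff)
  ultimately have "effl 0 (d - int r) (\<lambda>i. x i - aj (replicate r (Vertex 0)) i)"
    unfolding rkl_def by blast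
  then show "int r \<le> d"
    by (auto simp: effl_def)
next
  assume r: "int r \<le> d"
  show "rkl 0 d x r"
    unfolding rkl_def effl_def
  proof (intro allI impI)
    fix ps :: "(nat, nat \<times> side) point list"
    show "\<exists>qs. int (length qs) = d - int r \<and> set qs \<subseteq> points (\<Gamma> 0) \<and> (\<forall>i<0. period (x i - aj ps i - aj qs i))"
      using r by (intro exI[of _ "replicate (nat (d - int r)) (Vertex 0)"]) (auto simp: points_iff)
  qed
qed

text \<open>\<open>z\<close> is a bead position: the shift by \<open>n - d\<close> converts it into
  the chip count of the congruence. Any representative will do, since \<open>bead_step\<close> sees
  only its class modulo \<open>k\<close>.\<close>

definition residue :: "int \<Rightarrow> (nat \<Rightarrow> real) \<Rightarrow> nat \<Rightarrow> int option" where
  "residue d x n = (if \<exists>z. period (x n + of_int (z + int n - d) * real l)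
     then Some (SOME z. period (x n + of_int (z + int n - d) * real l)) else None)"

lemma residue_SomeD:
  "residue d x n = Some z \<Longrightarrow> period (x n + of_int (z + int n - d) * real l)"
  unfolding residue_def by (auto split: if_splits intro: someI_ex)

lemma residue_NoneD:
  "residue d x n = None \<Longrightarrow> \<not> period (x n + of_int m * real l)"
proof
  assume "residue d x n = None" "period (x n + of_int m * real l)"
  then have "\<not> period (x n + of_int ((m + d - int n) + int n - d) * real l)"
    unfolding residue_def by (metis option.distinct(1))
  then show False
    using \<open>period (x n + of_int m * real l)\<close> by simp
qed

lemma bead_step_residue:
  "bead_step k (residue d x n) f r =
     (if period (x n + of_int (f r + int n - d) * real l) \<and> (r = 0 \<or> f (r - 1) < f r - 1) then f r - 1 else f r)"
proof (cases "residue d x n")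
  case None
  then show ?thesis
    using residue_NoneD[of d x n "f r + int n - d"] by simp
next
  case (Some z)
  have "x n + of_int (f r + int n - d) * real l =
      (x n + of_int (z + int n - d) * real l) + of_int (f r - z) * real l"
    by (simp add: algebra_simps)
  then have "period (x n + of_int (f r + int n - d) * real l) \<longleftrightarrow> int k dvd f r - z"
    by (simp only: period_add_cancel[OF residue_SomeD[OF Some]] period_int_mult_l)
  then show ?thesis
    by (simp only: bead_step_def Some option.case)
qed

text \<open>Adding \<open>m\<close> chips at the right end raises the degree by \<open>m\<close> and
  each coordinate by \<open>m * l\<close>; the bead encodes the least \<open>m\<close> that yields
  rank at least \<open>r\<close>. Stating this for all \<open>m\<close> turns \<open>rkl_Suc\<close>
  into a recursion for the threshold.\<close>

lemma rkl_iff_beads: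
  "rkl n (d + m) (\<lambda>i. x i + of_int m * real l) r \<longleftrightarrow> beads k (residue d x) n r + int n - d \<le> m"
proof (induction n arbitrary: m r)
  case 0
  then show ?case
    by (auto simp: rkl_0)
next
  case (Suc n)
  let ?f = "beads k (residue d x) n"
  have "rkl n (d + m - 1) (\<lambda>i. x i + of_int m * real l - real l) r \<longleftrightarrow> ?f r + int n - d \<le> m - 1"
    using Suc.IH[of "m - 1" r] by (simp add: algebra_simps)
  moreover have "rkl n (d + m - 2) (\<lambda>i. x i + of_int m * real l - 2 * real l) (r - 1) \<longleftrightarrow> ?f (r - 1) + int n - d \<le> m - 2"
    using Suc.IH[of "m - 2" "r - 1"] by (simp add: algebra_simps)
  ultimately have "rkl (Suc n) (d + m) (\<lambda>i. x i + of_int m * real l) r \<longleftrightarrow>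
      ?f r + int n - d \<le> m - 1 \<or> period (x n + of_int m * real l) \<and> ?f r + int n - d \<le> m \<and>
      (r = 0 \<or> ?f (r - 1) + int n - d \<le> m - 2)"
    unfolding rkl_Suc using Suc.IH[of m r] by simp
  also have "\<dots> \<longleftrightarrow> beads k (residue d x) (Suc n) r + int (Suc n) - d \<le> m"
  \<comment> \<open>Above the old threshold the first disjunct holds, below it none does; the
    congruence matters only at equality.\<close>
  proof (cases "m = ?f r + int n - d")
    case True
    then show ?thesis
      by (auto simp: bead_step_residue)
  next
    case False
    then show ?thesis
      by (auto simp: bead_step_residue)
  qed
  finally show ?case .
qed

corollary rkl_beads: "rkl n d x r \<longleftrightarrow> beads k (residue d x) n r \<le> d - int n"
  using rkl_iff_beads[of n d 0 x r] by auto

section \<open>The Abel-Jacobi theorem for a chain of cycles\<close>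

lemma arcs_chain: "arcs (\<Gamma> g) = {..<g} \<times> {Top, Bottom}"
  and verts_chain: "verts (\<Gamma> g) = {..g}"
  and tail_chain: "tail (\<Gamma> g) = fst"
  and head_chain: "head (\<Gamma> g) = Suc \<circ> fst"
  by (auto simp: chain_of_cycles_def fun_eq_iff)

definition elen :: "nat \<times> side \<Rightarrow> real" where
  "elen e = (case snd e of Top \<Rightarrow> real l | Bottom \<Rightarrow> real k - real l)"

lemma len_chain: "len (\<Gamma> g) = elen"
  by (auto simp: chain_of_cycles_def elen_def fun_eq_iff)

lemma elen_simps [simp]: "elen (i, Top) = real l" "elen (i, Bottom) = real k - real l"
  by (simp_all add: elen_def)

lemma elen_pos: "0 < elen e"
  using l1 lk by (cases e; cases "snd e") auto

lemma edge_point_chain: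
  "edge_point (\<Gamma> g) e t = (if t \<le> 0 then Vertex (fst e) else if elen e \<le> t then Vertex (Suc (fst e)) else Interior e t)"
  by (simp add: edge_point_def tail_chain head_chain len_chain)

text \<open>The parametrization of an edge does not depend on the number of cycles, so the smallest
  chain containing \<open>e\<close> is used and \<open>g\<close> is no parameter.\<close>

definition start_slope :: "((nat, nat \<times> side) point \<Rightarrow> real) \<Rightarrow> nat \<times> side \<Rightarrow> real" where
  "start_slope f e = vector_derivative (\<lambda>t. f (edge_point (\<Gamma> (Suc (fst e))) e t)) (at_right 0)"

definition end_slope :: "((nat, nat \<times> side) point \<Rightarrow> real) \<Rightarrow> nat \<times> side \<Rightarrow> real" where
  "end_slope f e = vector_derivative (\<lambda>t. f (edge_point (\<Gamma> (Suc (fst e))) e t)) (at_left (elen e))"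

lemma edge_point_any: "edge_point (\<Gamma> g) = edge_point (\<Gamma> h)"
  by (simp add: fun_eq_iff edge_point_chain)

lemma order_at_Vertex:
  assumes "v \<le> g"
  shows "order_at (\<Gamma> g) f (Vertex v) =
    (if v < g then start_slope f (v, Top) + start_slope f (v, Bottom) else 0) -
    (if 0 < v then end_slope f (v - 1, Top) + end_slope f (v - 1, Bottom) else 0)"
proof -
  have 1: "{e \<in> arcs (\<Gamma> g). tail (\<Gamma> g) e = v} = (if v < g then {(v, Top), (v, Bottom)} else {})"
    by (auto simp: arcs_chain tail_chain)
  have 2: "{e \<in> arcs (\<Gamma> g). head (\<Gamma> g) e = v} = (if 0 < v then {(v - 1, Top), (v - 1, Bottom)} else {})"
    using assms by (auto simp: arcs_chain head_chain)
  have 3: "vector_derivative (\<lambda>t. f (edge_point (\<Gamma> g) e t)) (at_right 0) = start_slope f e"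
    "vector_derivative (\<lambda>t. f (edge_point (\<Gamma> g) e t)) (at_left (len (\<Gamma> g) e)) = end_slope f e" for e
    by (simp_all only: start_slope_def end_slope_def len_chain edge_point_any[of g "Suc (fst e)"])
  show ?thesis
    unfolding order_at.simps 1 2 3 by auto
qed

lemma order_at_Interior: "order_at (\<Gamma> g) f (Interior e s) = kink (\<lambda>t. f (edge_point (\<Gamma> g) e t)) s"
  by (simp add: kink_def)

definition positions :: "(nat, nat \<times> side) divisor \<Rightarrow> nat \<times> side \<Rightarrow> real set" where
  "positions E e = {t. Interior e t \<in> Poly_Mapping.keys E}"

definition edge_mass :: "(nat, nat \<times> side) divisor \<Rightarrow> nat \<times> side \<Rightarrow> int" where
  "edge_mass E e = (\<Sum>t\<in>positions E e. Poly_Mapping.lookup E (Interior e t))"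

definition edge_moment :: "(nat, nat \<times> side) divisor \<Rightarrow> nat \<times> side \<Rightarrow> real" where
  "edge_moment E e = (\<Sum>t\<in>positions E e. of_int (Poly_Mapping.lookup E (Interior e t)) * t)"

text \<open>The part of \<open>E\<close> to the right of cycle \<open>i\<close>, including its right
  vertex; \<open>crd i\<close> has the value \<open>l\<close> on all of it.\<close>

definition right_mass :: "nat \<Rightarrow> (nat, nat \<times> side) divisor \<Rightarrow> nat \<Rightarrow> int" where
  "right_mass g E i = (\<Sum>v\<in>{i<..g}. Poly_Mapping.lookup E (Vertex v)) +
     (\<Sum>j\<in>{i<..<g}. edge_mass E (j, Top) + edge_mass E (j, Bottom))"

lemma finite_positions [simp]: "finite (positions E e)"
proof -
  have "inj (Interior e)"
    by (auto simp: inj_on_def)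
  then show ?thesis
    using finite_vimageI[of "Poly_Mapping.keys E" "Interior e"]
    by (simp add: positions_def vimage_def)
qed

lemma positions_bounds:
  assumes "Poly_Mapping.keys E \<subseteq> points (\<Gamma> g)" "t \<in> positions E e"
  shows "0 < t" "t < elen e" "fst e < g"
proof -
  have "Interior e t \<in> points (\<Gamma> g)"
    using assms by (auto simp: positions_def)
  then show "0 < t" "t < elen e" "fst e < g"
    by (cases e; auto simp: points_iff elen_def)+
qed

lemma evaluate_decompose:
  assumes "Poly_Mapping.keys E \<subseteq> points (\<Gamma> g)"
  shows "evaluate \<phi> E = (\<Sum>v\<le>g. of_int (Poly_Mapping.lookup E (Vertex v)) * \<phi> (Vertex v)) +
    (\<Sum>j<g. (\<Sum>t\<in>positions E (j, Top). of_int (Poly_Mapping.lookup E (Interior (j, Top) t)) * \<phi> (Interior (j, Top) t)) +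
      (\<Sum>t\<in>positions E (j, Bottom). of_int (Poly_Mapping.lookup E (Interior (j, Bottom) t)) * \<phi> (Interior (j, Bottom) t)))"
proof -
  define F where "F p = of_int (Poly_Mapping.lookup E p) * \<phi> p" for p
  define I :: "nat \<times> side \<Rightarrow> (nat, nat \<times> side) point set" where "I e = Interior e ` positions E e" for e
  define A where "A = Vertex ` {..g} \<union> (\<Union>j\<in>{..<g}. I (j, Top) \<union> I (j, Bottom))"
  have "Poly_Mapping.keys E \<subseteq> A"
  proof
    fix p assume p: "p \<in> Poly_Mapping.keys E"
    then have "p \<in> points (\<Gamma> g)"
      using assms by blast
    show "p \<in> A"
    proof (cases p)
      case (Vertex v)
      then show ?thesis
        using \<open>p \<in> points (\<Gamma> g)\<close> by (auto simp: A_def points_iff)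
    next
      case (Interior e t)
      then obtain j s where e: "e = (j, s)" "j < g"
        using \<open>p \<in> points (\<Gamma> g)\<close> by (cases e) (auto simp: points_iff)
      have "t \<in> positions E e"
        using p Interior by (simp add: positions_def)
      then show ?thesis
        using e Interior by (cases s) (auto simp: A_def I_def)
    qed
  qed
  then have "evaluate \<phi> E = sum F A"
    unfolding F_def by (intro evaluate_superset) (auto simp: A_def I_def)
  also have "\<dots> = sum F (Vertex ` {..g}) + sum F (\<Union>j\<in>{..<g}. I (j, Top) \<union> I (j, Bottom))"
    unfolding A_def by (rule sum.union_disjoint) (auto simp: I_def)
  also have "sum F (Vertex ` {..g}) = (\<Sum>v\<le>g. F (Vertex v))"
    by (subst sum.reindex) (auto simp: inj_on_def)
  also have "sum F (\<Union>j\<in>{..<g}. I (j, Top) \<union> I (j, Bottom)) = (\<Sum>j<g. sum F (I (j, Top) \<union> I (j, Bottom)))"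
    by (rule sum.UNION_disjoint) (auto simp: I_def)
  also have "\<dots> = (\<Sum>j<g. sum F (I (j, Top)) + sum F (I (j, Bottom)))"
    by (rule sum.cong[OF refl], rule sum.union_disjoint) (auto simp: I_def)
  finally have "evaluate \<phi> E = (\<Sum>v\<le>g. F (Vertex v)) + (\<Sum>j<g. sum F (I (j, Top)) + sum F (I (j, Bottom)))" .
  moreover have "sum F (I e) = (\<Sum>t\<in>positions E e. F (Interior e t))" for e
    unfolding I_def by (subst sum.reindex) (auto simp: inj_on_def)
  ultimately show ?thesis
    by (simp add: F_def)
qed

lemma sum_positions:
  "(\<Sum>t\<in>positions E e. of_int (Poly_Mapping.lookup E (Interior e t)) * c) = of_int (edge_mass E e) * c"
  by (simp add: edge_mass_def sum_distrib_right)

lemma right_mass_Suc: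
  assumes "Suc i < g"
  shows "right_mass g E i = Poly_Mapping.lookup E (Vertex (Suc i)) +
    (edge_mass E (Suc i, Top) + edge_mass E (Suc i, Bottom)) + right_mass g E (Suc i)"
proof -
  have "{i<..g} = insert (Suc i) {Suc i<..g}" "{i<..<g} = insert (Suc i) {Suc i<..<g}"
    using assms by auto
  then show ?thesis
    by (simp add: right_mass_def)
qed

lemma right_mass_last: "0 < g \<Longrightarrow> right_mass g E (g - 1) = Poly_Mapping.lookup E (Vertex g)"
proof -
  assume "0 < g"
  then have "{g - 1<..g} = {g}" "{g - 1<..<g} = {}"
    by auto
  then show ?thesis
    by (simp add: right_mass_def)
qed

lemma divisor_degree_right_mass:
  assumes "Poly_Mapping.keys E \<subseteq> points (\<Gamma> g)" "0 < g"
  shows "divisor_degree E = Poly_Mapping.lookup E (Vertex 0) +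
    (edge_mass E (0, Top) + edge_mass E (0, Bottom)) + right_mass g E 0"
proof -
  have "evaluate (\<lambda>_. 1) E = of_int ((\<Sum>v\<le>g. Poly_Mapping.lookup E (Vertex v)) +
      (\<Sum>j<g. edge_mass E (j, Top) + edge_mass E (j, Bottom)))"
    using evaluate_decompose[OF assms(1), of "\<lambda>_. 1"] by (simp only: sum_positions) simp
  then have "divisor_degree E = (\<Sum>v\<le>g. Poly_Mapping.lookup E (Vertex v)) +
      (\<Sum>j<g. edge_mass E (j, Top) + edge_mass E (j, Bottom))"
    by (simp only: of_int_eq_iff flip: divisor_degree_evaluate)
  moreover have "{..g} = insert 0 {0<..g}" "{..<g} = insert 0 {0<..<g}"
    using assms(2) by auto
  ultimately show ?thesis
    by (simp add: right_mass_def)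
qed

lemma evaluate_crd:
  assumes "Poly_Mapping.keys E \<subseteq> points (\<Gamma> g)" "i < g"
  shows "evaluate (crd i) E = of_int (right_mass g E i) * real l + edge_moment E (i, Top) - edge_moment E (i, Bottom)"
proof -
  have 1: "(\<Sum>v\<le>g. of_int (Poly_Mapping.lookup E (Vertex v)) * crd i (Vertex v)) =
      of_int (\<Sum>v\<in>{i<..g}. Poly_Mapping.lookup E (Vertex v)) * real l"
    unfolding of_int_sum sum_distrib_right by (rule sum.mono_neutral_cong_right) auto
  define G where "G j = (\<Sum>t\<in>positions E (j, Top). of_int (Poly_Mapping.lookup E (Interior (j, Top) t)) * crd i (Interior (j, Top) t)) +
      (\<Sum>t\<in>positions E (j, Bottom). of_int (Poly_Mapping.lookup E (Interior (j, Bottom) t)) * crd i (Interior (j, Bottom) t))" for j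
  have G0: "G j = 0" if "j < i" for j
    using that by (simp add: G_def)
  have Gi: "G i = edge_moment E (i, Top) - edge_moment E (i, Bottom)"
    by (simp add: G_def edge_moment_def sum_negf)
  have Gr: "G j = of_int (edge_mass E (j, Top) + edge_mass E (j, Bottom)) * real l" if "i < j" for j
    using that by (simp add: G_def distrib_right sum_positions)
  have "(\<Sum>j<g. G j) = (\<Sum>j\<in>insert i {i<..<g}. G j)"
    using assms(2) G0 by (intro sum.mono_neutral_right) (auto simp: not_less order.order_iff_strict)
  also have "\<dots> = G i + (\<Sum>j\<in>{i<..<g}. of_int (edge_mass E (j, Top) + edge_mass E (j, Bottom)) * real l)"
    using Gr by simp
  finally have "(\<Sum>j<g. G j) = edge_moment E (i, Top) - edge_moment E (i, Bottom) +
      of_int (\<Sum>j\<in>{i<..<g}. edge_mass E (j, Top) + edge_mass E (j, Bottom)) * real l"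
    by (simp add: Gi sum_distrib_right)
  then show ?thesis
    unfolding evaluate_decompose[OF assms(1)] 1 right_mass_def by (simp add: G_def algebra_simps)
qed

text \<open>The two slopes with which \<open>f\<close> arrives at the right end of cycle
  \<open>i\<close> add up to minus the mass to the right, and \<open>f\<close> has the same
  increment along both edges. Together these give the coordinate as minus \<open>k\<close> times the
  end slope of the bottom edge.\<close>

lemma principal_imp:
  assumes g: "0 < g" and E: "principal (\<Gamma> g) E"
  shows "divisor_degree E = 0" "\<And>i. i < g \<Longrightarrow> period (evaluate (crd i) E)"
proof -
  have keys: "Poly_Mapping.keys E \<subseteq> points (\<Gamma> g)"
    using E by (simp add: principal_def)
  obtain f where f: "rational_function (\<Gamma> g) f"
    and ord: "\<And>p. p \<in> points (\<Gamma> g) \<Longrightarrow> of_int (Poly_Mapping.lookup E p) = order_at (\<Gamma> g) f p"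
    using E unfolding principal_def by blast
  have slopes: "\<exists>m n :: int. start_slope f e = m \<and> end_slope f e = n \<and> n = m + edge_mass E e \<and>
      f (Vertex (Suc (fst e))) - f (Vertex (fst e)) = of_int n * elen e - edge_moment E e"
    if "fst e < g" for e
  proof -
    let ?h = "\<lambda>t. f (edge_point (\<Gamma> g) e t)"
    have e: "e \<in> arcs (\<Gamma> g)"
      using that side_UNIV[of "snd e"] by (cases e) (auto simp: arcs_chain)
    then obtain S where S: "affine_cells S 0 (elen e) ?h"
      using f integral_piecewise_linear_cells unfolding rational_function_def len_chain by metis
    have kink: "kink ?h s = of_int (Poly_Mapping.lookup E (Interior e s))" if "0 < s" "s < elen e" for s
    proof -
      have "Interior e s \<in> points (\<Gamma> g)"
        using that \<open>fst e < g\<close> by (cases e) (auto simp: points_iff elen_def)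
      then show ?thesis
        using ord[of "Interior e s"] by (simp only: order_at_Interior)
    qed
    have inter: "positions E e \<inter> {0<..<elen e} = positions E e"
      using positions_bounds[OF keys, of _ e] by auto
    have "kink ?h s = 0" if "0 < s" "s < elen e" "s \<notin> positions E e" for s
      using kink[of s] that by (simp add: positions_def in_keys_iff)
    then obtain m n :: int where mn: "vector_derivative ?h (at_right 0) = m" "vector_derivative ?h (at_left (elen e)) = n"
      "of_int n = of_int m + (\<Sum>s\<in>positions E e. kink ?h s)"
      "?h (elen e) = ?h 0 + of_int m * (elen e - 0) + (\<Sum>s\<in>positions E e. kink ?h s * (elen e - s))"
      using affine_cells_kinks[OF S elen_pos finite_positions, of E e] unfolding inter by blast
    have "(\<Sum>s\<in>positions E e. kink ?h s * c s) = (\<Sum>s\<in>positions E e. of_int (Poly_Mapping.lookup E (Interior e s)) * c s)" for c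
      by (rule sum.cong) (use positions_bounds[OF keys, of _ e] kink in auto)
    note sums = this[of "\<lambda>_. 1"] this[of "\<lambda>s. elen e - s"]
    have n: "n = m + edge_mass E e"
      using mn(3) sums(1) by (simp add: edge_mass_def flip: of_int_sum of_int_add)
    have "(\<Sum>s\<in>positions E e. of_int (Poly_Mapping.lookup E (Interior e s)) * (elen e - s)) =
        of_int (edge_mass E e) * elen e - edge_moment E e"
      by (simp only: right_diff_distrib sum_subtractf sum_positions edge_moment_def)
    then have "f (Vertex (Suc (fst e))) - f (Vertex (fst e)) = of_int n * elen e - edge_moment E e"
      using mn(4) sums(2) elen_pos[of e] by (simp add: edge_point_chain n algebra_simps)
    moreover have "start_slope f e = m" "end_slope f e = n"
      using mn(1,2) by (simp_all only: start_slope_def end_slope_def edge_point_any[of g "Suc (fst e)"])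
    ultimately show ?thesis
      using n by blast
  qed
  define m where "m e = (SOME m::int. start_slope f e = m)" for e
  define n where "n e = (SOME n::int. end_slope f e = n)" for e
  have m: "start_slope f e = m e" and n: "end_slope f e = n e" if "fst e < g" for e
    unfolding m_def n_def using slopes[OF that] by (metis (mono_tags, lifting) someI)+
  have nm: "n e = m e + edge_mass E e"
    and \<Delta>: "f (Vertex (Suc (fst e))) - f (Vertex (fst e)) = of_int (n e) * elen e - edge_moment E e"
    if "fst e < g" for e
    using slopes[OF that] m[OF that] n[OF that] by auto
  have V: "Poly_Mapping.lookup E (Vertex v) = (if v < g then m (v, Top) + m (v, Bottom) else 0) -
      (if 0 < v then n (v - 1, Top) + n (v - 1, Bottom) else 0)" if "v \<le> g" for v
  proof -
    have "real_of_int (Poly_Mapping.lookup E (Vertex v)) = of_int ((if v < g then m (v, Top) + m (v, Bottom) else 0) -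
      (if 0 < v then n (v - 1, Top) + n (v - 1, Bottom) else 0))"
      using ord[of "Vertex v"] order_at_Vertex[OF that, of f] that g m n by (auto simp: points_iff)
    then show ?thesis
      by (simp only: of_int_eq_iff)
  qed
  \<comment> \<open>Flux balance, accumulated from the last vertex towards the left.\<close>
  have R: "right_mass g E i = - (n (i, Top) + n (i, Bottom))" if "i < g" for i
    using that
  proof (induction "g - 1 - i" arbitrary: i)
    case 0
    then have "i = g - 1"
      by simp
    then show ?case
      using right_mass_last[OF g, of E] V[of g] g by simp
  next
    case (Suc x)
    then have i: "Suc i < g" "x = g - 1 - Suc i"
      by simp_all
    then show ?case
      using right_mass_Suc[OF i(1), of E] Suc.hyps(1)[OF i(2,1)] V[of "Suc i"] nm[of "(Suc i, Top)"] nm[of "(Suc i, Bottom)"]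
      by simp
  qed
  show "divisor_degree E = 0"
    using divisor_degree_right_mass[OF keys g] R[OF g] V[of 0] nm[of "(0, Top)"] nm[of "(0, Bottom)"] g by simp
  fix i assume i: "i < g"
  have "evaluate (crd i) E = of_int (- n (i, Bottom)) * real k"
    using evaluate_crd[OF keys i] R[OF i] \<Delta>[of "(i, Top)"] \<Delta>[of "(i, Bottom)"] i
    by (simp add: algebra_simps)
  then show "period (evaluate (crd i) E)"
    by (simp only: period_k)
qed

text \<open>Inverts the computation for principal divisors. Start slopes follow from end slopes by
  the mass on the edge, and the coordinate condition says precisely that the increments along the
  two edges of a cycle agree, so \<open>f\<close> can be integrated from the left end.\<close>

lemma principalI:
  assumes g: "0 < g" and keys: "Poly_Mapping.keys E \<subseteq> points (\<Gamma> g)" and deg: "divisor_degree E = 0"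
    and per: "\<And>i. i < g \<Longrightarrow> period (evaluate (crd i) E)"
  shows "principal (\<Gamma> g) E"
proof -
  have "\<forall>i. \<exists>c::int. i < g \<longrightarrow> evaluate (crd i) E = of_int c * real k"
    using per by (auto simp: period_def)
  then obtain c :: "nat \<Rightarrow> int" where c: "\<And>i. i < g \<Longrightarrow> evaluate (crd i) E = of_int (c i) * real k"
    by metis
  \<comment> \<open>the end slopes are forced: \<open>f\<close> has the same increment along both edges of a cycle\<close>
  define n where "n = (\<lambda>(i, s). case s of Bottom \<Rightarrow> - c i | Top \<Rightarrow> c i - right_mass g E i)"
  define m where "m e = n e - edge_mass E e" for e
  define \<Delta> where "\<Delta> e = of_int (n e) * elen e - edge_moment E e" for e
  have \<Delta>_eq: "\<Delta> (i, Top) = \<Delta> (i, Bottom)" if "i < g" for i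
    using evaluate_crd[OF keys that] c[OF that] by (simp add: \<Delta>_def n_def algebra_simps)
  define f0 where "f0 v = (\<Sum>j<v. \<Delta> (j, Bottom))" for v
  define F where "F e = ramp (f0 (fst e)) (m e) (positions E e) (\<lambda>t. Poly_Mapping.lookup E (Interior e t))" for e
  define f where "f p = (case p of Vertex v \<Rightarrow> f0 v | Interior e t \<Rightarrow> F e t)" for p
  have F0: "F e 0 = f0 (fst e)" if "fst e < g" for e
  proof -
    have "(\<Sum>t\<in>positions E e. of_int (Poly_Mapping.lookup E (Interior e t)) * max 0 (0 - t)) = 0"
      using positions_bounds[OF keys, of _ e] by (intro sum.neutral) (fastforce simp: max_def)
    then show ?thesis
      by (simp add: F_def ramp_def)
  qed
  have FL: "F e (elen e) = f0 (Suc (fst e))" if "fst e < g" for e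
  proof -
    have "(\<Sum>t\<in>positions E e. of_int (Poly_Mapping.lookup E (Interior e t)) * max 0 (elen e - t)) =
        (\<Sum>t\<in>positions E e. of_int (Poly_Mapping.lookup E (Interior e t)) * (elen e - t))"
      using positions_bounds[OF keys, of _ e] by (intro sum.cong) (fastforce simp: max_def)+
    also have "\<dots> = of_int (edge_mass E e) * elen e - edge_moment E e"
      by (simp only: right_diff_distrib sum_subtractf sum_positions edge_moment_def)
    finally have "F e (elen e) = f0 (fst e) + \<Delta> e"
      by (simp add: F_def ramp_def \<Delta>_def m_def algebra_simps)
    also have "\<Delta> e = \<Delta> (fst e, Bottom)"
      using \<Delta>_eq[OF that] by (cases e; cases "snd e") auto
    finally show ?thesis
      by (simp add: f0_def)
  qed
  have h: "f (edge_point (\<Gamma> g) e t) = F e t" if "fst e < g" "t \<in> {0..elen e}" for e t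
    using that F0[of e] FL[of e] elen_pos[of e] by (auto simp: edge_point_chain f_def)
  have h': "f (edge_point (\<Gamma> g) e t) = ramp (f0 (fst e)) (m e) (positions E e) (\<lambda>t. Poly_Mapping.lookup E (Interior e t)) t"
    if "fst e < g" "t \<in> {0..elen e}" for e t
    using h[OF that] by (simp add: F_def)
  have "rational_function (\<Gamma> g) f"
    unfolding rational_function_def len_chain
  proof
    fix e assume "e \<in> arcs (\<Gamma> g)"
    then have e: "fst e < g"
      by (auto simp: arcs_chain)
    show "integral_piecewise_linear_on 0 (elen e) (\<lambda>t. f (edge_point (\<Gamma> g) e t))"
      by (rule integral_piecewise_linear_ramp[OF finite_positions h'[OF e]])
  qed
  moreover have "of_int (Poly_Mapping.lookup E p) = order_at (\<Gamma> g) f p" if "p \<in> points (\<Gamma> g)" for p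
  proof (cases p)
    case (Interior e s)
    have e: "fst e < g" and s: "0 < s" "s < elen e"
      using that Interior by (cases e; auto simp: points_iff elen_def)+
    have "kink (\<lambda>t. f (edge_point (\<Gamma> g) e t)) s =
        (if s \<in> positions E e then of_int (Poly_Mapping.lookup E (Interior e s)) else 0)"
      by (rule ramp_kink[OF finite_positions h'[OF e] s])
    then show ?thesis
      unfolding Interior order_at_Interior by (simp add: positions_def in_keys_iff)
  next
    case (Vertex v)
    then have v: "v \<le> g"
      using that by (simp add: points_iff)
    have start: "start_slope f e = of_int (m e)" if e: "fst e < g" for e
    proof -
      have "vector_derivative (\<lambda>t. f (edge_point (\<Gamma> g) e t)) (at_right 0) =
          of_int (m e + (\<Sum>u\<in>{u \<in> positions E e. u \<le> 0}. Poly_Mapping.lookup E (Interior e u)))"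
        by (rule ramp_right_derivative[OF finite_positions h'[OF e]]) (use elen_pos[of e] in auto)
      moreover have "{u \<in> positions E e. u \<le> 0} = {}"
        using positions_bounds[OF keys, of _ e] by force
      ultimately show ?thesis
        by (simp add: start_slope_def edge_point_any[of "Suc (fst e)" g])
    qed
    have "end": "end_slope f e = of_int (n e)" if e: "fst e < g" for e
    proof -
      have "vector_derivative (\<lambda>t. f (edge_point (\<Gamma> g) e t)) (at_left (elen e)) =
          of_int (m e + (\<Sum>u\<in>{u \<in> positions E e. u < elen e}. Poly_Mapping.lookup E (Interior e u)))"
        by (rule ramp_left_derivative[OF finite_positions h'[OF e]]) (use elen_pos[of e] in auto)
      moreover have "{u \<in> positions E e. u < elen e} = positions E e"
        using positions_bounds[OF keys, of _ e] by force
      ultimately show ?thesis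
        by (simp add: end_slope_def edge_point_any[of "Suc (fst e)" g] m_def edge_mass_def)
    qed
    have n: "n (i, Top) + n (i, Bottom) = - right_mass g E i" for i
      by (simp add: n_def)
    then have m: "m (i, Top) + m (i, Bottom) = - right_mass g E i - (edge_mass E (i, Top) + edge_mass E (i, Bottom))" for i
      using n[of i] by (simp add: m_def)
    have "Poly_Mapping.lookup E (Vertex v) = (if v < g then m (v, Top) + m (v, Bottom) else 0) -
        (if 0 < v then n (v - 1, Top) + n (v - 1, Bottom) else 0)"
    proof (cases v)
      case 0
      then show ?thesis
        using divisor_degree_right_mass[OF keys g] deg g m[of 0] by simp
    next
      case (Suc u)
      show ?thesis
      proof (cases "v = g")
        case True
        then show ?thesis
          using right_mass_last[OF g, of E] Suc n[of u] by auto
      next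
        case False
        then show ?thesis
          using right_mass_Suc[of u g E] Suc v n[of u] m[of v] by simp
      qed
    qed
    then show ?thesis
      unfolding Vertex order_at_Vertex[OF v] using v start "end" by auto
  qed
  ultimately show ?thesis
    using keys unfolding principal_def by blast
qed

lemma linearly_equivalent_iff:
  assumes "0 < g" "Poly_Mapping.keys D \<subseteq> points (\<Gamma> g)" "Poly_Mapping.keys D' \<subseteq> points (\<Gamma> g)"
  shows "linearly_equivalent (\<Gamma> g) D D' \<longleftrightarrow> divisor_degree D = divisor_degree D' \<and>
    (\<forall>i<g. period (evaluate (crd i) D - evaluate (crd i) D'))"
proof -
  have "Poly_Mapping.keys (D - D') \<subseteq> points (\<Gamma> g)"
    using assms keys_diff[of D D'] by blast
  then show ?thesis
    unfolding linearly_equivalent_def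
    using principal_imp[OF assms(1), of "D - D'"] principalI[OF assms(1), of "D - D'"]
    by (auto simp: divisor_degree_diff evaluate_diff)
qed

lemma period_mult_int: "period x \<Longrightarrow> period (of_int m * x)"
  unfolding period_def by (metis mult.assoc of_int_mult)

lemma period_sum: "(\<And>a. a \<in> A \<Longrightarrow> period (h a)) \<Longrightarrow> period (sum h A)"
  by (induction A rule: infinite_finite_induct) (auto intro: period_add)

lemma period_evaluate:
  assumes "\<And>x. x \<in> Poly_Mapping.keys D \<Longrightarrow> period (\<phi> x)"
  shows "period (evaluate \<phi> D)"
  unfolding evaluate_def using assms by (intro period_sum period_mult_int)

section \<open>The Baker-Norine rank in terms of the recursion\<close>

lemma aj_evaluate: "aj ps i = evaluate (crd i) (divisor_of ps)"
  by (simp add: aj_def evaluate_divisor_of)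

lemma rank_test_iff:
  assumes g: "0 < g" and D: "D \<in> divisors (\<Gamma> g) d"
  shows "(\<forall>E\<in>divisors (\<Gamma> g) (int n). effective E \<longrightarrow>
      (\<exists>F\<in>divisors (\<Gamma> g) (divisor_degree D - int n). effective F \<and> linearly_equivalent (\<Gamma> g) (D - E) F)) \<longleftrightarrow>
    rkl g d (\<lambda>i. evaluate (crd i) D) n" (is "?L \<longleftrightarrow> ?R")
proof -
  have keysD: "Poly_Mapping.keys D \<subseteq> points (\<Gamma> g)" and degD: "divisor_degree D = d"
    using D by (auto simp: divisors_def)
  have leq: "linearly_equivalent (\<Gamma> g) (D - divisor_of ps) (divisor_of qs) \<longleftrightarrow>
      int (length qs) = d - int (length ps) \<and> (\<forall>i<g. period (evaluate (crd i) D - aj ps i - aj qs i))"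
    if "set ps \<subseteq> points (\<Gamma> g)" "set qs \<subseteq> points (\<Gamma> g)" for ps qs
  proof -
    have "Poly_Mapping.keys (D - divisor_of ps) \<subseteq> points (\<Gamma> g)" "Poly_Mapping.keys (divisor_of qs) \<subseteq> points (\<Gamma> g)"
      using keys_diff[of D "divisor_of ps"] keys_divisor_of[of ps] keys_divisor_of[of qs] keysD that by blast+
    then show ?thesis
      using linearly_equivalent_iff[OF g]
      by (auto simp: divisor_degree_diff divisor_degree_divisor_of degD aj_evaluate evaluate_diff)
  qed
  show ?thesis
  proof
    assume L: ?L
    show ?R
      unfolding rkl_def effl_def
    proof (intro allI impI)
      fix ps assume ps: "length ps = n" "set ps \<subseteq> points (\<Gamma> g)"
      have "divisor_of ps \<in> divisors (\<Gamma> g) (int n)"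
        using ps keys_divisor_of[of ps] by (auto simp: divisors_def divisor_degree_divisor_of)
      then obtain F where F: "F \<in> divisors (\<Gamma> g) (d - int n)" "effective F"
        "linearly_equivalent (\<Gamma> g) (D - divisor_of ps) F"
        using L effective_divisor_of[of ps] degD by metis
      \<comment> \<open>An effective \<open>F\<close> has nonnegative degree, so \<open>nat\<close>
        truncates nothing.\<close>
      then have "divisor_degree F = int (nat (d - int n))"
        using effective_degree_nonneg[of F] by (auto simp: divisors_def)
      then obtain qs where qs: "set qs \<subseteq> Poly_Mapping.keys F" "F = divisor_of qs"
        using effective_obtain_list[OF F(2)] by metis
      have "set qs \<subseteq> points (\<Gamma> g)"
        using qs F(1) by (auto simp: divisors_def)
      then show "\<exists>qs. int (length qs) = d - int n \<and> set qs \<subseteq> points (\<Gamma> g) \<and>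
          (\<forall>i<g. period (evaluate (crd i) D - aj ps i - aj qs i))"
        using F(3) leq[OF ps(2)] qs(2) ps(1) by blast
    qed
  next
    assume R: ?R
    show ?L
    proof (intro ballI impI)
      fix E assume E: "E \<in> divisors (\<Gamma> g) (int n)" "effective E"
      then have "divisor_degree E = int n"
        by (simp add: divisors_def)
      then obtain ps where ps: "length ps = n" "set ps \<subseteq> Poly_Mapping.keys E" "E = divisor_of ps"
        by (rule effective_obtain_list[OF E(2)])
      have sub: "set ps \<subseteq> points (\<Gamma> g)"
        using ps E(1) by (auto simp: divisors_def)
      then obtain qs where qs: "int (length qs) = d - int n" "set qs \<subseteq> points (\<Gamma> g)"
        "\<And>i. i < g \<Longrightarrow> period (evaluate (crd i) D - aj ps i - aj qs i)"
        using R ps(1) unfolding rkl_def effl_def by blast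
      have "divisor_of qs \<in> divisors (\<Gamma> g) (divisor_degree D - int n)"
        using qs keys_divisor_of[of qs] by (auto simp: divisors_def divisor_degree_divisor_of degD)
      then show "\<exists>F\<in>divisors (\<Gamma> g) (divisor_degree D - int n). effective F \<and> linearly_equivalent (\<Gamma> g) (D - E) F"
        using leq[OF sub qs(2)] qs(1,3) ps effective_divisor_of[of qs] by metis
    qed
  qed
qed

text \<open>The definition of the rank as a greatest element does not show that the test property is
  inherited by smaller \<open>s\<close>; this follows from the beads, which increase with
  \<open>r\<close>. The maximum exists because \<open>s = -1\<close> passes vacuously and the degree
  limits the others.\<close>

lemma rank_ge_iff:
  assumes g: "0 < g" and D: "D \<in> divisors (\<Gamma> g) d"
  shows "rank (\<Gamma> g) D \<ge> int r \<longleftrightarrow> rkl g d (\<lambda>i. evaluate (crd i) D) r"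
proof -
  define P where "P s \<longleftrightarrow> -1 \<le> s \<and> (\<forall>E\<in>divisors (\<Gamma> g) s. effective E \<longrightarrow>
      (\<exists>F\<in>divisors (\<Gamma> g) (divisor_degree D - s). effective F \<and> linearly_equivalent (\<Gamma> g) (D - E) F))" for s
  have Pn: "P (int n) \<longleftrightarrow> rkl g d (\<lambda>i. evaluate (crd i) D) n" for n
    unfolding P_def using rank_test_iff[OF assms] by simp
  have "P (-1)"
    using effective_degree_nonneg by (force simp: P_def divisors_def)
  have bound: "s \<le> max d (-1)" if "P s" for s
  proof (cases "s = -1")
    case False
    then have "0 \<le> s"
      using that by (auto simp: P_def)
    then obtain n where n: "s = int n"
      by (rule nonneg_int_cases)
    define ps :: "(nat, nat \<times> side) point list" where "ps = replicate n (Vertex 0)"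
    have "length ps = n" "set ps \<subseteq> points (\<Gamma> g)"
      by (auto simp: ps_def points_iff)
    then have "effl g (d - int n) (\<lambda>i. evaluate (crd i) D - aj ps i)"
      using Pn[of n] that n by (auto simp: rkl_def)
    then show ?thesis
      using n by (auto simp: effl_def)
  qed simp
  have "finite {s. P s}"
    by (rule finite_subset[of _ "{-1..max d (-1)}"]) (use bound in \<open>auto simp: P_def\<close>)
  then have "P (Max {s. P s})" "\<And>s. P s \<Longrightarrow> s \<le> Max {s. P s}"
    using Max_in[of "{s. P s}"] \<open>P (-1)\<close> by auto
  then have "P (rank (\<Gamma> g) D)" and max: "\<And>s. P s \<Longrightarrow> s \<le> rank (\<Gamma> g) D"
    unfolding rank_def P_def[symmetric] by (metis Greatest_equality)+
  show ?thesis
  proof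
    assume r: "int r \<le> rank (\<Gamma> g) D"
    then have "rank (\<Gamma> g) D = int (nat (rank (\<Gamma> g) D))"
      by simp
    then have "rkl g d (\<lambda>i. evaluate (crd i) D) (nat (rank (\<Gamma> g) D))"
      using \<open>P (rank (\<Gamma> g) D)\<close> Pn by metis
    moreover have "beads k w g r \<le> beads k w g (nat (rank (\<Gamma> g) D))" for w
      using strict_mono_less_eq[OF strict_mono_beads] r by (metis nat_int nat_mono)
    ultimately show "rkl g d (\<lambda>i. evaluate (crd i) D) r"
      unfolding rkl_beads by (meson order.trans)
  next
    assume "rkl g d (\<lambda>i. evaluate (crd i) D) r"
    then show "int r \<le> rank (\<Gamma> g) D"
      using max Pn by blast
  qed
qed

section \<open>Windings of chains and the covering of the Picard torus\<close>

text \<open>The integral over a segment of the harmonic form of cycle \<open>i\<close>, which is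
  \<open>1\<close> on the top and \<open>- 1\<close> on the bottom edge: a real lift of the change
  of \<open>crd i\<close>.\<close>

definition winding :: "nat \<Rightarrow> (nat \<times> side) \<times> real \<times> real \<Rightarrow> real" where
  "winding i = (\<lambda>(e, s, t). if fst e = i then (case snd e of Top \<Rightarrow> t - s | Bottom \<Rightarrow> s - t) else 0)"

lemma real_cycles_iff:
  "\<omega> \<in> real_cycles (\<Gamma> g) \<longleftrightarrow> Poly_Mapping.keys \<omega> \<subseteq> {..<g} \<times> {Top, Bottom} \<and>
    (\<forall>i<g. Poly_Mapping.lookup \<omega> (i, Bottom) = - Poly_Mapping.lookup \<omega> (i, Top))"
proof -
  let ?w = "Poly_Mapping.lookup \<omega>"
  define s where "s i = ?w (i, Top) + ?w (i, Bottom)" for i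
  have tail: "(\<Sum>e | e \<in> arcs (\<Gamma> g) \<and> tail (\<Gamma> g) e = v. ?w e) = (if v < g then s v else 0)" for v
  proof -
    have "{e \<in> arcs (\<Gamma> g). tail (\<Gamma> g) e = v} = (if v < g then {(v, Top), (v, Bottom)} else {})"
      by (auto simp: arcs_chain tail_chain)
    then show ?thesis by (simp add: s_def)
  qed
  have head: "(\<Sum>e | e \<in> arcs (\<Gamma> g) \<and> head (\<Gamma> g) e = v. ?w e) = (if 0 < v then s (v - 1) else 0)" if "v \<le> g" for v
  proof -
    have "{e \<in> arcs (\<Gamma> g). head (\<Gamma> g) e = v} = (if 0 < v then {(v - 1, Top), (v - 1, Bottom)} else {})"
      using that by (auto simp: arcs_chain head_chain)
    then show ?thesis by (simp add: s_def)
  qed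
  have "(\<forall>v\<le>g. (if v < g then s v else 0) = (if 0 < v then s (v - 1) else 0)) \<longleftrightarrow> (\<forall>i<g. s i = 0)"
    (is "?A \<longleftrightarrow> ?B")
  proof
    assume A: ?A
    have "s i = 0" if "i < g" for i
      using that
    proof (induction i)
      case 0
      then show ?case using A[rule_format, of 0] by simp
    next
      case (Suc i)
      then show ?case using A[rule_format, of "Suc i"] by simp
    qed
    then show ?B by blast
  qed auto
  moreover have "s i = 0 \<longleftrightarrow> ?w (i, Bottom) = - ?w (i, Top)" for i
    by (auto simp: s_def)
  moreover have "(\<forall>v\<in>verts (\<Gamma> g).
      (\<Sum>e | e \<in> arcs (\<Gamma> g) \<and> tail (\<Gamma> g) e = v. ?w e) = (\<Sum>e | e \<in> arcs (\<Gamma> g) \<and> head (\<Gamma> g) e = v. ?w e)) \<longleftrightarrow>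
    (\<forall>v\<in>{..g}. (if v < g then s v else 0) = (if 0 < v then s (v - 1) else 0))"
    unfolding verts_chain by (intro ball_cong refl) (simp only: tail head atMost_iff)
  ultimately show ?thesis
    unfolding real_cycles_def by (simp add: arcs_chain Ball_def)
qed

lemma cycle_pairing_chain:
  assumes "\<eta> \<in> real_cycles (\<Gamma> g)" "\<omega> \<in> real_cycles (\<Gamma> g)"
  shows "cycle_pairing (\<Gamma> g) \<eta> \<omega> =
    (\<Sum>i<g. Poly_Mapping.lookup \<omega> (i, Top) * (real k * Poly_Mapping.lookup \<eta> (i, Top)))"
proof -
  have "cycle_pairing (\<Gamma> g) \<eta> \<omega> =
      (\<Sum>i<g. \<Sum>s\<in>{Top, Bottom}. elen (i, s) * Poly_Mapping.lookup \<eta> (i, s) * Poly_Mapping.lookup \<omega> (i, s))"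
    unfolding cycle_pairing_def arcs_chain len_chain sum.cartesian_product by (rule sum.cong) auto
  also have "\<dots> = (\<Sum>i<g. Poly_Mapping.lookup \<omega> (i, Top) * (real k * Poly_Mapping.lookup \<eta> (i, Top)))"
    using assms by (intro sum.cong) (auto simp: real_cycles_iff algebra_simps)
  finally show ?thesis .
qed

lemma chain_integral_winding:
  assumes "c \<in> chains (\<Gamma> g)" "\<omega> \<in> real_cycles (\<Gamma> g)"
  shows "chain_integral c \<omega> = (\<Sum>i<g. Poly_Mapping.lookup \<omega> (i, Top) * evaluate (winding i) c)"
proof -
  have seg: "(t - s) * Poly_Mapping.lookup \<omega> e = (\<Sum>i<g. Poly_Mapping.lookup \<omega> (i, Top) * winding i (e, s, t))"
    if "(e, s, t) \<in> Poly_Mapping.keys c" for e s t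
  proof -
    have e: "fst e < g"
      using that assms(1) by (auto simp: chains_def arcs_chain)
    have "(\<Sum>i<g. Poly_Mapping.lookup \<omega> (i, Top) * winding i (e, s, t)) =
        (\<Sum>i\<in>{fst e}. Poly_Mapping.lookup \<omega> (i, Top) * winding i (e, s, t))"
      using e by (intro sum.mono_neutral_right) (auto simp: winding_def)
    also have "\<dots> = (t - s) * Poly_Mapping.lookup \<omega> e"
      using e assms(2) by (cases e; cases "snd e") (auto simp: winding_def real_cycles_iff algebra_simps)
    finally show ?thesis ..
  qed
  have "chain_integral c \<omega> = (\<Sum>x\<in>Poly_Mapping.keys c. \<Sum>i<g.
      of_int (Poly_Mapping.lookup c x) * (Poly_Mapping.lookup \<omega> (i, Top) * winding i x))"
    unfolding chain_integral_def
    by (rule sum.cong) (auto simp: seg mult.assoc simp flip: sum_distrib_left)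
  also have "\<dots> = (\<Sum>i<g. \<Sum>x\<in>Poly_Mapping.keys c.
      of_int (Poly_Mapping.lookup c x) * (Poly_Mapping.lookup \<omega> (i, Top) * winding i x))"
    by (rule sum.swap)
  also have "\<dots> = (\<Sum>i<g. Poly_Mapping.lookup \<omega> (i, Top) * evaluate (winding i) c)"
    by (simp add: evaluate_def sum_distrib_left mult.left_commute)
  finally show ?thesis .
qed

definition loop :: "nat \<Rightarrow> (nat \<times> side) \<Rightarrow>\<^sub>0 real" where
  "loop i = Poly_Mapping.single (i, Top) 1 - Poly_Mapping.single (i, Bottom) 1"

lemma lookup_loop: "Poly_Mapping.lookup (loop i) (j, s) = (if j = i then (case s of Top \<Rightarrow> 1 | Bottom \<Rightarrow> -1) else 0)"
  by (cases s) (auto simp: loop_def lookup_minus lookup_single when_def)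

lemma loop_real_cycles: "i < g \<Longrightarrow> loop i \<in> real_cycles (\<Gamma> g)"
proof -
  assume i: "i < g"
  have "e \<in> {..<g} \<times> {Top, Bottom}" if "e \<in> Poly_Mapping.keys (loop i)" for e
    using that i side_UNIV[of "snd e"] lookup_loop[of i "fst e" "snd e"]
    by (cases e) (auto simp: in_keys_iff split: if_splits)
  then show ?thesis
    by (auto simp: real_cycles_iff lookup_loop)
qed

text \<open>Testing against the loops suffices, since both sides are linear in the top coefficients
  of the form.\<close>

lemma chain_periods_iff:
  assumes "c \<in> chains (\<Gamma> g)" "\<eta> \<in> real_cycles (\<Gamma> g)"
  shows "(\<forall>\<omega>\<in>real_cycles (\<Gamma> g). chain_integral c \<omega> = cycle_pairing (\<Gamma> g) \<eta> \<omega>) \<longleftrightarrow>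
    (\<forall>i<g. evaluate (winding i) c = real k * Poly_Mapping.lookup \<eta> (i, Top))" (is "?L \<longleftrightarrow> ?R")
proof
  assume L: ?L
  show ?R
  proof (intro allI impI)
    fix i assume i: "i < g"
    have pick: "(\<Sum>j<g. Poly_Mapping.lookup (loop i) (j, Top) * x j) = x i" for x
    proof -
      have "(\<Sum>j<g. Poly_Mapping.lookup (loop i) (j, Top) * x j) = (\<Sum>j<g. if j = i then x j else 0)"
        by (rule sum.cong) (auto simp: lookup_loop)
      then show ?thesis
        using i by simp
    qed
    show "evaluate (winding i) c = real k * Poly_Mapping.lookup \<eta> (i, Top)"
      using L[rule_format, OF loop_real_cycles[OF i]]
      unfolding chain_integral_winding[OF assms(1) loop_real_cycles[OF i]]
        cycle_pairing_chain[OF assms(2) loop_real_cycles[OF i]] pick .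
  qed
next
  assume ?R
  then show ?L
    using chain_integral_winding[OF assms(1)] cycle_pairing_chain[OF assms(2)] by simp
qed

lemma period_segment:
  assumes "e \<in> arcs (\<Gamma> g)" "s \<in> {0..elen e}" "t \<in> {0..elen e}"
  shows "period (crd i (edge_point (\<Gamma> g) e t) - crd i (edge_point (\<Gamma> g) e s) - winding i (e, s, t))"
proof -
  \<comment> \<open>A lift of the coordinate from the circle to the line along \<open>e\<close>. It
    differs from \<open>crd i\<close> only at the right end of the bottom edge of cycle
    \<open>i\<close>, and there by \<open>k\<close>.\<close>
  define \<psi> where "\<psi> u = (if fst e < i then 0 else if i < fst e then real l else case snd e of Top \<Rightarrow> u | Bottom \<Rightarrow> - u)" for u
  have lift: "period (crd i (edge_point (\<Gamma> g) e u) - \<psi> u)" if "u \<in> {0..elen e}" for u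
  proof -
    obtain j z where e: "e = (j, z)"
      by (cases e)
    have "u = 0 \<or> (0 < u \<and> u < elen e) \<or> u = elen e"
      using that by auto
    then show ?thesis
    proof (elim disjE)
      assume "u = elen e"
      then show ?thesis
        using elen_pos[of e] period_k[of 1] by (cases z) (auto simp: e edge_point_chain \<psi>_def)
    qed (cases z; auto simp: e edge_point_chain \<psi>_def)+
  qed
  have "period ((crd i (edge_point (\<Gamma> g) e t) - \<psi> t) - (crd i (edge_point (\<Gamma> g) e s) - \<psi> s))"
    by (rule period_diff[OF lift[OF assms(3)] lift[OF assms(2)]])
  moreover have "\<psi> t - \<psi> s = winding i (e, s, t)"
    by (cases "snd e") (auto simp: \<psi>_def winding_def)
  ultimately show ?thesis
    by (simp add: algebra_simps)
qed

lemma period_chain_boundary: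
  assumes "c \<in> chains (\<Gamma> g)"
  shows "period (evaluate (crd i) (chain_boundary (\<Gamma> g) c) - evaluate (winding i) c)"
proof -
  have "evaluate (crd i) (chain_boundary (\<Gamma> g) c) - evaluate (winding i) c =
      evaluate (\<lambda>x. evaluate (crd i) ((\<lambda>(e, s, t). frag_of (edge_point (\<Gamma> g) e t) - frag_of (edge_point (\<Gamma> g) e s)) x) - winding i x) c"
    unfolding chain_boundary_def evaluate_frag_extend evaluate_diff_fun ..
  also have "period \<dots>"
  proof (rule period_evaluate)
    fix x assume x: "x \<in> Poly_Mapping.keys c"
    obtain e s t where est: "x = (e, s, t)"
      by (cases x)
    have "e \<in> arcs (\<Gamma> g)" "s \<in> {0..elen e}" "t \<in> {0..elen e}"
      using x assms unfolding est by (auto simp: chains_def len_chain)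
    then show "period (evaluate (crd i) ((\<lambda>(e, s, t). frag_of (edge_point (\<Gamma> g) e t) - frag_of (edge_point (\<Gamma> g) e s)) x) - winding i x)"
      using period_segment[of e g s t i] by (simp add: est evaluate_diff)
  qed
  finally show ?thesis .
qed

lemma chains_add: "a \<in> chains G \<Longrightarrow> b \<in> chains G \<Longrightarrow> a + b \<in> chains G"
  using Poly_Mapping.keys_add[of a b] by (auto simp: chains_def)

lemma chains_diff: "a \<in> chains G \<Longrightarrow> b \<in> chains G \<Longrightarrow> a - b \<in> chains G"
  using keys_diff[of a b] by (auto simp: chains_def)

lemma chains_cmul: "a \<in> chains G \<Longrightarrow> frag_cmul m a \<in> chains G"
  using keys_cmul[of m a] by (auto simp: chains_def)

lemma segment_chain:
  assumes "fst e < g" "s \<in> {0..elen e}" "t \<in> {0..elen e}"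
  shows "frag_of (e, s, t) \<in> chains (\<Gamma> g)"
    "chain_boundary (\<Gamma> g) (frag_of (e, s, t)) = frag_of (edge_point (\<Gamma> g) e t) - frag_of (edge_point (\<Gamma> g) e s)"
  using assms side_UNIV[of "snd e"] by (cases e; auto simp: chains_def arcs_chain len_chain chain_boundary_def)+

text \<open>A path along top edges up to the edge of \<open>p\<close> has the coordinates as its
  exact windings, not only modulo \<open>k\<close>.\<close>

lemma path_from_origin:
  assumes "p \<in> points (\<Gamma> g)"
  shows "\<exists>c\<in>chains (\<Gamma> g). chain_boundary (\<Gamma> g) c = frag_of p - frag_of (Vertex 0) \<and>
    (\<forall>i. evaluate (winding i) c = crd i p)"
proof -
  have V: "\<exists>c\<in>chains (\<Gamma> g). chain_boundary (\<Gamma> g) c = frag_of (Vertex v) - frag_of (Vertex 0) \<and>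
    (\<forall>i. evaluate (winding i) c = crd i (Vertex v))" if "v \<le> g" for v
    using that
  proof (induction v)
    case 0
    show ?case
      by (intro bexI[of _ 0]) (auto simp: chains_def chain_boundary_def)
  next
    case (Suc v)
    then obtain c where c: "c \<in> chains (\<Gamma> g)" "chain_boundary (\<Gamma> g) c = frag_of (Vertex v) - frag_of (Vertex 0)"
      "\<And>i. evaluate (winding i) c = crd i (Vertex v)"
      by force
    let ?c = "frag_of ((v, Top), 0, real l)"
    have "?c \<in> chains (\<Gamma> g)" "chain_boundary (\<Gamma> g) ?c = frag_of (Vertex (Suc v)) - frag_of (Vertex v)"
      using segment_chain[of "(v, Top)" g 0 "real l"] Suc.prems l1 by (auto simp: edge_point_chain)
    moreover have "evaluate (winding i) (c + ?c) = crd i (Vertex (Suc v))" for i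
      using c(3)[of i] by (auto simp: evaluate_add winding_def)
    ultimately show ?case
      using c by (intro bexI[of _ "c + ?c"] conjI allI chains_add) (auto simp: chain_boundary_def frag_extend_add)
  qed
  show ?thesis
  proof (cases p)
    case (Vertex v)
    then show ?thesis
      using V assms by (simp add: points_iff)
  next
    case (Interior e t)
    obtain j z where e: "e = (j, z)"
      by (cases e)
    have j: "j < g" "0 < t" "t < elen e"
      using assms Interior e by (auto simp: points_iff elen_def)
    then obtain c where c: "c \<in> chains (\<Gamma> g)" "chain_boundary (\<Gamma> g) c = frag_of (Vertex j) - frag_of (Vertex 0)"
      "\<And>i. evaluate (winding i) c = crd i (Vertex j)"
      using V[of j] by force
    let ?c = "frag_of (e, 0, t)"
    have "?c \<in> chains (\<Gamma> g)" "chain_boundary (\<Gamma> g) ?c = frag_of p - frag_of (Vertex j)"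
      using segment_chain[of e g 0 t] j by (auto simp: edge_point_chain Interior e)
    moreover have "evaluate (winding i) (c + ?c) = crd i p" for i
      using c(3)[of i] by (cases z) (auto simp: evaluate_add winding_def Interior e)
    ultimately show ?thesis
      using c by (intro bexI[of _ "c + ?c"] conjI allI chains_add) (auto simp: chain_boundary_def frag_extend_add)
  qed
qed

lemma chain_from_origin:
  assumes "Poly_Mapping.keys E \<subseteq> points (\<Gamma> g)"
  shows "\<exists>c\<in>chains (\<Gamma> g). chain_boundary (\<Gamma> g) c = E - frag_cmul (divisor_degree E) (frag_of (Vertex 0)) \<and>
    (\<forall>i. evaluate (winding i) c = evaluate (crd i) E)"
  using assms
proof (induction E rule: frag_induction)
  case zero
  show ?case
    by (intro bexI[of _ 0]) (auto simp: chains_def chain_boundary_def divisor_degree_def)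
next
  case (one p)
  then show ?case
    using path_from_origin[of p g] by (simp add: divisor_degree_def)
next
  case (diff a b)
  then obtain c c' where "c \<in> chains (\<Gamma> g)" "chain_boundary (\<Gamma> g) c = a - frag_cmul (divisor_degree a) (frag_of (Vertex 0))"
    "\<And>i. evaluate (winding i) c = evaluate (crd i) a"
    and "c' \<in> chains (\<Gamma> g)" "chain_boundary (\<Gamma> g) c' = b - frag_cmul (divisor_degree b) (frag_of (Vertex 0))"
    "\<And>i. evaluate (winding i) c' = evaluate (crd i) b"
    by blast
  then show ?case
    by (intro bexI[of _ "c - c'"] conjI allI chains_diff)
      (auto simp: chain_boundary_def frag_extend_diff divisor_degree_diff frag_cmul_diff_distrib evaluate_diff)
qed

text \<open>Going \<open>n i\<close> times around cycle \<open>i\<close> realises the period lattice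
  by boundaryless chains.\<close>

lemma closed_chain:
  fixes n :: "nat \<Rightarrow> int"
  assumes "m \<le> g"
  shows "\<exists>c\<in>chains (\<Gamma> g). chain_boundary (\<Gamma> g) c = 0 \<and>
    (\<forall>i. evaluate (winding i) c = (if i < m then of_int (n i) * real k else 0))"
  using assms
proof (induction m)
  case 0
  show ?case
    by (intro bexI[of _ 0]) (auto simp: chains_def chain_boundary_def)
next
  case (Suc m)
  then obtain c where c: "c \<in> chains (\<Gamma> g)" "chain_boundary (\<Gamma> g) c = 0"
    "\<And>i. evaluate (winding i) c = (if i < m then of_int (n i) * real k else 0)"
    by force
  let ?t = "frag_of ((m, Top), 0, real l)" and ?b = "frag_of ((m, Bottom), 0, real k - real l)"
  have "?t \<in> chains (\<Gamma> g)" "?b \<in> chains (\<Gamma> g)"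
    "chain_boundary (\<Gamma> g) ?t = chain_boundary (\<Gamma> g) ?b"
    using segment_chain[of "(m, Top)" g 0 "real l"] segment_chain[of "(m, Bottom)" g 0 "real k - real l"] Suc.prems l1 lk
    by (auto simp: edge_point_chain)
  moreover have "evaluate (winding i) (c + frag_cmul (n m) (?t - ?b)) = (if i < Suc m then of_int (n i) * real k else 0)" for i
    using c(3)[of i] by (auto simp: evaluate_add evaluate_cmul evaluate_diff winding_def less_Suc_eq)
  ultimately show ?case
    using c by (intro bexI[of _ "c + frag_cmul (n m) (?t - ?b)"] conjI allI chains_add chains_cmul chains_diff)
      (auto simp: chain_boundary_def frag_extend_add frag_extend_cmul frag_extend_diff)
qed

text \<open>The windings of a chain are determined modulo \<open>k\<close> by its boundary, and
  closed chains remove the remaining multiples of \<open>k\<close>. The covering is thus the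
  quotient onto a product of circles of length \<open>k\<close>, one per cycle.\<close>

lemma Pic_covering_chain:
  assumes D0: "D0 \<in> divisors (\<Gamma> g) d" and \<eta>: "\<eta> \<in> real_cycles (\<Gamma> g)"
  shows "Pic_covering (\<Gamma> g) D0 \<eta> = {D \<in> divisors (\<Gamma> g) d.
    \<forall>i<g. period (evaluate (crd i) D - evaluate (crd i) D0 - real k * Poly_Mapping.lookup \<eta> (i, Top))}"
proof -
  have deg: "divisor_degree D0 = d"
    using D0 by (simp add: divisors_def)
  have "(\<exists>c\<in>chains (\<Gamma> g). chain_boundary (\<Gamma> g) c = D - D0 \<and>
      (\<forall>\<omega>\<in>real_cycles (\<Gamma> g). chain_integral c \<omega> = cycle_pairing (\<Gamma> g) \<eta> \<omega>)) \<longleftrightarrow>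
    (\<forall>i<g. period (evaluate (crd i) D - evaluate (crd i) D0 - real k * Poly_Mapping.lookup \<eta> (i, Top)))"
    (is "?L \<longleftrightarrow> ?R") if D: "D \<in> divisors (\<Gamma> g) d" for D
  proof
    assume ?L
    then obtain c where c: "c \<in> chains (\<Gamma> g)" "chain_boundary (\<Gamma> g) c = D - D0"
      "\<And>i. i < g \<Longrightarrow> evaluate (winding i) c = real k * Poly_Mapping.lookup \<eta> (i, Top)"
      using chain_periods_iff[OF _ \<eta>] by blast
    show ?R
      using period_chain_boundary[OF c(1)] c(2,3) by (metis evaluate_diff)
  next
    assume R: ?R
    have keys: "Poly_Mapping.keys (D - D0) \<subseteq> points (\<Gamma> g)"
      using keys_diff[of D D0] D D0 by (auto simp: divisors_def)
    have "divisor_degree (D - D0) = 0"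
      using D deg by (simp add: divisor_degree_diff divisors_def)
    then obtain c where c: "c \<in> chains (\<Gamma> g)" "chain_boundary (\<Gamma> g) c = D - D0"
      "\<And>i. evaluate (winding i) c = evaluate (crd i) D - evaluate (crd i) D0"
      using chain_from_origin[OF keys] by (auto simp: evaluate_diff)
    have "\<forall>i. \<exists>n::int. i < g \<longrightarrow> evaluate (crd i) D - evaluate (crd i) D0 - real k * Poly_Mapping.lookup \<eta> (i, Top) = of_int n * real k"
      using R by (auto simp: period_def)
    then obtain n :: "nat \<Rightarrow> int" where n: "\<And>i. i < g \<Longrightarrow>
        evaluate (crd i) D - evaluate (crd i) D0 - real k * Poly_Mapping.lookup \<eta> (i, Top) = of_int (n i) * real k"
      by metis
    obtain b where b: "b \<in> chains (\<Gamma> g)" "chain_boundary (\<Gamma> g) b = 0"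
      "\<And>i. evaluate (winding i) b = (if i < g then of_int (n i) * real k else 0)"
      using closed_chain[of g g n] by auto
    have "evaluate (winding i) (c - b) = real k * Poly_Mapping.lookup \<eta> (i, Top)" if "i < g" for i
      using c(3)[of i] b(3)[of i] n[OF that] that by (simp add: evaluate_diff)
    moreover have "c - b \<in> chains (\<Gamma> g)"
      using b c chains_diff by blast
    moreover have "chain_boundary (\<Gamma> g) (c - b) = D - D0"
      using b c by (simp add: chain_boundary_def frag_extend_diff)
    ultimately show ?L
      using chain_periods_iff[OF _ \<eta>] by blast
  qed
  then show ?thesis
    unfolding Pic_covering_def deg by blast
qed

section \<open>Brill-Noether loci as unions of cells\<close>

definition flow :: "nat \<Rightarrow> (nat \<Rightarrow> real) \<Rightarrow> (nat \<times> side) \<Rightarrow>\<^sub>0 real" where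
  "flow g a = (\<Sum>i<g. a i *\<^sub>R loop i)"

lemma lookup_flow:
  "Poly_Mapping.lookup (flow g a) (j, s) = (if j < g then (case s of Top \<Rightarrow> a j | Bottom \<Rightarrow> - a j) else 0)"
proof -
  have "Poly_Mapping.lookup (flow g a) (j, s) = (\<Sum>i<g. if i = j then (case s of Top \<Rightarrow> a i | Bottom \<Rightarrow> - a i) else 0)"
    unfolding flow_def lookup_sum lookup_scaleR lookup_loop by (rule sum.cong) (auto split: side.split)
  then show ?thesis
    by (simp add: sum.delta)
qed

lemma flow_real_cycles: "flow g a \<in> real_cycles (\<Gamma> g)"
proof -
  have "e \<in> {..<g} \<times> {Top, Bottom}" if "e \<in> Poly_Mapping.keys (flow g a)" for e
    using that side_UNIV[of "snd e"] by (cases e) (auto simp: in_keys_iff lookup_flow split: if_splits)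
  then show ?thesis
    by (auto simp: real_cycles_iff lookup_flow)
qed

lemma flow_diff: "flow g a - flow g b = flow g (\<lambda>i. a i - b i)"
  by (simp add: flow_def scaleR_diff_left sum_subtractf)

text \<open>The covering sends \<open>a i\<close> to the coordinate \<open>k * a i\<close>, so
  \<open>{0..1}\<close> is one full turn, and the singleton solves the congruence of the letter
  \<open>z\<close>.\<close>

definition range_of :: "int \<Rightarrow> (nat \<Rightarrow> int option) \<Rightarrow> nat \<Rightarrow> real set" where
  "range_of d w i = (case w i of None \<Rightarrow> {0..1}
    | Some z \<Rightarrow> {- (of_int (z + int i - d) * real l) / real k})"

definition cell :: "nat \<Rightarrow> int \<Rightarrow> (nat \<Rightarrow> int option) \<Rightarrow> ((nat \<times> side) \<Rightarrow>\<^sub>0 real) set" where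
  "cell g d w = {flow g a | a. \<forall>i<g. a i \<in> range_of d w i}"

lemma range_of_nonempty: "\<exists>a. \<forall>i. a i \<in> range_of d w i"
proof -
  have "\<forall>i. \<exists>u. u \<in> range_of d w i"
    by (auto simp: range_of_def split: option.split intro: exI[of _ 0])
  then show ?thesis
    by (rule choice)
qed

text \<open>A cell is a Minkowski sum of segments and single points, one for each cycle.\<close>

lemma polytope_cell: "polytope (cell g d w)"
proof -
  define S where "S i = (\<lambda>u. u *\<^sub>R loop i) ` range_of d w i" for i
  have "polytope (S i)" for i
  proof (cases "w i")
    case None
    have "S i = closed_segment 0 (loop i)"
      using None by (auto simp: S_def range_of_def closed_segment_def)
    then show ?thesis
      unfolding polytope_def segment_convex_hull by (intro exI[of _ "{0, loop i}"]) simp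
  next
    case (Some z)
    then show ?thesis
      by (auto simp: S_def range_of_def polytope_def intro: exI[of _ "{v}" for v])
  qed
  then have "polytope {\<Sum>i<g. s i | s. \<forall>i\<in>{..<g}. s i \<in> S i}"
    by (intro polytope_set_sum) auto
  also have "{\<Sum>i<g. s i | s. \<forall>i\<in>{..<g}. s i \<in> S i} = cell g d w"
  proof
    show "{\<Sum>i<g. s i | s. \<forall>i\<in>{..<g}. s i \<in> S i} \<subseteq> cell g d w"
    proof safe
      fix s assume "\<forall>i\<in>{..<g}. s i \<in> S i"
      then have "\<forall>i\<in>{..<g}. \<exists>u. u \<in> range_of d w i \<and> s i = u *\<^sub>R loop i"
        by (auto simp: S_def)
      then obtain a where "\<And>i. i < g \<Longrightarrow> a i \<in> range_of d w i" "\<And>i. i < g \<Longrightarrow> s i = a i *\<^sub>R loop i"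
        by (metis lessThan_iff)
      then show "sum s {..<g} \<in> cell g d w"
        by (auto simp: cell_def flow_def intro!: exI[of _ a])
    qed
    show "cell g d w \<subseteq> {\<Sum>i<g. s i | s. \<forall>i\<in>{..<g}. s i \<in> S i}"
    proof
      fix \<eta> assume "\<eta> \<in> cell g d w"
      then obtain a where "\<eta> = flow g a" "\<And>i. i < g \<Longrightarrow> a i \<in> range_of d w i"
        by (auto simp: cell_def)
      then show "\<eta> \<in> {\<Sum>i<g. s i | s. \<forall>i\<in>{..<g}. s i \<in> S i}"
        by (auto simp: flow_def S_def intro!: exI[of _ "\<lambda>i. a i *\<^sub>R loop i"])
    qed
  qed
  finally show ?thesis .
qed

lemma affine_dimension_cell:
  "affine_dimension (cell g d w) = card {i. i < g \<and> w i = None}"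
proof -
  define N where "N = {i. i < g \<and> w i = None}"
  define V where "V = {x - y | x y. x \<in> cell g d w \<and> y \<in> cell g d w}"
  have inj: "inj_on loop N"
  proof (rule inj_onI)
    fix i j assume "loop i = loop j"
    then have "Poly_Mapping.lookup (loop i) (i, Top) = Poly_Mapping.lookup (loop j) (i, Top)"
      by simp
    then show "i = j"
      by (auto simp: lookup_loop split: if_splits)
  qed
  have "dim V = card N"
  proof (rule dim_unique)
    show "loop ` N \<subseteq> V"
    proof
      fix x assume "x \<in> loop ` N"
      then obtain i where i: "i < g" "w i = None" "x = loop i"
        by (auto simp: N_def)
      obtain a where a: "\<And>i. a i \<in> range_of d w i"
        using range_of_nonempty by blast
      \<comment> \<open>Switching a free coordinate between the ends of \<open>{0..1}\<close>
        exhibits the loop itself as a difference of two points of the cell.\<close>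
      have "flow g (a(i := 1)) - flow g (a(i := 0)) = (\<Sum>j<g. if j = i then loop j else 0)"
        unfolding flow_diff unfolding flow_def by (rule sum.cong) auto
      then have "x = flow g (a(i := 1)) - flow g (a(i := 0))"
        using i by simp
      moreover have "\<forall>j<g. (a(i := 1)) j \<in> range_of d w j" "\<forall>j<g. (a(i := 0)) j \<in> range_of d w j"
        using a i by (auto simp: range_of_def)
      then have "flow g (a(i := 1)) \<in> cell g d w" "flow g (a(i := 0)) \<in> cell g d w"
        unfolding cell_def by blast+
      ultimately show "x \<in> V"
        unfolding V_def by blast
    qed
    show "V \<subseteq> span (loop ` N)"
    proof
      fix x assume "x \<in> V"
      then obtain a b where x: "x = flow g a - flow g b" and ab: "\<And>i. i < g \<Longrightarrow> a i \<in> range_of d w i" "\<And>i. i < g \<Longrightarrow> b i \<in> range_of d w i"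
        by (auto simp: V_def cell_def)
      have "(a i - b i) *\<^sub>R loop i \<in> span (loop ` N)" if "i < g" for i
      proof (cases "w i")
        case None
        then show ?thesis
          using that by (intro span_mul span_base) (auto simp: N_def)
      next
        case (Some z)
        then have "a i = b i"
          using ab[OF that] by (simp add: range_of_def)
        then show ?thesis
          by (simp add: span_zero)
      qed
      then show "x \<in> span (loop ` N)"
        unfolding x flow_diff unfolding flow_def by (intro span_sum) auto
    qed
    show "independent (loop ` N)"
    proof (rule independent_if_scalars_zero)
      show "finite (loop ` N)"
        by (simp add: N_def)
      fix f x assume sum0: "(\<Sum>x\<in>loop ` N. f x *\<^sub>R x) = 0" and "x \<in> loop ` N"
      then obtain i where i: "i \<in> N" "x = loop i"
        by blast
      have "0 = Poly_Mapping.lookup (\<Sum>x\<in>loop ` N. f x *\<^sub>R x) (i, Top)"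
        by (simp add: sum0)
      also have "\<dots> = (\<Sum>j\<in>N. f (loop j) *\<^sub>R Poly_Mapping.lookup (loop j) (i, Top))"
        by (simp add: sum.reindex[OF inj] lookup_sum lookup_scaleR)
      also have "\<dots> = (\<Sum>j\<in>N. if j = i then f (loop j) else 0)"
        by (rule sum.cong) (auto simp: lookup_loop)
      also have "\<dots> = f x"
        using i by (simp add: N_def)
      finally show "f x = 0" ..
    qed
    show "card (loop ` N) = card N"
      by (rule card_image[OF inj])
  qed
  then show ?thesis
    by (simp add: affine_dimension_def V_def N_def)
qed

text \<open>Representatives in \<open>{0..<int k}\<close> leave finitely many words, hence finitely
  many cells.\<close>

definition normal_residue :: "int \<Rightarrow> (nat \<Rightarrow> real) \<Rightarrow> nat \<Rightarrow> int option" where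
  "normal_residue d x n = map_option (\<lambda>z. z mod int k) (residue d x n)"

lemma beads_mod: "beads k (\<lambda>i. map_option (\<lambda>z. z mod int k) (w i)) n = beads k w n"
proof (induction n)
  case (Suc n)
  have dvd: "int k dvd y - z mod int k \<longleftrightarrow> int k dvd y - z" for y z
    by (metis mod_eq_dvd_iff mod_mod_trivial)
  have "bead_step k (map_option (\<lambda>z. z mod int k) v) f = bead_step k v f" for v f
    by (cases v) (simp_all add: bead_step_def fun_eq_iff dvd)
  then show ?case
    using Suc by simp
qed simp

lemma period_shift:
  assumes "int k dvd z - z'"
  shows "period (x + of_int (z + m) * real l) \<longleftrightarrow> period (x + of_int (z' + m) * real l)"
proof -
  have "x + of_int (z + m) * real l = of_int (z - z') * real l + (x + of_int (z' + m) * real l)"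
    by (simp add: algebra_simps)
  moreover have "period (of_int (z - z') * real l)"
    using assms by (simp only: period_int_mult_l)
  ultimately show ?thesis
    by (metis period_add_cancel)
qed

lemma normal_residue_SomeD:
  assumes "normal_residue d x n = Some z"
  shows "0 \<le> z" "z < int k" "period (x n + of_int (z + int n - d) * real l)"
proof -
  obtain z' where z': "residue d x n = Some z'" "z = z' mod int k"
    using assms by (auto simp: normal_residue_def)
  show "0 \<le> z" "z < int k"
    using lk z' by simp_all
  have "int k dvd z' - z"
    unfolding z' by (metis dvd_minus_mod)
  then show "period (x n + of_int (z + int n - d) * real l)"
    using residue_SomeD[OF z'(1)] period_shift[of z' z "x n" "int n - d"] by (simp add: algebra_simps)
qed

lemma normal_residue_SomeI:
  assumes "0 \<le> z" "z < int k" "period (x n + of_int (z + int n - d) * real l)"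
  shows "normal_residue d x n = Some z"
proof -
  obtain z' where z': "residue d x n = Some z'"
    using residue_NoneD[of d x n "z + int n - d"] assms(3) by (cases "residue d x n") auto
  have "x n + of_int (z' + int n - d) * real l - (x n + of_int (z + int n - d) * real l) = of_int (z' - z) * real l"
    by (simp add: algebra_simps)
  then have "period (of_int (z' - z) * real l)"
    using period_diff[OF residue_SomeD[OF z'] assms(3)] by (simp only:)
  then have "int k dvd z' - z"
    by (simp only: period_int_mult_l)
  then have "z' mod int k = z mod int k"
    by (simp add: mod_eq_dvd_iff)
  then show ?thesis
    using z' assms by (simp add: normal_residue_def)
qed

definition admissible :: "nat \<Rightarrow> int \<Rightarrow> nat \<Rightarrow> (nat \<Rightarrow> int option) set" where
  "admissible g d r = {w \<in> {..<g} \<rightarrow>\<^sub>E insert None (Some ` {0..<int k}). beads k w g r \<le> d - int g}"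

lemma finite_admissible: "finite (admissible g d r)"
proof -
  have "finite ({..<g} \<rightarrow>\<^sub>E insert None (Some ` {0..<int k}))"
    by (intro finite_PiE) auto
  then show ?thesis
    by (rule rev_finite_subset) (auto simp: admissible_def)
qed

lemma origin_divisor: "frag_cmul d (frag_of (Vertex 0)) \<in> divisors (\<Gamma> g) d"
proof -
  have "real_of_int (divisor_degree (frag_cmul d (frag_of (Vertex 0)))) = of_int d"
    by (simp add: divisor_degree_evaluate evaluate_cmul)
  then show ?thesis
    by (auto simp: divisors_def points_iff dest: subsetD[OF keys_cmul])
qed

text \<open>Moving a chip from the left vertex of cycle \<open>m\<close> along that cycle changes no
  other coordinate, so the coordinates can be set one after another.\<close>

lemma divisor_with_coordinates:
  assumes "m \<le> g"
  shows "\<exists>D\<in>divisors (\<Gamma> g) d. \<forall>i. period (evaluate (crd i) D - (if i < m then a i else 0))"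
  using assms
proof (induction m)
  case 0
  show ?case
    by (intro bexI[OF _ origin_divisor]) (auto simp: evaluate_cmul)
next
  case (Suc m)
  then obtain D where D: "D \<in> divisors (\<Gamma> g) d"
    "\<And>i. period (evaluate (crd i) D - (if i < m then a i else 0))"
    by force
  obtain p where p: "p \<in> points (\<Gamma> (Suc m))" "\<And>i. i < m \<Longrightarrow> crd i p = real l" "period (a m - crd m p)"
    "\<And>i. m < i \<Longrightarrow> crd i p = 0"
    using ex_point_on_cycle[of m "a m"] by metis
  have sub: "points (\<Gamma> (Suc m)) \<subseteq> points (\<Gamma> g)"
    by (rule lift_Suc_mono_le[of "\<lambda>n. points (\<Gamma> n)", OF points_Suc Suc.prems])
  let ?D = "D + (frag_of p - frag_of (Vertex m))"
  have "Vertex m \<in> points (\<Gamma> g)" "Poly_Mapping.keys D \<subseteq> points (\<Gamma> g)"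
    using Suc.prems D(1) by (simp_all add: points_iff divisors_def)
  then have "Poly_Mapping.keys ?D \<subseteq> points (\<Gamma> g)"
    using Poly_Mapping.keys_add[of D "frag_of p - frag_of (Vertex m)"] keys_diff[of "frag_of p" "frag_of (Vertex m)"]
      p(1) sub unfolding keys_frag_of by blast
  moreover have "real_of_int (divisor_degree ?D) = of_int d"
    using D(1) by (simp add: divisor_degree_evaluate evaluate_add evaluate_diff)
      (simp add: divisors_def flip: divisor_degree_evaluate)
  ultimately have "?D \<in> divisors (\<Gamma> g) d"
    by (simp add: divisors_def)
  moreover have "period (evaluate (crd i) ?D - (if i < Suc m then a i else 0))" for i
  proof -
    consider "i < m" | "i = m" | "m < i"
      by linarith
    then show ?thesis
    proof cases
      case 2
      then show ?thesis
        using period_diff[OF D(2)[of m] p(3)] by (simp add: evaluate_add evaluate_diff algebra_simps)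
    qed (use D(2)[of i] p in \<open>auto simp: evaluate_add evaluate_diff\<close>)
  qed
  ultimately show ?case
    by blast
qed

lemma divisor_class_chain:
  assumes "0 < g" "D \<in> divisors (\<Gamma> g) d"
  shows "divisor_class (\<Gamma> g) D = {D' \<in> divisors (\<Gamma> g) d. \<forall>i<g. period (evaluate (crd i) D - evaluate (crd i) D')}"
  unfolding divisor_class_def using assms linearly_equivalent_iff[OF assms(1)]
  by (auto simp: divisors_def)

text \<open>A class lies in the cell of its own word of residues. Conversely, a cell can contain
  classes with further residues, at special values of a free coordinate; these only lower the beads,
  so the rank condition persists.\<close>

lemma brill_noether_locus_chain:
  assumes g: "0 < g"
  obtains D0 where "D0 \<in> divisors (\<Gamma> g) d"
    "brill_noether_locus (\<Gamma> g) (int r) d = (\<Union>P\<in>cell g d ` admissible g d r. Pic_covering (\<Gamma> g) D0 ` P)"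
proof
  define D0 :: "(nat, nat \<times> side) divisor" where "D0 = frag_cmul d (frag_of (Vertex 0))"
  show D0: "D0 \<in> divisors (\<Gamma> g) d"
    unfolding D0_def by (rule origin_divisor)
  have cover: "Pic_covering (\<Gamma> g) D0 (flow g a) = {D \<in> divisors (\<Gamma> g) d. \<forall>i<g. period (evaluate (crd i) D - real k * a i)}"
    for a
    unfolding Pic_covering_chain[OF D0 flow_real_cycles] by (auto simp: D0_def evaluate_cmul lookup_flow)
  have rank: "rank (\<Gamma> g) D \<ge> int r \<longleftrightarrow> beads k (normal_residue d (\<lambda>i. evaluate (crd i) D)) g r \<le> d - int g"
    if "D \<in> divisors (\<Gamma> g) d" for D
    using rank_ge_iff[OF g that, of r] beads_mod[of "residue d (\<lambda>i. evaluate (crd i) D)" g]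
    by (simp add: rkl_beads normal_residue_def[abs_def])
  show "brill_noether_locus (\<Gamma> g) (int r) d = (\<Union>P\<in>cell g d ` admissible g d r. Pic_covering (\<Gamma> g) D0 ` P)"
  proof
    show "brill_noether_locus (\<Gamma> g) (int r) d \<subseteq> (\<Union>P\<in>cell g d ` admissible g d r. Pic_covering (\<Gamma> g) D0 ` P)"
    proof
      fix C assume "C \<in> brill_noether_locus (\<Gamma> g) (int r) d"
      then obtain D1 D where D1: "D1 \<in> divisors (\<Gamma> g) d" "C = divisor_class (\<Gamma> g) D1"
        and D: "D \<in> C" "int r \<le> rank (\<Gamma> g) D"
        by (auto simp: brill_noether_locus_def Pic_def)
      have Dd: "D \<in> divisors (\<Gamma> g) d" and D1D: "\<And>i. i < g \<Longrightarrow> period (evaluate (crd i) D1 - evaluate (crd i) D)"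
        using D(1) unfolding D1(2) divisor_class_chain[OF g D1(1)] by auto
      define x where "x = (\<lambda>i. evaluate (crd i) D)"
      define w where "w = restrict (normal_residue d x) {..<g}"
      have "w \<in> admissible g d r"
      proof -
        have "beads k w g = beads k (normal_residue d x) g"
          by (rule beads_cong) (simp add: w_def)
        moreover have "normal_residue d x i \<in> insert None (Some ` {0..<int k})" for i
          using normal_residue_SomeD(1,2)[of d x i] by (cases "normal_residue d x i") auto
        ultimately show ?thesis
          using rank[OF Dd] D(2) by (auto simp: admissible_def w_def x_def)
      qed
      moreover have "\<exists>u. u \<in> range_of d w i \<and> period (x i - real k * u)" if i: "i < g" for i
      proof (cases "normal_residue d x i")
        case None
        obtain v where v: "0 \<le> v" "v < real k" "period (x i - v)"
          by (rule period_reduce)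
        then have "v / real k \<in> range_of d w i"
          using i None by (auto simp: range_of_def w_def field_simps)
        then show ?thesis
          using v k0 by (intro exI[of _ "v / real k"]) auto
      next
        case (Some z)
        then show ?thesis
          using i normal_residue_SomeD(3)[OF Some] k0 by (auto simp: range_of_def w_def)
      qed
      then obtain a where a: "\<And>i. i < g \<Longrightarrow> a i \<in> range_of d w i" "\<And>i. i < g \<Longrightarrow> period (x i - real k * a i)"
        by metis
      have "period (evaluate (crd i) D1 - evaluate (crd i) D') \<longleftrightarrow> period (evaluate (crd i) D' - real k * a i)"
        if "i < g" for i D'
      proof -
        let ?u = "(evaluate (crd i) D1 - evaluate (crd i) D) + (x i - real k * a i)"
        have "period ?u"
          using D1D[OF that] a(2)[OF that] by (rule period_add)
        moreover have "evaluate (crd i) D' - real k * a i = ?u + - (evaluate (crd i) D1 - evaluate (crd i) D')"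
          by (simp add: x_def)
        ultimately show ?thesis
          using period_add_cancel[of ?u] period_minus by (metis minus_minus)
      qed
      then have "C = Pic_covering (\<Gamma> g) D0 (flow g a)"
        unfolding D1(2) divisor_class_chain[OF g D1(1)] cover by auto
      moreover have "flow g a \<in> cell g d w"
        using a(1) by (auto simp: cell_def)
      ultimately show "C \<in> (\<Union>P\<in>cell g d ` admissible g d r. Pic_covering (\<Gamma> g) D0 ` P)"
        by blast
    qed
    show "(\<Union>P\<in>cell g d ` admissible g d r. Pic_covering (\<Gamma> g) D0 ` P) \<subseteq> brill_noether_locus (\<Gamma> g) (int r) d"
    proof
      fix C assume "C \<in> (\<Union>P\<in>cell g d ` admissible g d r. Pic_covering (\<Gamma> g) D0 ` P)"
      then obtain w a where w: "w \<in> admissible g d r" and a: "\<And>i. i < g \<Longrightarrow> a i \<in> range_of d w i"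
        and C: "C = Pic_covering (\<Gamma> g) D0 (flow g a)"
        by (auto simp: cell_def)
      obtain D where D: "D \<in> divisors (\<Gamma> g) d"
        and "\<forall>i. period (evaluate (crd i) D - (if i < g then real k * a i else 0))"
        using divisor_with_coordinates[where g = g and d = d and a = "\<lambda>i. real k * a i", OF order_refl] by blast
      then have D2: "period (evaluate (crd i) D - real k * a i)" if "i < g" for i
        using that by metis
      note D = D D2
      have "period (evaluate (crd i) D' - real k * a i) \<longleftrightarrow> period (evaluate (crd i) D - evaluate (crd i) D')"
        if "i < g" for i D'
      proof -
        have "evaluate (crd i) D' - real k * a i = (evaluate (crd i) D - real k * a i) + - (evaluate (crd i) D - evaluate (crd i) D')"
          by simp
        then show ?thesis
          using period_add_cancel[OF D(2)[OF that]] period_minus by (metis minus_minus)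
      qed
      then have C_class: "C = divisor_class (\<Gamma> g) D"
        unfolding C cover divisor_class_chain[OF g D(1)] by auto
      have "D \<in> C"
        unfolding C_class divisor_class_chain[OF g D(1)] using D(1) by simp
      moreover have "w i = None \<or> w i = normal_residue d (\<lambda>i. evaluate (crd i) D) i" if "i < g" for i
      proof (cases "w i")
        case (Some z)
        have "w i \<in> insert None (Some ` {0..<int k})"
          using w that by (auto simp: admissible_def PiE_iff)
        then have "0 \<le> z" "z < int k"
          using Some by auto
        moreover have "a i = - (of_int (z + int i - d) * real l) / real k"
          using a[OF that] Some by (simp add: range_of_def)
        then have "period (evaluate (crd i) D + of_int (z + int i - d) * real l)"
          using D(2)[OF that] k0 by simp
        ultimately show ?thesis
          using normal_residue_SomeI[of z "\<lambda>i. evaluate (crd i) D" i d] Some by simp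
      qed simp
      then have "beads k (normal_residue d (\<lambda>i. evaluate (crd i) D)) g r \<le> beads k w g r"
        by (intro beads_mono) auto
      then have "int r \<le> rank (\<Gamma> g) D"
        using rank[OF D(1)] w by (simp add: admissible_def)
      moreover have "C \<in> Pic (\<Gamma> g) d"
        using C_class D(1) by (auto simp: Pic_def)
      ultimately show "C \<in> brill_noether_locus (\<Gamma> g) (int r) d"
        by (auto simp: brill_noether_locus_def)
    qed
  qed
qed

section \<open>Dimension of the locus\<close>

lemma k2: "2 \<le> k"
  using l1 lk by simp

lemma admissible_dimension_le:
  assumes b: "int g - int d + int r > 0" and w: "w \<in> admissible g (int d) r"
  shows "int (card {i. i < g \<and> w i = None}) \<le> rho_bar (int g) (int k) (int d) (int r)"
proof -
  have "beads k w g r \<le> int r - (int g - int d + int r)"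
    using w by (simp add: admissible_def)
  then obtain j where "j \<in> {0..min (int r) (int g - int d + int r - 1)}"
    "(int r + 1 - j) * (int g - int d + int r - j) + j * int k \<le> int (card {i. i < g \<and> w i \<noteq> None})"
    using beads_lower_bound[OF k2, of "int g - int d + int r" w g r] b by auto
  moreover have "card {i. i < g \<and> w i \<noteq> None} \<le> card {..<g}"
    by (rule card_mono) auto
  then have "int (card {i. i < g \<and> w i = None}) = int g - int (card {i. i < g \<and> w i \<noteq> None})"
    by (simp add: card_None of_nat_diff)
  ultimately show ?thesis
    using rho_bar_ge[of j r g d k] by linarith
qed

lemma admissible_dimension_attained:
  assumes b: "int g - int d + int r > 0" and nonneg: "rho_bar (int g) (int k) (int d) (int r) \<ge> 0"
  obtains w where "w \<in> admissible g (int d) r"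
    "rho_bar (int g) (int k) (int d) (int r) \<le> int (card {i. i < g \<and> w i = None})"
proof -
  obtain j where j: "j \<in> {0..min (int r) (int g - int d + int r - 1)}"
    "rho_bar (int g) (int k) (int d) (int r) = int g - ((int r + 1 - j) * (int g - int d + int r - j) + j * int k)"
    using rho_bar_attained[OF b] by blast
  have bn: "int (nat (int g - int d + int r)) = int g - int d + int r" "1 \<le> nat (int g - int d + int r)"
    using b by simp_all
  have "\<exists>zs. (\<forall>j\<in>{0..min (int r + 1) (int g - int d + int r) - 1}.
      int (length zs) \<le> (int r + 1 - j) * (int g - int d + int r - j) + j * int k) \<and>
    beads k (letters zs) (length zs) r \<le> int d - int g"
    using beads_upper_bound[OF k2 _ bn(2), of "r + 1"] unfolding bn(1) by (simp add: add.commute)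
  then obtain zs where zs: "\<forall>j\<in>{0..min (int r + 1) (int g - int d + int r) - 1}.
      int (length zs) \<le> (int r + 1 - j) * (int g - int d + int r - j) + j * int k"
    "beads k (letters zs) (length zs) r \<le> int d - int g"
    by blast
  have "j \<in> {0..min (int r + 1) (int g - int d + int r) - 1}"
    using j(1) by auto
  then have len: "int (length zs) \<le> int g - rho_bar (int g) (int k) (int d) (int r)"
    using zs(1) unfolding j(2) by simp
  \<comment> \<open>Nonnegativity of \<open>rho_bar\<close> is what lets the word fit into the
    \<open>g\<close> cycles; the cycles after it stay free.\<close>
  then have lg: "length zs \<le> g"
    using nonneg by linarith
  define w where "w = restrict (\<lambda>i. map_option (\<lambda>z. z mod int k) (letters zs i)) {..<g}"
  have "beads k (letters zs) (length zs + n) = beads k (letters zs) (length zs)" for n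
    by (induction n) (auto simp: letters_def)
  from this[of "g - length zs"] have "beads k (letters zs) g = beads k (letters zs) (length zs)"
    using lg by simp
  moreover have "beads k w g = beads k (letters zs) g"
    unfolding beads_mod[of "letters zs" g, symmetric] by (rule beads_cong) (simp add: w_def)
  ultimately have "beads k w g r \<le> int d - int g"
    using zs(2) by simp
  moreover have "map_option (\<lambda>z. z mod int k) v \<in> insert None (Some ` {0..<int k})" for v
    using lk by (cases v) auto
  ultimately have "w \<in> admissible g (int d) r"
    by (auto simp: admissible_def w_def)
  moreover have "{i. i < g \<and> w i \<noteq> None} = {..<length zs}"
    using lg by (auto simp: w_def letters_def)
  then have "int (card {i. i < g \<and> w i = None}) = int g - int (length zs)"
    using lg by (simp add: card_None of_nat_diff)
  ultimately show thesis
    using that len by simp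
qed

end

theorem corollary3p6:
  fixes g k l r d :: nat
  assumes "g \<ge> 1" and "k \<ge> 2"
    and "int g - int d + int r > 0"
    and "1 \<le> l" and "l \<le> k - 1"
    and "coprime k l"
  shows "if rho_bar (int g) (int k) (int d) (int r) < 0
         then brill_noether_locus (chain_of_cycles g k l) (int r) (int d) = {}
         else has_polyhedral_dimension (chain_of_cycles g k l) (int d)
                (brill_noether_locus (chain_of_cycles g k l) (int r) (int d))
                (rho_bar (int g) (int k) (int d) (int r))"
proof -
  interpret cycle_chain k l
    by standard (use assms in auto)
  let ?A = "admissible g (int d) r" and ?\<rho> = "rho_bar (int g) (int k) (int d) (int r)"
  obtain D0 where D0: "D0 \<in> divisors (\<Gamma> g) (int d)"
    and W: "brill_noether_locus (\<Gamma> g) (int r) (int d) = (\<Union>P\<in>cell g (int d) ` ?A. Pic_covering (\<Gamma> g) D0 ` P)"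
    using brill_noether_locus_chain[of g "int d" r] assms(1) by auto
  have le: "int (card {i. i < g \<and> w i = None}) \<le> ?\<rho>" if "w \<in> ?A" for w
    by (rule admissible_dimension_le[OF assms(3) that])
  show ?thesis
  proof (cases "?\<rho> < 0")
    \<comment> \<open>An admissible word would bound the negative number \<open>?\<rho>\<close> from
      below by a cardinality.\<close>
    case True
    then have "?A = {}"
      using le by (force intro: of_nat_0_le_iff)
    then show ?thesis
      using True W by simp
  next
    case False
    then obtain w where w: "w \<in> ?A" "?\<rho> \<le> int (card {i. i < g \<and> w i = None})"
      using admissible_dimension_attained[OF assms(3)] by (metis not_less)
    let ?\<P> = "cell g (int d) ` ?A"
    have fin: "finite ?\<P>"
      using finite_admissible by blast
    have "Max (affine_dimension ` ?\<P>) = nat ?\<rho>"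
    proof (rule Max_eqI)
      show "finite (affine_dimension ` ?\<P>)"
        using fin by blast
      fix n assume "n \<in> affine_dimension ` ?\<P>"
      then show "n \<le> nat ?\<rho>"
        using le by (force simp: affine_dimension_cell)
    next
      have "nat ?\<rho> = affine_dimension (cell g (int d) w)"
        using w(2) le[OF w(1)] by (simp add: affine_dimension_cell)
      then show "nat ?\<rho> \<in> affine_dimension ` ?\<P>"
        using w(1) by blast
    qed
    then have "?\<rho> = int (Max (affine_dimension ` ?\<P>))"
      using False by simp
    moreover have "polytope P \<and> P \<noteq> {} \<and> P \<subseteq> real_cycles (\<Gamma> g)" if P\<P>: "P \<in> ?\<P>" for P
    proof -
      obtain w where P: "P = cell g (int d) w"
        using P\<P> by blast
      have "cell g (int d) w \<noteq> {}"
        using range_of_nonempty[of "int d" w] by (auto simp: cell_def)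
      then show ?thesis
        using polytope_cell flow_real_cycles by (auto simp: P cell_def)
    qed
    ultimately have "has_polyhedral_dimension (\<Gamma> g) (int d) (brill_noether_locus (\<Gamma> g) (int r) (int d)) ?\<rho>"
      unfolding has_polyhedral_dimension_def using D0 W fin w(1)
      by (intro bexI[of _ D0] exI[of _ ?\<P>]) auto
    then show ?thesis
      using False by simp
  qed
qed

end
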